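(* Let $\Omega\subset\mathbb{C}^n$ be a bounded pseudoconvex domain with $C^2$ boundary, and let $r=\sup_{z\in\Omega}|z|$. (1) Suppose that for some $0<\eta<1$ and $M_\eta\in\mathbb{R}$ there exists a $C^2$ defining function $\rho_\eta$ for $\Omega$ such that $\lambda_\eta=-(-\rho_\eta)^\eta$ satisfies $i\partial\bar\partial\lambda_\eta\geq M_\eta(-\lambda_\eta)\omega$ on $U_\eta\cap\Omega$ for some neighborhood $U_\eta$ of $b\Omega$. Then for every $0<s<\eta$ and every $N_s<\frac{1}{2r^2}\left(\frac{1}{s}-\frac{1}{\eta}\right)+\eta^{-1}M_\eta$ there exist a neighborhood $U_s\subset U_\eta$ of $b\Omega$ and a function $\varphi_s\in C^1(U_s)\cap C^2(U_s\setminus b\Omega)$ satisfying $$\lim_{\varepsilon\to0^+}\varepsilon\,\|\varphi_s\|_{C^2(\{z\in\Omega\cap U_s:\ \delta_\Omega(z)>\varepsilon\})}=0 \qquad (\ast)$$ such that for every $z\in U_s\cap\Omega$ and every $\tau\in T^{1,0}_z$ satisfying $\partial\tilde\delta_\Omega(\tau)=0$ we have $$N_s|\tau|^2+\frac{s}{1-s}\Big|\partial\varphi_s(\tau)|_z-2\alpha_\Omega(\tau)|_{\xi_\Omega(z)}\Big|^2\leq i\partial\bar\partial\varphi_s(\tau,\bar\tau)|_z+(-\tilde\delta_\Omega(z))^{-1}i\partial\bar\partial\tilde\delta_\Omega(\tau,\bar\tau)|_{\xi_\Omega(z)}+2\beta_\Omega(\tau,\bar\tau)|_{\xi_\Omega(z)}.\qquad(\ast\ast)$$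 (2) Suppose that for some $0<s<1$ and $N_s\in\mathbb{R}$ there exist a neighborhood $U_s$ of $b\Omega$ and a function $\varphi_s\in C^1(U_s)\cap C^2(U_s\setminus b\Omega)$ satisfying $(\ast)$ such that $(\ast\ast)$ holds for every $z\in U_s\cap\Omega$ and every $\tau\in T^{1,0}_z$ satisfying $\partial\tilde\delta_\Omega(\tau)=0$. Then for every $0<\eta<s$ and every $M_\eta<\frac{1}{2r^2}\left(1-\frac{\eta}{s}\right)+\eta N_s$ there exists a $C^2$ defining function $\rho_\eta$ for $\Omega$ such that $\lambda_\eta=-(-\rho_\eta)^\eta$ satisfies $i\partial\bar\partial\lambda_\eta\geq M_\eta(-\lambda_\eta)\omega$ on $U_\eta\cap\Omega$ for some neighborhood $U_\eta$ of $b\Omega$.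
   Context: Distance function. $\delta_\Omega(z)=\operatorname{dist}(z,b\Omega)$; the signed distance function is $\tilde\delta_\Omega=\delta_\Omega$ outside $\Omega$ and $\tilde\delta_\Omega=-\delta_\Omega$ on $\Omega$. Since $b\Omega$ is $C^2$, there is a neighborhood $U$ of $b\Omega$ on which $\tilde\delta_\Omega$ is $C^2$ and every $z\in U$ has a unique nearest point $\xi_\Omega(z)\in b\Omega$, i.e. $|z-\xi_\Omega(z)|=\delta_\Omega(z)$. The neighborhoods $U_s$ are understood to be contained in such a $U$, so that all expressions are defined. Forms and vectors. $\omega=\frac i2\partial\bar\partial|z|^2$. For a real $(1,1)$-form $\Theta$ and $X,Y\in T^{1,0}$, $\Theta(X,\bar Y)=\Theta(-iX\wedge\bar Y)$; thus for $X=\sum_jX_j\frac{\partial}{\partial z_j}$ and $Y=\sum_k Y_k\frac{\partial}{\partial z_k}$, $i\partial\bar\partial f(X,\bar Y)=\sum_{j,k}\frac{\partial^2f}{\partial z_j\partial\bar z_k}X_j\bar Y_k$. The Hermitian inner product on $T^{1,0}$ is $\langle X,Y\rangle=\omega(X,\bar Y)$, so $|X|^2=\frac12\sum_j|X_j|^2$. The inequality $i\partial\bar\partial\lambda\geq g\,\omega$ means $i\partial\bar\partial\lambda(X,\bar X)\geq g|X|^2$ for all $X\in T^{1,0}$. A vector at $z$ is also regarded as a vector at $\xi_\Omega(z)$ with the same coefficients in the coordinates of $\mathbb{C}^n$; $|_z$ and $|_{\xi_\Omega(z)}$ indicate the point at which a form is evaluated. The forms $\alpha_\Omega$ and $\beta_\Omega$.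 On $U$ define the real one-form $$\alpha_\Omega=4\sum_{j=1}^n\operatorname{Re}\left(\frac{\partial\tilde\delta_\Omega}{\partial\bar z_j}\bar\partial\left(\frac{\partial\tilde\delta_\Omega}{\partial z_j}\right)\right),$$ and, with $\pi_{1,0}\alpha_\Omega$ and $\pi_{0,1}\alpha_\Omega$ its $(1,0)$ and $(0,1)$ components, the real $(1,1)$-form $$\beta_\Omega=\sum_{j=1}^n i\left(\partial\frac{\partial\tilde\delta_\Omega}{\partial z_j}\wedge\bar\partial\frac{\partial\tilde\delta_\Omega}{\partial\bar z_j}+\partial\frac{\partial\tilde\delta_\Omega}{\partial\bar z_j}\wedge\bar\partial\frac{\partial\tilde\delta_\Omega}{\partial z_j}\right)-2i\,\pi_{1,0}\alpha_\Omega\wedge\pi_{0,1}\alpha_\Omega.$$ A $C^2$ defining function for $\Omega$ is a $C^2$ function $\rho$ on a neighborhood of $b\Omega$ which is negative in $\Omega$, positive outside $\overline\Omega$, zero on $b\Omega$, with $d\rho\neq0$ on $b\Omega$. *)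

theory Defs
  imports "HOL-Analysis.Analysis"
begin

section \<open>Functions of class $C^k$\<close>

text \<open>Only meant for open \<open>S\<close>: then differentiability within \<open>S\<close> is differentiability, and
  \<^term>\<open>frechet_derivative f (at x) v\<close> is the derivative in the (real) direction \<open>v\<close>.\<close>

primrec Ck_on :: "nat \<Rightarrow> ('a::euclidean_space \<Rightarrow> 'b::real_normed_vector) \<Rightarrow> 'a set \<Rightarrow> bool" where
  "Ck_on 0 f S \<longleftrightarrow> continuous_on S f"
| "Ck_on (Suc k) f S \<longleftrightarrow>
     f differentiable_on S \<and> (\<forall>v. Ck_on k (\<lambda>x. frechet_derivative f (at x) v) S)"

text \<open>The sum, over all partial derivatives of order at most two, of their suprema over \<open>A\<close>;
  the value is \<open>\<infinity>\<close> if one of them is unbounded on \<open>A\<close>.\<close>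

definition C2_norm :: "('a::euclidean_space \<Rightarrow> 'b::real_normed_vector) \<Rightarrow> 'a set \<Rightarrow> ennreal" where
  "C2_norm f A =
     (SUP x\<in>A. ennreal (norm (f x)))
     + (\<Sum>b\<in>Basis. SUP x\<in>A. ennreal (norm (frechet_derivative f (at x) b)))
     + (\<Sum>b\<in>Basis. \<Sum>c\<in>Basis.
          SUP x\<in>A. ennreal (norm (frechet_derivative (\<lambda>y. frechet_derivative f (at y) b) (at x) c)))"


section \<open>Forms on $\mathbb{C}^n$\<close>

text \<open>The pair \<open>(a, b)\<close> stands for the complexified tangent vector
  $\sum_j a_j \partial/\partial z_j + \sum_j b_j \partial/\partial \bar z_j$. Forms at a point are
  complex (bi)linear in such vectors; a form on a set is a function of the point.\<close>

type_synonym 'n ctan = "(complex, 'n) vec \<times> (complex, 'n) vec"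
type_synonym 'n form1 = "'n ctan \<Rightarrow> complex"
type_synonym 'n form2 = "'n ctan \<Rightarrow> 'n ctan \<Rightarrow> complex"

definition conj_vec :: "complex^'n \<Rightarrow> complex^'n" where
  "conj_vec a = (\<chi> j. cnj (a $ j))"

definition conj_tan :: "'n::finite ctan \<Rightarrow> 'n ctan" where
  "conj_tan V = (conj_vec (snd V), conj_vec (fst V))"

definition T10 :: "complex^'n \<Rightarrow> 'n ctan" where
  "T10 X = (X, 0)"

definition Re_form :: "'n::finite form1 \<Rightarrow> 'n form1" where
  "Re_form \<phi> = (\<lambda>V. (\<phi> V + cnj (\<phi> (conj_tan V))) / 2)"

definition pi_10 :: "'n::finite form1 \<Rightarrow> 'n form1" where
  "pi_10 \<phi> = (\<lambda>V. \<phi> (fst V, 0))"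

definition pi_01 :: "'n::finite form1 \<Rightarrow> 'n form1" where
  "pi_01 \<phi> = (\<lambda>V. \<phi> (0, snd V))"

definition wedge :: "'n form1 \<Rightarrow> 'n form1 \<Rightarrow> 'n form2" where
  "wedge \<phi> \<psi> = (\<lambda>V W. \<phi> V * \<psi> W - \<phi> W * \<psi> V)"

text \<open>$\Theta(X, \bar Y) = \Theta(-i X \wedge \bar Y)$ for $X, Y \in T^{1,0}$.\<close>

definition eval11 :: "'n::finite form2 \<Rightarrow> complex^'n \<Rightarrow> complex^'n \<Rightarrow> complex" where
  "eval11 \<Theta> X Y = - \<i> * \<Theta> (T10 X) (conj_tan (T10 Y))"

definition d_z :: "'n \<Rightarrow> (complex^'n \<Rightarrow> complex) \<Rightarrow> complex^'n \<Rightarrow> complex" where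
  "d_z j f z =
     (frechet_derivative f (at z) (axis j 1) - \<i> * frechet_derivative f (at z) (axis j \<i>)) / 2"

definition d_zbar :: "'n \<Rightarrow> (complex^'n \<Rightarrow> complex) \<Rightarrow> complex^'n \<Rightarrow> complex" where
  "d_zbar j f z =
     (frechet_derivative f (at z) (axis j 1) + \<i> * frechet_derivative f (at z) (axis j \<i>)) / 2"

definition del :: "(complex^'n \<Rightarrow> complex) \<Rightarrow> complex^'n \<Rightarrow> 'n form1" where
  "del f z = (\<lambda>V. \<Sum>j\<in>UNIV. d_z j f z * fst V $ j)"

definition delbar :: "(complex^'n \<Rightarrow> complex) \<Rightarrow> complex^'n \<Rightarrow> 'n form1" where
  "delbar f z = (\<lambda>V. \<Sum>j\<in>UNIV. d_zbar j f z * snd V $ j)"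

text \<open>$\partial\bar\partial f = \sum_k \partial(\partial f/\partial\bar z_k) \wedge d\bar z_k$\<close>

definition del_delbar :: "(complex^'n \<Rightarrow> complex) \<Rightarrow> complex^'n \<Rightarrow> 'n form2" where
  "del_delbar f z = (\<lambda>V W. \<Sum>k\<in>UNIV. wedge (del (d_zbar k f) z) (\<lambda>V. snd V $ k) V W)"

text \<open>For real-valued \<open>f\<close> of class $C^2$, the form $i\partial\bar\partial f$ is real, so the value
  $i\partial\bar\partial f(X, \bar X)$ is a real number; the real part only fixes its type.\<close>

definition levi :: "(complex^'n \<Rightarrow> real) \<Rightarrow> complex^'n \<Rightarrow> complex^'n \<Rightarrow> real" where
  "levi f z X = Re (eval11 (\<lambda>V W. \<i> * del_delbar (\<lambda>w. complex_of_real (f w)) z V W) X X)"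

definition omega :: "complex^'n \<Rightarrow> 'n form2" where
  "omega z = (\<lambda>V W. \<i> / 2 * del_delbar (\<lambda>w. complex_of_real ((norm w)\<^sup>2)) z V W)"

text \<open>The squared length $|X|^2 = \omega(X, \bar X)$ of $X \in T^{1,0}_z$, which is half of the
  squared norm of the coefficient vector (see \<open>tan_norm_sq_eq\<close> below).\<close>

definition tan_norm_sq :: "complex^'n \<Rightarrow> complex^'n \<Rightarrow> real" where
  "tan_norm_sq z X = Re (eval11 (omega z) X X)"


section \<open>Domains\<close>

definition boundary_nbhd :: "'a::topological_space set \<Rightarrow> 'a set \<Rightarrow> bool" where
  "boundary_nbhd \<Omega> U \<longleftrightarrow> open U \<and> frontier \<Omega> \<subseteq> U"

text \<open>\<open>W\<close> is the neighborhood of the boundary on which \<open>\<rho>\<close> is defined; the values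
  of \<open>\<rho>\<close> outside of \<open>W\<close> carry no information.\<close>

definition C2_defining_function ::
  "(complex^'n) set \<Rightarrow> (complex^'n) set \<Rightarrow> (complex^'n \<Rightarrow> real) \<Rightarrow> bool" where
  "C2_defining_function \<Omega> W \<rho> \<longleftrightarrow>
     boundary_nbhd \<Omega> W \<and> Ck_on 2 \<rho> W
     \<and> (\<forall>z\<in>W \<inter> \<Omega>. \<rho> z < 0) \<and> (\<forall>z\<in>W - closure \<Omega>. \<rho> z > 0)
     \<and> (\<forall>z\<in>frontier \<Omega>. \<rho> z = 0 \<and> frechet_derivative \<rho> (at z) \<noteq> (\<lambda>v. 0))"

definition C2_boundary :: "(complex^'n) set \<Rightarrow> bool" where
  "C2_boundary \<Omega> \<longleftrightarrow> (\<exists>W \<rho>. C2_defining_function \<Omega> W \<rho>)"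

text \<open>Pseudoconvexity of a domain with $C^2$ boundary: the Levi form of a $C^2$ defining function is
  nonnegative on complex tangent vectors at the boundary. The condition does not depend on the
  choice of the defining function.\<close>

definition pseudoconvex :: "(complex^'n) set \<Rightarrow> bool" where
  "pseudoconvex \<Omega> \<longleftrightarrow>
     (\<exists>W \<rho>. C2_defining_function \<Omega> W \<rho>
       \<and> (\<forall>p\<in>frontier \<Omega>. \<forall>\<tau>. del (\<lambda>w. complex_of_real (\<rho> w)) p (T10 \<tau>) = 0 \<longrightarrow> levi \<rho> p \<tau> \<ge> 0))"

definition bdist :: "(complex^'n) set \<Rightarrow> complex^'n \<Rightarrow> real" where
  "bdist \<Omega> z = infdist z (frontier \<Omega>)"

definition sdist :: "(complex^'n) set \<Rightarrow> complex^'n \<Rightarrow> real" where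
  "sdist \<Omega> z = (if z \<in> \<Omega> then - bdist \<Omega> z else bdist \<Omega> z)"

abbreviation sdistc :: "(complex^'n) set \<Rightarrow> complex^'n \<Rightarrow> complex" where
  "sdistc \<Omega> \<equiv> (\<lambda>z. complex_of_real (sdist \<Omega> z))"

definition nearest :: "(complex^'n) set \<Rightarrow> complex^'n \<Rightarrow> complex^'n" where
  "nearest \<Omega> z = (THE \<xi>. \<xi> \<in> frontier \<Omega> \<and> dist z \<xi> = bdist \<Omega> z)"

text \<open>Neighborhoods of the boundary on which the signed distance function is $C^2$ and the nearest
  boundary point is unique, so that \<open>nearest\<close> and the forms below make sense.\<close>

definition regular_nbhd :: "(complex^'n) set \<Rightarrow> (complex^'n) set \<Rightarrow> bool" where
  "regular_nbhd \<Omega> U \<longleftrightarrow>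
     boundary_nbhd \<Omega> U \<and> Ck_on 2 (sdist \<Omega>) U
     \<and> (\<forall>z\<in>U. \<exists>!\<xi>. \<xi> \<in> frontier \<Omega> \<and> dist z \<xi> = bdist \<Omega> z)"

definition alpha :: "(complex^'n) set \<Rightarrow> complex^'n \<Rightarrow> 'n form1" where
  "alpha \<Omega> z =
     (\<lambda>V. 4 * (\<Sum>j\<in>UNIV.
        Re_form (\<lambda>V. d_zbar j (sdistc \<Omega>) z * delbar (d_z j (sdistc \<Omega>)) z V) V))"

definition beta :: "(complex^'n) set \<Rightarrow> complex^'n \<Rightarrow> 'n form2" where
  "beta \<Omega> z =
     (\<lambda>V W. (\<Sum>j\<in>UNIV. \<i> *
          (wedge (del (d_z j (sdistc \<Omega>)) z) (delbar (d_zbar j (sdistc \<Omega>)) z) V W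
           + wedge (del (d_zbar j (sdistc \<Omega>)) z) (delbar (d_z j (sdistc \<Omega>)) z) V W))
        - 2 * \<i> * wedge (pi_10 (alpha \<Omega> z)) (pi_01 (alpha \<Omega> z)) V W)"


section \<open>The two conditions\<close>

definition lam :: "real \<Rightarrow> (complex^'n \<Rightarrow> real) \<Rightarrow> complex^'n \<Rightarrow> real" where
  "lam \<eta> \<rho> z = - ((- \<rho> z) powr \<eta>)"

text \<open>$i\partial\bar\partial\lambda \geq M(-\lambda)\omega$ on $U \cap \Omega$ for
  $\lambda = -(-\rho)^\eta$, where \<open>U\<close> lies in the domain \<open>W\<close> of \<open>\<rho>\<close>.\<close>

definition hessian_condition ::
  "(complex^'n) set \<Rightarrow> real \<Rightarrow> real \<Rightarrow> (complex^'n) set \<Rightarrow> (complex^'n \<Rightarrow> real) \<Rightarrow> (complex^'n) set \<Rightarrow> bool"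
  where
  "hessian_condition \<Omega> \<eta> M W \<rho> U \<longleftrightarrow>
     C2_defining_function \<Omega> W \<rho> \<and> boundary_nbhd \<Omega> U \<and> U \<subseteq> W
     \<and> (\<forall>z\<in>U \<inter> \<Omega>. \<forall>X. levi (lam \<eta> \<rho>) z X \<ge> M * (- lam \<eta> \<rho> z) * tan_norm_sq z X)"

definition small_C2_growth :: "(complex^'n) set \<Rightarrow> (complex^'n) set \<Rightarrow> (complex^'n \<Rightarrow> real) \<Rightarrow> bool"
  where
  "small_C2_growth \<Omega> U \<phi> \<longleftrightarrow>
     ((\<lambda>\<epsilon>. ennreal \<epsilon> * C2_norm \<phi> {z \<in> \<Omega> \<inter> U. bdist \<Omega> z > \<epsilon>}) \<longlongrightarrow> 0) (at_right 0)"

definition tangential_condition ::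
  "(complex^'n) set \<Rightarrow> real \<Rightarrow> real \<Rightarrow> (complex^'n) set \<Rightarrow> (complex^'n \<Rightarrow> real) \<Rightarrow> bool" where
  "tangential_condition \<Omega> s N U \<phi> \<longleftrightarrow>
     (\<forall>z\<in>U \<inter> \<Omega>. \<forall>\<tau>. del (sdistc \<Omega>) z (T10 \<tau>) = 0 \<longrightarrow>
        N * tan_norm_sq z \<tau>
        + s / (1 - s) *
            (cmod (del (\<lambda>w. complex_of_real (\<phi> w)) z (T10 \<tau>)
                   - 2 * alpha \<Omega> (nearest \<Omega> z) (T10 \<tau>)))\<^sup>2
        \<le> levi \<phi> z \<tau>
          + inverse (- sdist \<Omega> z) * levi (sdist \<Omega>) (nearest \<Omega> z) \<tau>
          + 2 * Re (eval11 (beta \<Omega> (nearest \<Omega> z)) \<tau> \<tau>))"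

definition weight_condition ::
  "(complex^'n) set \<Rightarrow> real \<Rightarrow> real \<Rightarrow> (complex^'n) set \<Rightarrow> (complex^'n \<Rightarrow> real) \<Rightarrow> bool" where
  "weight_condition \<Omega> s N U \<phi> \<longleftrightarrow>
     regular_nbhd \<Omega> U \<and> Ck_on 1 \<phi> U \<and> Ck_on 2 \<phi> (U - frontier \<Omega>)
     \<and> small_C2_growth \<Omega> U \<phi> \<and> tangential_condition \<Omega> s N U \<phi>"


section \<open>Coordinate expressions\<close>

lemma levi_eq:
  "levi f z X = Re (\<Sum>j\<in>UNIV. \<Sum>k\<in>UNIV.
     d_z j (d_zbar k (\<lambda>w. complex_of_real (f w))) z * X $ j * cnj (X $ k))"
proof -
  have "eval11 (\<lambda>V W. \<i> * del_delbar (\<lambda>w. complex_of_real (f w)) z V W) X X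
      = (\<Sum>k\<in>UNIV. \<Sum>j\<in>UNIV. d_z j (d_zbar k (\<lambda>w. complex_of_real (f w))) z * X $ j * cnj (X $ k))"
    by (simp add: eval11_def del_delbar_def wedge_def del_def T10_def conj_tan_def conj_vec_def
        sum_distrib_right flip: mult.assoc)
  then show ?thesis
    unfolding levi_def by (subst sum.swap) simp
qed

lemma alpha_T10:
  "alpha \<Omega> z (T10 X) = 2 * (\<Sum>j\<in>UNIV. cnj (d_zbar j (sdistc \<Omega>) z) *
     (\<Sum>k\<in>UNIV. cnj (d_zbar k (d_z j (sdistc \<Omega>)) z) * X $ k))"
  by (simp add: alpha_def Re_form_def delbar_def T10_def conj_tan_def conj_vec_def
      sum_distrib_left sum_divide_distrib mult_ac)

lemma frechet_derivative_eqI: "(f has_derivative f') (at x) \<Longrightarrow> frechet_derivative f (at x) = f'"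
  using frechet_derivative_at by metis

lemma d_zbar_norm_sq: "d_zbar k (\<lambda>w::complex^'n. complex_of_real ((norm w)\<^sup>2)) z = z $ k"
proof -
  have "((\<lambda>w::complex^'n. complex_of_real ((norm w)\<^sup>2))
      has_derivative (\<lambda>v. complex_of_real (2 * (z \<bullet> v)))) (at z)"
    unfolding power2_norm_eq_inner
    by (auto intro!: derivative_eq_intros simp: inner_commute)
  from frechet_derivative_eqI[OF this] show ?thesis
    by (simp add: d_zbar_def inner_axis inner_complex_def complex_eq_iff)
qed

lemma d_z_component: "d_z j (\<lambda>w::complex^'n. w $ k) z = (if j = k then 1 else 0)"
proof -
  have "((\<lambda>w::complex^'n. w $ k) has_derivative (\<lambda>v. v $ k)) (at z)"
    by (rule bounded_linear_imp_has_derivative) (rule bounded_linear_vec_nth)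
  from frechet_derivative_eqI[OF this] show ?thesis
    by (simp add: d_z_def axis_def)
qed

lemma tan_norm_sq_eq: "tan_norm_sq z X = (\<Sum>j\<in>UNIV. (cmod (X $ j))\<^sup>2) / 2"
proof -
  have "eval11 (omega z) X X = (\<Sum>k\<in>UNIV. X $ k * cnj (X $ k)) / 2"
    by (simp add: eval11_def omega_def del_delbar_def wedge_def del_def T10_def conj_tan_def
        conj_vec_def d_zbar_norm_sq[abs_def] d_z_component if_distrib if_distribR
        del: of_real_power cong: if_cong)
  also have "\<dots> = complex_of_real ((\<Sum>k\<in>UNIV. (cmod (X $ k))\<^sup>2) / 2)"
    by (simp flip: complex_norm_square)
  finally show ?thesis
    by (simp add: tan_norm_sq_def del: of_real_divide)
qed

end

theory Submission
  imports Defs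
begin

text \<open>Write \<open>\<rho> = d e\<^sup>-\<^sup>\<psi>\<close> with \<open>d\<close> the signed distance. With \<open>u = \<psi> - ln (-d)\<close> we have
  \<open>\<lambda>\<^sub>\<eta> = - e\<^sup>-\<^sup>\<eta>\<^sup>u\<close>, and the condition on \<open>\<lambda>\<^sub>\<eta>\<close> says that
  $i\partial\bar\partial u - \eta\, i\partial u\wedge\bar\partial u \geq (M_\eta/\eta)\,\omega$. Split a vector into a
  complex tangential part \<open>\<tau>\<close> and a complex normal part of size \<open>d\<close> times a complex number \<open>a\<close>. Up to terms
  which vanish at the boundary, the left hand side is a quadratic polynomial in \<open>a\<close>, and its minimum
  over \<open>a\<close> is
  $i\partial\bar\partial\psi(\tau,\bar\tau) + (-d)^{-1} i\partial\bar\partial d(\tau,\bar\tau) - |2\alpha(\tau)|^2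
  - \frac{\eta}{1-\eta}|\partial\psi(\tau) - 2\alpha(\tau)|^2$.
  The Hessian \<open>H\<close> of \<open>d\<close> satisfies \<open>H(z) = H(\<xi>) - d(z) H(\<xi>) H(z)\<close>, and moving the second term to the nearest
  point \<open>\<xi>\<close> produces \<open>\<beta>\<close>. So both conditions agree for \<open>s = \<eta>\<close> up to an arbitrarily small loss. Lowering the
  exponent gains room in the coefficient of the square, which is used to add a multiple of \<open>|z|\<^sup>2\<close>
  to \<open>\<psi>\<close>; this yields the terms with \<open>r\<close>.

  In (1), \<open>\<rho>/d\<close> is $C^1$ up to the boundary, being an average of a derivative of \<open>\<rho>\<close> along normal segments. In (2),
  \<open>d e\<^sup>-\<^sup>\<psi>\<close> is $C^2$ up to the boundary from inside only, and is extended by a reflection.\<close>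

section \<open>Calculus of $C^k$ functions\<close>

text \<open>The normal part is scaled by the distance because |\<nu> . X|^2/d^2 dominates: only
  vectors with a normal part of size d make all terms comparable. The weight \<psi> is merely C^1 up
  to the boundary and its Hessian may blow up; what is controlled is that d times the Hessian tends
  to 0. This one fact is used three times: it removes the errors in the minimization, it is the
  growth condition on the weight, and it makes d e^(-\<psi>) of class C^2 up to the boundary
  although the second factor is not. Each passage loses an arbitrarily small amount, which the
  strict inequalities between the constants absorb. With k = s/(1-s) one has 1/k = 1/s - 1, so the
  room gained by lowering the exponent is measured by 1/s - 1/\<eta>; spending it optimally on c
  |z|^2 with |z| at most r gives the factor 1/(2 r^2). The extension cannot reflect along the normal
  field itself: second derivatives of the reflection are needed and the field is only C^1. A
  polynomial field near the normals replaces it, and two step lengths are combined so that first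
  derivatives match even though that field is not normal.\<close>

abbreviation deriv_at :: "('a::real_normed_vector \<Rightarrow> 'b::real_normed_vector) \<Rightarrow> 'a \<Rightarrow> 'a \<Rightarrow> 'b" ("\<D>") where
  "\<D> f x \<equiv> frechet_derivative f (at x)"

abbreviation deriv2_at :: "('a::real_normed_vector \<Rightarrow> 'b::real_normed_vector) \<Rightarrow> 'a \<Rightarrow> 'a \<Rightarrow> 'a \<Rightarrow> 'b" ("\<H>") where
  "\<H> f x v \<equiv> \<D> (\<lambda>y. \<D> f y v) x"

text \<open>Derivatives at a point of an open set depend only on nearby values, so equality on
  \<open>S\<close> passes to the first derivatives on all of \<open>S\<close>, which is what the
  induction needs.\<close>

lemma Ck_on_transfer:
  assumes "open S" "Ck_on k f S" "\<And>x. x \<in> S \<Longrightarrow> f x = g x"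
  shows "Ck_on k g S"
  using assms(2,3)
proof (induction k arbitrary: f g)
  case 0
  then show ?case using continuous_on_eq by fastforce
next
  case (Suc k)
  note C = \<open>Ck_on (Suc k) f S\<close>
  have d: "(g has_derivative \<D> f x) (at x)" if x: "x \<in> S" for x
  proof -
    have "f differentiable (at x within S)"
      using C x by (simp add: differentiable_on_def)
    then have "f differentiable (at x)"
      using at_within_open[OF x \<open>open S\<close>] by simp
    then have "(f has_derivative \<D> f x) (at x)"
      by (simp only: frechet_derivative_works)
    from has_derivative_transform_within_open[OF this \<open>open S\<close> x Suc.prems(2)]
    show ?thesis .
  qed
  have "g differentiable (at x within S)" if "x \<in> S" for x
    using d[OF that] by (meson differentiableI differentiable_at_withinI)
  then have "g differentiable_on S" by (simp add: differentiable_on_def)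
  moreover have "Ck_on k (\<lambda>x. \<D> g x v) S" for v
  proof (rule Suc.IH)
    show "Ck_on k (\<lambda>x. \<D> f x v) S"
      using C by simp
    show "\<D> f x v = \<D> g x v" if "x \<in> S" for x
      by (simp only: frechet_derivative_eqI[OF d[OF that]])
  qed
  ultimately show ?case by simp
qed

lemma Ck_on_subset:
  "Ck_on k f S \<Longrightarrow> T \<subseteq> S \<Longrightarrow> Ck_on k f T"
  by (induction k arbitrary: f) (auto intro: continuous_on_subset differentiable_on_subset)

lemma Ck_on_Suc_imp: "Ck_on (Suc k) f S \<Longrightarrow> Ck_on k f S"
  by (induction k arbitrary: f) (auto intro: differentiable_imp_continuous_on)

lemma Ck_on_le: "Ck_on k f S \<Longrightarrow> j \<le> k \<Longrightarrow> Ck_on j f S"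
  by (induction k) (auto simp: le_Suc_eq intro: Ck_on_Suc_imp simp del: Ck_on.simps(2))

lemma Ck_on_imp_continuous_on: "Ck_on k f S \<Longrightarrow> continuous_on S f"
  using Ck_on_le[of k f S 0] by simp

lemma Ck_on_has_derivative:
  assumes "Ck_on (Suc k) f S" "open S" "x \<in> S"
  shows "(f has_derivative \<D> f x) (at x)"
  using assms by (simp add: differentiable_on_def at_within_open_NO_MATCH flip: frechet_derivative_works)

lemma Ck_on_SucI:
  assumes "open S" "\<And>x. x \<in> S \<Longrightarrow> (f has_derivative f' x) (at x)" "\<And>v. Ck_on k (\<lambda>x. f' x v) S"
  shows "Ck_on (Suc k) f S"
proof -
  have "f differentiable (at x within S)" if "x \<in> S" for x
    using assms(2)[OF that] by (meson differentiableI differentiable_at_withinI)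
  then have "f differentiable_on S" by (simp add: differentiable_on_def)
  moreover have "Ck_on k (\<lambda>x. \<D> f x v) S" for v
  proof -
    have "\<D> f x v = f' x v" if "x \<in> S" for x
      by (simp only: frechet_derivative_eqI[OF assms(2)[OF that]])
    with Ck_on_transfer[OF assms(1) assms(3)[of v]] show ?thesis by simp
  qed
  ultimately show ?thesis by simp
qed

text \<open>Neighborhoods of the boundary are built below as unions of balls around boundary points,
  with regularity known ball by ball; this glues it.\<close>

lemma Ck_on_local:
  assumes "open S" "\<And>x. x \<in> S \<Longrightarrow> \<exists>T. open T \<and> x \<in> T \<and> Ck_on k f T"
  shows "Ck_on k f S"
  using assms
proof (induction k arbitrary: f)
  case 0
  then show ?case
    by (metis Ck_on.simps(1) continuous_at_imp_continuous_on continuous_on_eq_continuous_at)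
next
  case (Suc k)
  show ?case
  proof (rule Ck_on_SucI[OF \<open>open S\<close>])
    show "(f has_derivative \<D> f x) (at x)" if "x \<in> S" for x
      using Suc.prems(2)[OF that] Ck_on_has_derivative by blast
    show "Ck_on k (\<lambda>x. \<D> f x v) S" for v
    proof (rule Suc.IH[OF \<open>open S\<close>])
      fix x assume "x \<in> S"
      then obtain T where "open T" "x \<in> T" "Ck_on (Suc k) f T" using Suc.prems(2) by blast
      then show "\<exists>T. open T \<and> x \<in> T \<and> Ck_on k (\<lambda>x. \<D> f x v) T" by auto
    qed
  qed
qed

lemma Ck_on_const: "open S \<Longrightarrow> Ck_on k (\<lambda>x. c) S"
proof (induction k arbitrary: c)
  case (Suc k)
  show ?case by (rule Ck_on_SucI[where f' = "\<lambda>x v. 0"]) (use Suc in auto)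
qed simp

lemma Ck_on_bounded_linear:
  assumes "bounded_linear L" "Ck_on k f S" "open S"
  shows "Ck_on k (\<lambda>x. L (f x)) S"
  using assms(2)
proof (induction k arbitrary: f)
  case 0
  then show ?case by (simp add: bounded_linear.continuous_on[OF assms(1)])
next
  case (Suc k)
  show ?case
  proof (rule Ck_on_SucI[OF \<open>open S\<close>])
    show "((\<lambda>x. L (f x)) has_derivative (\<lambda>v. L (\<D> f x v))) (at x)"
      if "x \<in> S" for x
      by (rule bounded_linear.has_derivative[OF assms(1) Ck_on_has_derivative[OF Suc.prems \<open>open S\<close> that]])
  qed (use Suc in auto)
qed

lemma Ck_on_add:
  assumes "Ck_on k f S" "Ck_on k g S" "open S"
  shows "Ck_on k (\<lambda>x. f x + g x) S"
  using assms(1,2)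
proof (induction k arbitrary: f g)
  case 0
  then show ?case by (simp add: continuous_on_add)
next
  case (Suc k)
  show ?case
  proof (rule Ck_on_SucI[OF \<open>open S\<close>])
    show "((\<lambda>x. f x + g x) has_derivative (\<lambda>v. \<D> f x v + \<D> g x v)) (at x)"
      if "x \<in> S" for x
      by (rule has_derivative_add[OF Ck_on_has_derivative[OF Suc.prems(1) \<open>open S\<close> that]
          Ck_on_has_derivative[OF Suc.prems(2) \<open>open S\<close> that]])
  qed (use Suc in auto)
qed

lemma Ck_on_uminus: "Ck_on k f S \<Longrightarrow> open S \<Longrightarrow> Ck_on k (\<lambda>x. - f x) S"
  by (rule Ck_on_bounded_linear[OF bounded_linear_minus[OF bounded_linear_ident]])

lemma Ck_on_diff:
  assumes "Ck_on k f S" "Ck_on k g S" "open S"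
  shows "Ck_on k (\<lambda>x. f x - g x) S"
  using Ck_on_add[OF assms(1) Ck_on_uminus[OF assms(2,3)] assms(3)] by simp

lemma Ck_on_sum:
  assumes "\<And>i. i \<in> I \<Longrightarrow> Ck_on k (f i) S" "open S"
  shows "Ck_on k (\<lambda>x. \<Sum>i\<in>I. f i x) S"
  using assms(1) by (induction I rule: infinite_finite_induct) (auto intro: Ck_on_const Ck_on_add assms(2))

lemma Ck_on_bilinear:
  assumes "bounded_bilinear B" "Ck_on k f S" "Ck_on k g S" "open S"
  shows "Ck_on k (\<lambda>x. B (f x) (g x)) S"
  using assms(2,3)
proof (induction k arbitrary: f g)
  case 0
  then show ?case by (simp add: bounded_bilinear.continuous_on[OF assms(1)])
next
  case (Suc k)
  show ?case
  proof (rule Ck_on_SucI[OF \<open>open S\<close>])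
    show "((\<lambda>x. B (f x) (g x)) has_derivative
        (\<lambda>v. B (f x) (\<D> g x v) + B (\<D> f x v) (g x))) (at x)"
      if "x \<in> S" for x
      by (rule bounded_bilinear.FDERIV[OF assms(1) Ck_on_has_derivative[OF Suc.prems(1) \<open>open S\<close> that]
          Ck_on_has_derivative[OF Suc.prems(2) \<open>open S\<close> that]])
    show "Ck_on k (\<lambda>x. B (f x) (\<D> g x v) + B (\<D> f x v) (g x)) S" for v
      using Suc.prems by (intro Ck_on_add Suc.IH Ck_on_Suc_imp[OF Suc.prems(1)] Ck_on_Suc_imp[OF Suc.prems(2)] \<open>open S\<close>) auto
  qed
qed

lemmas Ck_on_mult = Ck_on_bilinear[OF bounded_bilinear_mult]
lemmas Ck_on_scaleR = Ck_on_bilinear[OF bounded_bilinear_scaleR]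
lemmas Ck_on_inner = Ck_on_bilinear[OF bounded_bilinear_inner]

lemma Ck_on_ident: "open S \<Longrightarrow> Ck_on k (\<lambda>x. x) S"
proof (cases k)
  case (Suc j)
  assume "open S"
  then show ?thesis unfolding Suc
    by (intro Ck_on_SucI[where f' = "\<lambda>x v. v"]) (auto intro: Ck_on_const)
qed simp

text \<open>\<open>Ck_on\<close> speaks of derivatives in fixed directions, while the chain rule
  differentiates the outer function in a direction that moves with the point. Expansion in the basis
  separates the two.\<close>

lemma frechet_derivative_expand:
  fixes f :: "'a::euclidean_space \<Rightarrow> 'b::real_normed_vector"
  assumes "(f has_derivative f') (at x)"
  shows "f' v = (\<Sum>b\<in>Basis. (v \<bullet> b) *\<^sub>R f' b)"
proof -
  interpret linear f' using has_derivative_linear[OF assms] .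
  have "f' v = f' (\<Sum>b\<in>Basis. (v \<bullet> b) *\<^sub>R b)" by (simp add: euclidean_representation)
  also have "\<dots> = (\<Sum>b\<in>Basis. (v \<bullet> b) *\<^sub>R f' b)" by (simp add: sum scale)
  finally show ?thesis .
qed

lemma Ck_on_compose:
  fixes f :: "'b::euclidean_space \<Rightarrow> 'c::real_normed_vector" and g :: "'a::euclidean_space \<Rightarrow> 'b"
  assumes "Ck_on k f T" "Ck_on k g S" "g ` S \<subseteq> T" "open S" "open T"
  shows "Ck_on k (\<lambda>x. f (g x)) S"
  using assms(1,2)
proof (induction k arbitrary: f)
  case 0
  then show ?case using assms(3) by (auto intro: continuous_on_compose2)
next
  case (Suc k)
  let ?F = "\<lambda>y b. \<D> f y b"
  let ?G = "\<lambda>x v. \<D> g x v"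
  have gx: "g x \<in> T" if "x \<in> S" for x using that assms(3) by auto
  show ?case
  proof (rule Ck_on_SucI[OF \<open>open S\<close>])
    fix x assume x: "x \<in> S"
    note f = Ck_on_has_derivative[OF Suc.prems(1) \<open>open T\<close> gx[OF x]]
    have "((\<lambda>x. f (g x)) has_derivative (\<lambda>v. ?F (g x) (?G x v))) (at x)"
      by (rule has_derivative_compose[OF Ck_on_has_derivative[OF Suc.prems(2) \<open>open S\<close> x] f])
    moreover have "(\<lambda>v. ?F (g x) (?G x v)) = (\<lambda>v. \<Sum>b\<in>Basis. (?G x v \<bullet> b) *\<^sub>R ?F (g x) b)"
      by (intro ext frechet_derivative_expand[OF f])
    ultimately show "((\<lambda>x. f (g x)) has_derivative (\<lambda>v. \<Sum>b\<in>Basis. (?G x v \<bullet> b) *\<^sub>R ?F (g x) b)) (at x)"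
      by simp
  next
    fix v
    show "Ck_on k (\<lambda>x. \<Sum>b\<in>Basis. (?G x v \<bullet> b) *\<^sub>R ?F (g x) b) S"
    proof (intro Ck_on_sum Ck_on_scaleR \<open>open S\<close>)
      show "Ck_on k (\<lambda>x. ?G x v \<bullet> b) S" for b
        using Suc.prems(2) by (auto intro!: Ck_on_bounded_linear[OF bounded_linear_inner_left] \<open>open S\<close>)
      show "Ck_on k (\<lambda>x. ?F (g x) b) S" for b
        using Suc.prems Ck_on_Suc_imp[OF Suc.prems(2)] by (intro Suc.IH) auto
    qed
  qed
qed

lemma Ck_on_exp_real: "Ck_on k (exp :: real \<Rightarrow> real) UNIV"
proof (induction k)
  case (Suc k)
  show ?case
    by (rule Ck_on_SucI[where f' = "\<lambda>x v. exp x * v"])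
      (auto intro!: derivative_eq_intros Ck_on_mult Ck_on_const Suc.IH)
qed (simp add: continuous_on_exp)

lemma Ck_on_inverse_real: "Ck_on k (inverse :: real \<Rightarrow> real) {0<..}"
proof (induction k)
  case (Suc k)
  show ?case
    by (rule Ck_on_SucI[where f' = "\<lambda>x v. - (inverse x * v * inverse x)"])
      (auto intro!: derivative_eq_intros Ck_on_mult Ck_on_uminus Ck_on_const Suc.IH)
qed (auto intro!: continuous_intros)

lemma Ck_on_ln_real: "Ck_on k (ln :: real \<Rightarrow> real) {0<..}"
proof (cases k)
  case (Suc j)
  show ?thesis unfolding Suc
    by (rule Ck_on_SucI[where f' = "\<lambda>x v. inverse x * v"])
      (auto intro!: derivative_eq_intros Ck_on_mult Ck_on_const Ck_on_inverse_real)
qed (auto intro!: continuous_intros)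

lemma Ck_on_polynomial_function:
  fixes f :: "'a::euclidean_space \<Rightarrow> 'b::euclidean_space"
  assumes "polynomial_function f" "open S"
  shows "Ck_on k f S"
proof -
  have real: "Ck_on k p S" if "real_polynomial_function p" for p :: "'a \<Rightarrow> real"
    using that
  proof induction
    case (linear f)
    show ?case by (rule Ck_on_bounded_linear[OF linear Ck_on_ident]) fact+
  qed (auto intro: Ck_on_const Ck_on_add Ck_on_mult assms(2))
  have "Ck_on k (\<lambda>x. \<Sum>b\<in>Basis. (f x \<bullet> b) *\<^sub>R b) S"
    using assms by (intro Ck_on_sum Ck_on_scaleR Ck_on_const real) (auto simp: polynomial_function_iff_Basis_inner)
  then show ?thesis by (simp add: euclidean_representation)
qed

section \<open>Symmetry of second derivatives\<close>

lemma second_difference_eq: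
  fixes f :: "'a::euclidean_space \<Rightarrow> real"
  assumes C2: "Ck_on 2 f (ball x e)" and t: "0 < t" "t * (norm v + norm w) < e"
  obtains y where "dist x y \<le> t * (norm v + norm w)"
    "f (x + t *\<^sub>R v + t *\<^sub>R w) - f (x + t *\<^sub>R v) - f (x + t *\<^sub>R w) + f x
      = t * t * \<H> f y v w"
proof -
  let ?D = "\<lambda>y. \<D> f y"
  have C2': "Ck_on (Suc (Suc 0)) f (ball x e)" using C2 by (simp only: numeral_2_eq_2)
  have inb: "x + s *\<^sub>R v + u *\<^sub>R w \<in> ball x e \<and> dist x (x + s *\<^sub>R v + u *\<^sub>R w) \<le> t * (norm v + norm w)"
    if "0 \<le> s" "s \<le> t" "0 \<le> u" "u \<le> t" for s u
  proof -
    have "norm (s *\<^sub>R v + u *\<^sub>R w) \<le> s * norm v + u * norm w"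
      using norm_triangle_ineq[of "s *\<^sub>R v" "u *\<^sub>R w"] that by simp
    also have "\<dots> \<le> t * (norm v + norm w)"
      using that by (simp add: distrib_left add_mono mult_right_mono)
    finally show ?thesis using t(2) by (simp add: dist_norm norm_minus_commute algebra_simps)
  qed
  \<comment> \<open>The mean value theorem is applied twice: to \<open>g\<close>, which involves
    derivatives in the direction \<open>v\<close>, and then to the difference of these derivatives
    along \<open>w\<close>.\<close>
  define g where "g s = f (x + s *\<^sub>R v + t *\<^sub>R w) - f (x + s *\<^sub>R v)" for s
  have line: "((\<lambda>s. f (x + s *\<^sub>R v + u *\<^sub>R w)) has_derivative (\<lambda>h. h * ?D (x + s *\<^sub>R v + u *\<^sub>R w) v)) (at s)"
    if "0 \<le> s" "s \<le> t" "0 \<le> u" "u \<le> t" for s u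
  proof -
    note fd = Ck_on_has_derivative[OF C2' open_ball, of "x + s *\<^sub>R v + u *\<^sub>R w"]
    have "((\<lambda>s. f (x + s *\<^sub>R v + u *\<^sub>R w)) has_derivative (\<lambda>h. ?D (x + s *\<^sub>R v + u *\<^sub>R w) (h *\<^sub>R v))) (at s)"
      by (rule has_derivative_compose[where f = "\<lambda>s. x + s *\<^sub>R v + u *\<^sub>R w"])
        (use fd inb[OF that] in \<open>auto intro!: derivative_eq_intros\<close>)
    then show ?thesis
      using linear_scale[OF has_derivative_linear[OF fd]] inb[OF that] by simp
  qed
  have gd: "(g has_derivative (\<lambda>h. h * (?D (x + s *\<^sub>R v + t *\<^sub>R w) v - ?D (x + s *\<^sub>R v) v))) (at s)"
    if "0 \<le> s" "s \<le> t" for s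
    unfolding g_def using has_derivative_diff[OF line[of s t] line[of s 0]] that t(1)
    by (simp add: right_diff_distrib)
  obtain s where s: "0 < s" "s < t" "g t - g 0 = t * (?D (x + s *\<^sub>R v + t *\<^sub>R w) v - ?D (x + s *\<^sub>R v) v)"
  proof -
    have "\<exists>s\<in>{0<..<t}. g t - g 0 = (\<lambda>h. h * (?D (x + s *\<^sub>R v + t *\<^sub>R w) v - ?D (x + s *\<^sub>R v) v)) (t - 0)"
      by (rule mvt_simple[OF t(1)]) (use gd in \<open>auto intro: has_derivative_at_withinI\<close>)
    then show ?thesis using that by auto
  qed
  have C1: "Ck_on (Suc 0) (\<lambda>y. ?D y v) (ball x e)" using C2' by simp
  have hd: "((\<lambda>u. ?D (x + s *\<^sub>R v + u *\<^sub>R w) v) has_derivative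
      (\<lambda>h. h * \<D> (\<lambda>y. ?D y v) (x + s *\<^sub>R v + u *\<^sub>R w) w)) (at u)"
    if "0 \<le> u" "u \<le> t" for u
  proof -
    have i: "x + s *\<^sub>R v + u *\<^sub>R w \<in> ball x e" using inb[of s u] that s by auto
    note fd = Ck_on_has_derivative[OF C1 open_ball i]
    have "((\<lambda>u. ?D (x + s *\<^sub>R v + u *\<^sub>R w) v) has_derivative
      (\<lambda>h. \<D> (\<lambda>y. ?D y v) (x + s *\<^sub>R v + u *\<^sub>R w) (h *\<^sub>R w))) (at u)"
      by (rule has_derivative_compose[where f = "\<lambda>u. x + s *\<^sub>R v + u *\<^sub>R w", OF _ fd])
        (auto intro!: derivative_eq_intros)
    then show ?thesis using linear_scale[OF has_derivative_linear[OF fd]] by simp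
  qed
  have "\<exists>u\<in>{0<..<t}. ?D (x + s *\<^sub>R v + t *\<^sub>R w) v - ?D (x + s *\<^sub>R v + 0 *\<^sub>R w) v
      = (\<lambda>h. h * \<D> (\<lambda>y. ?D y v) (x + s *\<^sub>R v + u *\<^sub>R w) w) (t - 0)"
    by (rule mvt_simple[OF t(1), where f = "\<lambda>u. ?D (x + s *\<^sub>R v + u *\<^sub>R w) v"])
      (use hd in \<open>auto intro: has_derivative_at_withinI\<close>)
  then obtain u where u: "0 < u" "u < t"
    "?D (x + s *\<^sub>R v + t *\<^sub>R w) v - ?D (x + s *\<^sub>R v) v
      = t * \<D> (\<lambda>y. ?D y v) (x + s *\<^sub>R v + u *\<^sub>R w) w" by auto
  show ?thesis
  proof (rule that)
    show "dist x (x + s *\<^sub>R v + u *\<^sub>R w) \<le> t * (norm v + norm w)" using inb[of s u] s u by auto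
    show "f (x + t *\<^sub>R v + t *\<^sub>R w) - f (x + t *\<^sub>R v) - f (x + t *\<^sub>R w) + f x
      = t * t * \<D> (\<lambda>y. ?D y v) (x + s *\<^sub>R v + u *\<^sub>R w) w"
      using s(3) u(3) by (simp add: g_def)
  qed
qed

text \<open>The second difference does not change when \<open>v\<close> and \<open>w\<close> are
  exchanged. Hence the two mixed derivatives, taken at suitable points arbitrarily near
  \<open>x\<close>, agree, and both are continuous.\<close>

lemma second_derivative_symmetric:
  fixes f :: "'a::euclidean_space \<Rightarrow> real"
  assumes C2: "Ck_on 2 f S" and "open S" "x \<in> S"
  shows "\<H> f x v w
       = \<H> f x w v"
proof -
  let ?D2 = "\<lambda>v w y. \<H> f y v w"
  obtain e where e: "e > 0" "ball x e \<subseteq> S" using assms(2,3) openE by blast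
  have C: "Ck_on 2 f (ball x e)" using Ck_on_subset[OF C2 e(2)] .
  have cont: "isCont (?D2 v w) x" for v w
    using C2 assms(2,3) by (auto simp: numeral_2_eq_2 continuous_on_eq_continuous_at)
  show ?thesis
  proof (rule ccontr)
    assume ne: "?D2 v w x \<noteq> ?D2 w v x"
    \<comment> \<open>Half the supposed gap: two numbers closer than this to the two limits cannot
      coincide.\<close>
    define \<eta> where "\<eta> = \<bar>?D2 v w x - ?D2 w v x\<bar> / 2"
    have \<eta>: "\<eta> > 0" using ne by (simp add: \<eta>_def)
    obtain d1 where d1: "d1 > 0" "\<And>y. dist y x < d1 \<Longrightarrow> dist (?D2 v w y) (?D2 v w x) < \<eta>"
      using cont[of v w] \<eta> unfolding continuous_at_eps_delta by blast
    obtain d2 where d2: "d2 > 0" "\<And>y. dist y x < d2 \<Longrightarrow> dist (?D2 w v y) (?D2 w v x) < \<eta>"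
      using cont[of w v] \<eta> unfolding continuous_at_eps_delta by blast
    define m where "m = min e (min d1 d2)"
    define t where "t = m / (norm v + norm w + 1)"
    have m: "m > 0" using d1(1) d2(1) e(1) by (simp add: m_def)
    have n: "norm v + norm w + 1 > 0" by (smt (verit) norm_ge_zero)
    have t: "t > 0" "t * (norm v + norm w) < m" using m n by (auto simp: t_def field_simps)
    obtain y1 where y1: "dist x y1 \<le> t * (norm v + norm w)"
      "f (x + t *\<^sub>R v + t *\<^sub>R w) - f (x + t *\<^sub>R v) - f (x + t *\<^sub>R w) + f x = t * t * ?D2 v w y1"
      using second_difference_eq[OF C t(1), of v w] t(2) unfolding m_def by auto
    obtain y2 where y2: "dist x y2 \<le> t * (norm w + norm v)"
      "f (x + t *\<^sub>R w + t *\<^sub>R v) - f (x + t *\<^sub>R w) - f (x + t *\<^sub>R v) + f x = t * t * ?D2 w v y2"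
      using second_difference_eq[OF C t(1), of w v] t(2) unfolding m_def by (auto simp: add.commute)
    have "t * t * ?D2 v w y1 = t * t * ?D2 w v y2"
      using y1(2) y2(2) by (simp add: algebra_simps)
    then have "?D2 v w y1 = ?D2 w v y2" using t(1) by simp
    moreover have "dist (?D2 v w y1) (?D2 v w x) < \<eta>"
      using d1(2)[of y1] y1(1) t(2) by (simp add: m_def dist_commute)
    moreover have "dist (?D2 w v y2) (?D2 w v x) < \<eta>"
      using d2(2)[of y2] y2(1) t(2) by (simp add: m_def dist_commute add.commute)
    ultimately show False using \<eta> unfolding dist_real_def \<eta>_def by argo
  qed
qed

lemma Ck_on_Pair:
  fixes f :: "'a::euclidean_space \<Rightarrow> 'b::real_normed_vector" and g :: "'a \<Rightarrow> 'c::real_normed_vector"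
  assumes "Ck_on k f S" "Ck_on k g S" "open S"
  shows "Ck_on k (\<lambda>x. (f x, g x)) S"
proof -
  have "bounded_linear (\<lambda>y::'b. (y, 0::'c))" "bounded_linear (\<lambda>y::'c. (0::'b, y))"
    by (simp_all add: bounded_linear_Pair bounded_linear_ident bounded_linear_zero)
  from Ck_on_add[OF Ck_on_bounded_linear[OF this(1) assms(1,3)] Ck_on_bounded_linear[OF this(2) assms(2,3)] assms(3)]
  show ?thesis by simp
qed

lemma Ck_on_inverse_norm:
  "Ck_on k (\<lambda>x::'a::euclidean_space. inverse (norm x)) (- {0})"
proof -
  have o: "open (- {0::'a})" by auto
  \<comment> \<open>Away from 0, the function is a composition of \<open>exp\<close>,
    \<open>ln\<close> and the inner product, for which smoothness is already known.\<close>
  have eq: "exp (- (1/2) * ln (x \<bullet> x)) = inverse (norm x)" if "x \<in> - {0}" for x :: 'a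
  proof -
    have "ln (x \<bullet> x) = 2 * ln (norm x)"
      using that by (simp add: dot_square_norm ln_realpow)
    then show ?thesis using that by (simp add: exp_minus)
  qed
  have "Ck_on k (\<lambda>x::'a. ln (x \<bullet> x)) (- {0})"
    by (rule Ck_on_compose[OF Ck_on_ln_real Ck_on_inner[OF Ck_on_ident Ck_on_ident] _ o]) auto
  then have "Ck_on k (\<lambda>x::'a. exp (- (1/2) * ln (x \<bullet> x))) (- {0})"
    by (rule Ck_on_compose[OF Ck_on_exp_real Ck_on_mult[OF Ck_on_const[OF o]] _ o]) (use o in auto)
  from Ck_on_transfer[OF o this eq] show ?thesis by simp
qed

section \<open>The inverse function theorem with a C^1 inverse\<close>

lemma Ck_on_inverse_function:
  fixes f :: "'a::euclidean_space \<Rightarrow> 'a"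
  assumes f: "Ck_on 1 f S" and S: "open S" "x0 \<in> S" and inj: "inj (\<D> f x0)"
  obtains U V g where "open U" "U \<subseteq> S" "x0 \<in> U" "open V" "f x0 \<in> V" "homeomorphism U V f g" "Ck_on 1 g V"
proof -
  define A where "A x = Blinfun (\<D> f x)" for x
  have A: "blinfun_apply (A x) = \<D> f x" if "x \<in> S" for x
    using Ck_on_has_derivative[of 0 f S x] f S that unfolding A_def
    by (simp add: bounded_linear_Blinfun_apply has_derivative_bounded_linear)
  have der: "(f has_derivative blinfun_apply (A x)) (at x)" if "x \<in> S" for x
    using Ck_on_has_derivative[of 0 f S x] f S that A by simp
  have contA: "continuous_on S A"
  proof (rule continuous_on_blinfun_componentwise)
    fix i :: 'a
    have "continuous_on S (\<lambda>x. \<D> f x i)" using f by simp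
    then show "continuous_on S (\<lambda>x. A x i)" using A by (simp cong: continuous_on_cong)
  qed
  obtain B where B: "linear B" "B \<circ> \<D> f x0 = id"
    using linear_injective_left_inverse[OF has_derivative_linear[OF der[OF S(2)]]] inj A[OF S(2)] by auto
  have "Blinfun B o\<^sub>L A x0 = id_blinfun"
    using B A[OF S(2)]
    by (intro blinfun_eqI) (auto simp: bounded_linear_Blinfun_apply linear_conv_bounded_linear fun_eq_iff)
  from inverse_function_theorem[OF S(1) der contA S(2) this]
  obtain U V g g' where UV: "open U" "U \<subseteq> S" "x0 \<in> U" "open V" "f x0 \<in> V" "homeomorphism U V f g"
    and g: "\<And>y. y \<in> V \<Longrightarrow> (g has_derivative (g' y)) (at y)"
    and g': "\<And>y. y \<in> V \<Longrightarrow> g' y = inv (blinfun_apply (A (g y)))"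
    and bij: "\<And>y. y \<in> V \<Longrightarrow> bij (blinfun_apply (A (g y)))"
    by metis
  have gS: "g ` V \<subseteq> S" using UV by (auto simp: homeomorphism_def)
  have contg: "continuous_on V (\<lambda>y. A (g y))"
    using UV gS by (intro continuous_on_compose2[OF contA]) (auto simp: homeomorphism_def)
  have right: "A (g y) (g' y w) = w" if "y \<in> V" for y w
    using bij[OF that] g'[OF that] by (simp add: bij_is_surj surj_f_inv_f)
  \<comment> \<open>Continuity of the derivative of the inverse. Injectivity bounds
    \<open>A (g y)\<close> below by some \<open>b\<close>, hence \<open>A (g y')\<close> below by
    b/2 for y' near y. Applied to \<open>g' y' w - g' y w\<close>, this bounds the difference by the
    defect with which \<open>g' y w\<close> solves the equation at y', and that defect tends to
    0.\<close>
  have "isCont (\<lambda>y. g' y w) y" if y: "y \<in> V" for y w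
  proof -
    obtain b where b: "b > 0" "\<And>x. b * norm x \<le> norm (A (g y) x)"
      using linear_inj_bounded_below_pos[of "blinfun_apply (A (g y))"] bij[OF y]
      by (metis bij_is_inj blinfun.bounded_linear_right bounded_linear.linear)
    have tA: "((\<lambda>y. A (g y)) \<longlongrightarrow> A (g y)) (at y)"
      using contg UV(4) y by (simp add: continuous_on_eq_continuous_at isCont_def)
    have "eventually (\<lambda>y'. norm (A (g y') - A (g y)) < b / 2) (at y)"
      using tendstoD[OF tA, of "b/2"] b(1) by (simp add: dist_norm)
    moreover have "eventually (\<lambda>y'. y' \<in> V) (at y)" using UV(4) y by (rule eventually_at_in_open')
    ultimately have "eventually (\<lambda>y'. norm (g' y' w - g' y w) \<le> (2 / b) * norm (w - A (g y') (g' y w))) (at y)"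
    proof eventually_elim
      case (elim y')
      define x where "x = g' y' w - g' y w"
      have "b * norm x \<le> norm (A (g y') x) + norm ((A (g y') - A (g y)) x)"
        using b(2)[of x] norm_triangle_ineq4[of "A (g y') x" "(A (g y') - A (g y)) x"]
        by (simp add: blinfun.diff_left)
      also have "norm ((A (g y') - A (g y)) x) \<le> norm (A (g y') - A (g y)) * norm x"
        by (rule norm_blinfun)
      also have "\<dots> \<le> (b / 2) * norm x" using elim by (intro mult_right_mono) auto
      finally have "b / 2 * norm x \<le> norm (A (g y') x)" by simp
      moreover have "A (g y') x = w - A (g y') (g' y w)"
        using right[OF elim(2)] by (simp add: x_def blinfun.diff_right)
      ultimately have "b * norm x \<le> 2 * norm (w - A (g y') (g' y w))" by simp
      then show ?case using b(1) by (simp add: x_def field_simps)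
    qed
    moreover have "((\<lambda>y'. (2 / b) * norm (w - A (g y') (g' y w))) \<longlongrightarrow> (2 / b) * norm (w - A (g y) (g' y w))) (at y)"
      by (intro tendsto_intros blinfun.tendsto tA)
    ultimately have "((\<lambda>y'. g' y' w - g' y w) \<longlongrightarrow> 0) (at y)"
      using right[OF y] by (auto intro: Lim_null_comparison)
    then show ?thesis by (simp add: isCont_def LIM_zero_iff)
  qed
  then have "Ck_on 1 g V"
    using Ck_on_SucI[OF UV(4) g, of 0] by (simp add: continuous_at_imp_continuous_on)
  with UV that show thesis by blast
qed

section \<open>The tubular neighborhood of the boundary\<close>

definition grad :: "('a::euclidean_space \<Rightarrow> real) \<Rightarrow> 'a \<Rightarrow> 'a" where
  "grad f x = (\<Sum>b\<in>Basis. \<D> f x b *\<^sub>R b)"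

lemma grad_inner:
  assumes "(f has_derivative f') (at x)"
  shows "grad f x \<bullet> v = f' v"
proof -
  have "grad f x \<bullet> v = (\<Sum>b\<in>Basis. (v \<bullet> b) *\<^sub>R f' b)"
    unfolding grad_def frechet_derivative_eqI[OF assms] by (simp add: inner_sum_left inner_commute[of v] mult.commute)
  then show ?thesis using frechet_derivative_expand[OF assms, of v] by simp
qed

lemma has_derivative_grad:
  assumes "Ck_on (Suc k) f S" "open S" "x \<in> S"
  shows "(f has_derivative (\<lambda>v. grad f x \<bullet> v)) (at x)"
  using Ck_on_has_derivative[OF assms] grad_inner[OF Ck_on_has_derivative[OF assms]] by (simp add: eta_contract_eq)

lemma Ck_on_grad: "Ck_on (Suc k) f S \<Longrightarrow> open S \<Longrightarrow> Ck_on k (grad f) S"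
  unfolding grad_def[abs_def] by (intro Ck_on_sum Ck_on_scaleR Ck_on_const) auto

text \<open>The part \<open>h\<close> of \<open>g\<close> orthogonal to \<open>w\<close> vanishes:
  otherwise a slight tilt of \<open>h\<close> towards \<open>w\<close> lies in the open half space,
  but \<open>g\<close> is positive on it.\<close>

lemma antiparallel_if_halfspace:
  fixes g w :: "'a::euclidean_space"
  assumes "w \<noteq> 0" "\<And>v. v \<bullet> w > 0 \<Longrightarrow> g \<bullet> v \<le> 0"
  obtains c where "c \<ge> 0" "g = - (c *\<^sub>R w)"
proof -
  define c where "c = - (g \<bullet> w) / (w \<bullet> w)"
  define h where "h = g + c *\<^sub>R w"
  have w: "w \<bullet> w > 0" using assms(1) by simp
  have "c * (w \<bullet> w) = - (g \<bullet> w)" using w unfolding c_def by simp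
  then have hw: "h \<bullet> w = 0" unfolding h_def inner_add_left inner_scaleR_left by simp
  have "g \<bullet> w \<le> 0" using assms(2)[of w] w by simp
  then have c: "c \<ge> 0" using w by (simp add: c_def divide_nonpos_nonneg)
  have gh: "g \<bullet> h = h \<bullet> h"
  proof -
    have "h \<bullet> h = g \<bullet> h + c * (w \<bullet> h)" by (subst h_def) (simp add: inner_add_left)
    then show ?thesis using hw by (simp add: inner_commute)
  qed
  have "h = 0"
  proof (rule ccontr)
    assume "h \<noteq> 0"
    then have hh: "h \<bullet> h > 0" by simp
    \<comment> \<open>Chosen so that the tilt \<open>e *\<^sub>R w\<close> costs at most half of
      \<open>h \<bullet> h\<close>; the added 1 keeps the denominator positive.\<close>
    define e where "e = (h \<bullet> h) / (2 * (\<bar>g \<bullet> w\<bar> + 1))"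
    have e: "e > 0" using hh by (simp add: e_def)
    have "g \<bullet> (h + e *\<^sub>R w) \<le> 0"
      using assms(2)[of "h + e *\<^sub>R w"] e w hw by (simp add: inner_add_left)
    then have "h \<bullet> h + e * (g \<bullet> w) \<le> 0" using gh by (simp add: inner_add_right)
    moreover have "e * (g \<bullet> w) \<ge> - (e * (\<bar>g \<bullet> w\<bar> + 1))"
      using e mult_left_mono[of "- (\<bar>g \<bullet> w\<bar> + 1)" "g \<bullet> w" e] by (simp add: algebra_simps)
    moreover have "e * (\<bar>g \<bullet> w\<bar> + 1) = (h \<bullet> h) / 2"
      unfolding e_def by (simp add: field_simps)
    ultimately show False using hh by linarith
  qed
  with c show thesis using that[of c] by (simp add: h_def eq_neg_iff_add_eq_0)
qed

lemma directional_derivative_nonpos: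
  fixes f :: "'a::euclidean_space \<Rightarrow> real"
  assumes "(f has_derivative f') (at x)" "eventually (\<lambda>s. f (x + s *\<^sub>R v) \<le> f x) (at_right 0)"
  shows "f' v \<le> 0"
proof (rule ccontr)
  assume "\<not> f' v \<le> 0"
  have "((\<lambda>s. f (x + s *\<^sub>R v)) has_derivative (\<lambda>h. f' (h *\<^sub>R v))) (at (0::real))"
    by (rule has_derivative_compose[where f = "\<lambda>s. x + s *\<^sub>R v"])
      (use assms(1) in \<open>auto intro!: derivative_eq_intros\<close>)
  then have "((\<lambda>s. f (x + s *\<^sub>R v)) has_real_derivative f' v) (at 0)"
    using linear_scale[OF has_derivative_linear[OF assms(1)]]
    by (simp add: has_field_derivative_def mult_commute_abs)
  from has_real_derivative_pos_inc_right[OF this] \<open>\<not> f' v \<le> 0\<close>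
  obtain d where d: "d > 0" "\<And>h. 0 < h \<Longrightarrow> h < d \<Longrightarrow> f x < f (x + h *\<^sub>R v)"
    by auto
  have "eventually (\<lambda>s. s \<in> {0<..<d}) (at_right 0)"
    using d(1) by (rule eventually_at_right_real)
  with assms(2) have "eventually (\<lambda>s::real. False) (at_right 0)"
    by eventually_elim (use d(2) in fastforce)
  then show False by simp
qed

lemma C2_defining_functionD:
  assumes "C2_defining_function \<Omega> W \<rho>" "open \<Omega>"
  shows "open W" "frontier \<Omega> \<subseteq> W" "Ck_on (Suc (Suc 0)) \<rho> W"
    "z \<in> W \<Longrightarrow> z \<in> \<Omega> \<Longrightarrow> \<rho> z < 0" "z \<in> W \<Longrightarrow> z \<notin> closure \<Omega> \<Longrightarrow> \<rho> z > 0"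
    "z \<in> frontier \<Omega> \<Longrightarrow> \<rho> z = 0" "z \<in> frontier \<Omega> \<Longrightarrow> grad \<rho> z \<noteq> 0"
proof -
  show *: "open W" "frontier \<Omega> \<subseteq> W" "Ck_on (Suc (Suc 0)) \<rho> W"
    using assms by (auto simp: C2_defining_function_def boundary_nbhd_def numeral_2_eq_2)
  show "z \<in> W \<Longrightarrow> z \<in> \<Omega> \<Longrightarrow> \<rho> z < 0" "z \<in> W \<Longrightarrow> z \<notin> closure \<Omega> \<Longrightarrow> \<rho> z > 0"
    "z \<in> frontier \<Omega> \<Longrightarrow> \<rho> z = 0"
    using assms by (auto simp: C2_defining_function_def)
  assume z: "z \<in> frontier \<Omega>"
  then have "z \<in> W" using * by auto
  from frechet_derivative_eqI[OF has_derivative_grad[OF *(3,1) this]]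
  have "\<D> \<rho> z = (\<lambda>v. grad \<rho> z \<bullet> v)" .
  moreover have "\<D> \<rho> z \<noteq> (\<lambda>v. 0)" using assms z by (auto simp: C2_defining_function_def)
  ultimately show "grad \<rho> z \<noteq> 0" by auto
qed

lemma frontier_open_disjoint: "open \<Omega> \<Longrightarrow> z \<in> frontier \<Omega> \<Longrightarrow> z \<notin> \<Omega>"
  by (simp add: frontier_def interior_open)

text \<open>The open ball about \<open>z\<close> with \<open>q\<close> on its sphere misses the
  boundary, so by connectedness it lies inside \<Omega> or outside. Along every direction at
  \<open>q\<close> that enters the ball, \<rho> then moves to one side of 0, which makes the
  gradient a multiple of \<open>z - q\<close>. The side also decides the sign of \<open>t\<close>
  and of the signed distance.\<close>

lemma nearest_point_normal:
  assumes "C2_defining_function \<Omega> W \<rho>" "open \<Omega>" "q \<in> frontier \<Omega>" "dist z q = bdist \<Omega> z"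
  obtains t where "z - q = t *\<^sub>R grad \<rho> q" "sdist \<Omega> z = t * norm (grad \<rho> q)"
proof (cases "z = q")
  case True
  then have "bdist \<Omega> z = 0" using assms(4) by simp
  then show thesis using that[of 0] True assms frontier_open_disjoint[of \<Omega> z] by (simp add: sdist_def)
next
  case False
  note D = C2_defining_functionD[OF assms(1,2)]
  define w where "w = z - q"
  have w: "w \<noteq> 0" "norm w = dist z q" using False by (auto simp: w_def dist_norm)
  have qW: "q \<in> W" using D(2) assms(3) by auto
  note der = has_derivative_grad[OF D(3,1) qW]
  have "ball z (dist z q) \<inter> frontier \<Omega> = {}"
  proof -
    have "dist z y \<ge> dist z q" if "y \<in> frontier \<Omega>" for y
      using infdist_le[OF that, of z] assms(4) by (simp add: bdist_def)
    then show ?thesis by fastforce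
  qed
  then have alt: "ball z (dist z q) \<subseteq> \<Omega> \<or> ball z (dist z q) \<inter> \<Omega> = {}"
    using connected_Int_frontier[of "ball z (dist z q)" \<Omega>] by blast
  have zb: "z \<in> ball z (dist z q)" using False by simp
  \<comment> \<open>Expanding |w - s v|^2 shows that a direction with positive product with
    \<open>w\<close> enters the ball for small s > 0.\<close>
  have into: "eventually (\<lambda>s. q + s *\<^sub>R v \<in> ball z (dist z q) \<inter> W) (at_right 0)" if "v \<bullet> w > 0" for v
  proof -
    have "((\<lambda>s. q + s *\<^sub>R v) \<longlongrightarrow> q + 0 *\<^sub>R v) (at_right 0)" by (intro tendsto_intros)
    then have ev1: "eventually (\<lambda>s. q + s *\<^sub>R v \<in> W) (at_right 0)"
      using topological_tendstoD[of _ q _ W] D(1) qW by simp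
    have "((\<lambda>s. s * (v \<bullet> v)) \<longlongrightarrow> 0 * (v \<bullet> v)) (at_right (0::real))" by (intro tendsto_intros)
    then have ev2: "eventually (\<lambda>s. s * (v \<bullet> v) < 2 * (v \<bullet> w)) (at_right 0)"
      using that by (intro order_tendstoD(2)) auto
    have ev3: "eventually (\<lambda>s. s > 0) (at_right (0::real))" by (simp add: eventually_at_right_less)
    show ?thesis using ev1 ev2 ev3
    proof eventually_elim
      case (elim s)
      have "(norm (w - s *\<^sub>R v))\<^sup>2 = (norm w)\<^sup>2 - s * (2 * (v \<bullet> w) - s * (v \<bullet> v))"
        by (simp add: power2_norm_eq_inner inner_diff_left inner_diff_right inner_commute algebra_simps)
      also have "\<dots> < (norm w)\<^sup>2" using elim by simp
      finally have "norm (w - s *\<^sub>R v) < norm w" by (rule power_less_imp_less_base) simp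
      moreover have "z - (q + s *\<^sub>R v) = w - s *\<^sub>R v" by (simp add: w_def)
      ultimately have "dist z (q + s *\<^sub>R v) < dist z q" using w(2) by (simp only: dist_norm)
      then show ?case using elim(1) by simp
    qed
  qed
  show thesis
  proof (cases "ball z (dist z q) \<subseteq> \<Omega>")
    case True
    have "grad \<rho> q \<bullet> v \<le> 0" if "v \<bullet> w > 0" for v
    proof (rule directional_derivative_nonpos[OF der])
      show "eventually (\<lambda>s. \<rho> (q + s *\<^sub>R v) \<le> \<rho> q) (at_right 0)"
        using into[OF that] by eventually_elim (use D(4,6) True assms(3) in \<open>auto intro!: less_imp_le\<close>)
    qed
    then obtain c where c: "c \<ge> 0" "grad \<rho> q = - (c *\<^sub>R w)" using antiparallel_if_halfspace[OF w(1)] by metis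
    then have "c > 0" using D(7)[OF assms(3)] by (cases "c = 0") auto
    have "z \<in> \<Omega>" using True zb by auto
    then show thesis using that[of "- (1/c)"] c \<open>c > 0\<close> w(2) assms(4) by (simp add: sdist_def w_def)
  next
    case False
    then have dis: "ball z (dist z q) \<inter> \<Omega> = {}" using alt by auto
    then have dis': "ball z (dist z q) \<inter> closure \<Omega> = {}"
      using open_Int_closure_eq_empty[OF open_ball] by metis
    have "(- grad \<rho> q) \<bullet> v \<le> 0" if "v \<bullet> w > 0" for v
    proof (rule directional_derivative_nonpos[where f' = "\<lambda>v. (- grad \<rho> q) \<bullet> v"])
      show "((\<lambda>x. - \<rho> x) has_derivative (\<lambda>v. (- grad \<rho> q) \<bullet> v)) (at q)"
        using has_derivative_minus[OF der] by simp
      show "eventually (\<lambda>s. - \<rho> (q + s *\<^sub>R v) \<le> - \<rho> q) (at_right 0)"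
        using into[OF that]
      proof eventually_elim
        case (elim s)
        then have "q + s *\<^sub>R v \<notin> closure \<Omega>" using dis' by auto
        then show ?case using D(5)[of "q + s *\<^sub>R v"] D(6)[OF assms(3)] elim by simp
      qed
    qed
    then obtain c where c: "c \<ge> 0" "- grad \<rho> q = - (c *\<^sub>R w)" using antiparallel_if_halfspace[OF w(1)] by metis
    then have "c > 0" using D(7)[OF assms(3)] by (cases "c = 0") auto
    have "z \<notin> \<Omega>" using dis zb by blast
    then show thesis using that[of "1/c"] c \<open>c > 0\<close> w(2) assms(4) by (simp add: sdist_def w_def)
  qed
qed

text \<open>By \<open>nearest_point_normal\<close>, every nearest point of \<open>z\<close> solves
  the equation inverted here. The inverse function theorem leaves only one solution near
  \<open>(p, 0)\<close>, depending on \<open>z\<close> in a C^1 way.\<close>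

lemma tubular_local:
  fixes \<Omega> :: "(complex^'n) set"
  assumes def: "C2_defining_function \<Omega> W \<rho>" "open \<Omega>" and p: "p \<in> frontier \<Omega>"
  obtains e \<xi> where "e > 0" "ball p e \<subseteq> W" "Ck_on 1 \<xi> (ball p e)"
    "\<And>z q. z \<in> ball p e \<Longrightarrow> q \<in> frontier \<Omega> \<Longrightarrow> dist z q = bdist \<Omega> z \<Longrightarrow> q = \<xi> z"
proof -
  note D = C2_defining_functionD[OF def]
  define g where "g = grad \<rho>"
  have g: "Ck_on 1 g W" using Ck_on_grad[OF D(3,1)] by (simp add: g_def)
  have pW: "p \<in> W" using D(2) p by auto
  \<comment> \<open>\<open>F (q, t) = (z, 0)\<close> says that \<open>q\<close> is a boundary point and \<open>z\<close> lies on its normal line\<close>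
  define F where "F z = (fst z + snd z *\<^sub>R g (fst z), \<rho> (fst z))" for z :: "(complex^'n) \<times> real"
  have oW: "open (W \<times> (UNIV :: real set))" using D(1) by (simp add: open_Times)
  have cfst: "Ck_on 1 (fst :: (complex^'n) \<times> real \<Rightarrow> _) (W \<times> UNIV)"
    by (rule Ck_on_bounded_linear[OF bounded_linear_fst Ck_on_ident]) (rule oW)+
  have csnd: "Ck_on 1 (snd :: (complex^'n) \<times> real \<Rightarrow> _) (W \<times> UNIV)"
    by (rule Ck_on_bounded_linear[OF bounded_linear_snd Ck_on_ident]) (rule oW)+
  have r1: "Ck_on 1 \<rho> W" using Ck_on_Suc_imp[OF D(3)] by simp
  have "Ck_on 1 F (W \<times> UNIV)"
    unfolding F_def[abs_def]
    by (intro Ck_on_Pair Ck_on_add Ck_on_scaleR cfst csnd oW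
        Ck_on_compose[OF g cfst] Ck_on_compose[OF r1 cfst]) (use D(1) in auto)
  moreover have Fp: "\<D> F (p, 0) = (\<lambda>(v, \<tau>). (v + \<tau> *\<^sub>R g p, g p \<bullet> v))"
  proof (rule frechet_derivative_eqI)
    have gd: "(g has_derivative \<D> g p) (at p)"
      using Ck_on_has_derivative[of 0 g W p] g D(1) pW by simp
    have "((\<lambda>z. g (fst z)) has_derivative (\<lambda>h. \<D> g p (fst h))) (at (p, 0::real))"
      by (rule has_derivative_compose[where f = fst]) (use gd in \<open>auto intro!: derivative_eq_intros\<close>)
    moreover have "((\<lambda>z. \<rho> (fst z)) has_derivative (\<lambda>h. g p \<bullet> fst h)) (at (p, 0::real))"
      by (rule has_derivative_compose[where f = fst])
        (use has_derivative_grad[OF D(3,1) pW] in \<open>auto intro!: derivative_eq_intros simp: g_def\<close>)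
    ultimately show "(F has_derivative (\<lambda>(v, \<tau>). (v + \<tau> *\<^sub>R g p, g p \<bullet> v))) (at (p, 0))"
      unfolding F_def[abs_def] by (auto intro!: derivative_eq_intros simp: case_prod_beta)
  qed
  have gp: "g p \<noteq> 0" using D(7)[OF p] by (simp add: g_def)
  \<comment> \<open>A kernel vector is v = -\<tau> g(p) and also orthogonal to g(p), so \<tau>
    |g(p)|^2 = 0.\<close>
  have "inj (\<D> F (p, 0))"
  proof -
    have "linear (\<D> F (p, 0))"
      using \<open>Ck_on 1 F (W \<times> UNIV)\<close> oW pW Ck_on_has_derivative[of 0 F "W \<times> UNIV" "(p, 0)"]
      by (auto intro: has_derivative_linear)
    moreover have "v = 0 \<and> \<tau> = 0" if "\<D> F (p, 0) (v, \<tau>) = 0" for v \<tau>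
    proof -
      have *: "v = - (\<tau> *\<^sub>R g p)" "g p \<bullet> v = 0"
        using that by (auto simp: Fp zero_prod_def eq_neg_iff_add_eq_0)
      then have "\<tau> * (g p \<bullet> g p) = 0" by simp
      then show ?thesis using gp * by simp
    qed
    ultimately show ?thesis by (auto simp: linear_injective_0 zero_prod_def)
  qed
  ultimately obtain U' V G where UV: "open U'" "U' \<subseteq> W \<times> UNIV" "(p, 0) \<in> U'" "open V" "F (p, 0) \<in> V"
    "homeomorphism U' V F G" "Ck_on 1 G V"
    using Ck_on_inverse_function[of F "W \<times> UNIV" "(p, 0)"] oW pW by auto
  have "F (p, 0) = (p, 0)" using D(6)[OF p] by (simp add: F_def)
  then have pV: "(p, 0) \<in> V" using UV by simp
  obtain A B where AB: "open A" "open B" "(p, 0) \<in> A \<times> B" "A \<times> B \<subseteq> V"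
    by (rule open_prod_elim[OF UV(4) pV])
  obtain A' B' where AB': "open A'" "open B'" "(p, 0) \<in> A' \<times> B'" "A' \<times> B' \<subseteq> U'"
    by (rule open_prod_elim[OF UV(1,3)])
  have "isCont (\<lambda>x. norm (g x)) p"
    using Ck_on_imp_continuous_on[OF g] D(1) pW by (intro continuous_intros) (simp add: continuous_on_eq_continuous_at)
  then have "((\<lambda>x. norm (g x)) \<longlongrightarrow> norm (g p)) (nhds p)"
    using tendsto_at_iff_tendsto_nhds[of "\<lambda>x. norm (g x)" p] by (simp add: isCont_def)
  then have "eventually (\<lambda>x. norm (g x) > norm (g p) / 2) (nhds p)"
    using gp by (intro order_tendstoD(1)) auto
  then obtain e1 where e1: "e1 > 0" "\<And>x. dist x p < e1 \<Longrightarrow> norm (g x) > norm (g p) / 2"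
    by (auto simp: eventually_nhds_metric)
  have "open (A \<inter> A' \<inter> W)" "p \<in> A \<inter> A' \<inter> W" using AB AB' D(1) pW by auto
  then obtain e2 where e2: "e2 > 0" "ball p e2 \<subseteq> A \<inter> A' \<inter> W" by (rule openE)
  obtain e3 where e3: "e3 > 0" "ball 0 e3 \<subseteq> B'"
    using openE[of B' 0] AB' by auto
  \<comment> \<open>A nearest point \<open>q\<close> of \<open>z\<close> lies within 2e of
    \<open>p\<close>; hence the halves. There the gradient keeps at least half of its length at
    \<open>p\<close>, so |t| |g(q)| = |z - q| < e forces |t| < \<open>e3\<close> by the last
    entry.\<close>
  define e where "e = min (min (e1 / 2) (e2 / 2)) (e3 * (norm (g p) / 2))"
  have e: "e > 0" using e1(1) e2(1) e3(1) gp by (simp add: e_def)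
  show thesis
  proof (rule that[OF e, of "\<lambda>z. fst (G (z, 0))"])
    have be: "ball p e \<subseteq> ball p e2" using e1 e2 by (auto simp: e_def)
    then show "ball p e \<subseteq> W" using e2(2) by auto
    have "Ck_on 1 (\<lambda>z. (z, 0::real)) (ball p e)" by (intro Ck_on_Pair Ck_on_ident Ck_on_const open_ball)
    moreover have "(\<lambda>z. (z, 0::real)) ` ball p e \<subseteq> V" using be e2(2) AB by auto
    ultimately have "Ck_on 1 (\<lambda>z. G (z, 0)) (ball p e)"
      by (rule Ck_on_compose[OF UV(7) _ _ open_ball UV(4)])
    then show "Ck_on 1 (\<lambda>z. fst (G (z, 0))) (ball p e)"
      by (rule Ck_on_bounded_linear[OF bounded_linear_fst _ open_ball])
  next
    fix z q assume z: "z \<in> ball p e" and q: "q \<in> frontier \<Omega>" "dist z q = bdist \<Omega> z"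
    obtain t where t: "z - q = t *\<^sub>R g q" using nearest_point_normal[OF def q] unfolding g_def by metis
    have zp: "dist z p < e" using z by (simp add: dist_commute)
    have zq: "dist z q \<le> dist z p" using infdist_le[OF p, of z] q(2) by (simp add: bdist_def)
    have qp: "dist q p < 2 * e" using dist_triangle[of q p z] zq zp by (simp add: dist_commute)
    have gq: "norm (g q) > norm (g p) / 2" using e1(2) qp by (simp add: e_def)
    have "\<bar>t\<bar> * norm (g q) = dist z q" using t by (metis dist_norm norm_scaleR)
    then have "\<bar>t\<bar> * norm (g q) < e3 * (norm (g p) / 2)" using zq zp by (simp add: e_def)
    moreover have "\<bar>t\<bar> * (norm (g p) / 2) \<le> \<bar>t\<bar> * norm (g q)" using gq by (intro mult_left_mono) auto
    ultimately have "\<bar>t\<bar> * (norm (g p) / 2) < e3 * (norm (g p) / 2)" by linarith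
    then have "\<bar>t\<bar> < e3" using gp by simp
    then have "t \<in> B'" using e3(2) by (auto simp: dist_real_def)
    moreover have "q \<in> A'" using qp e2(2) by (auto simp: e_def dist_commute subset_iff)
    ultimately have "(q, t) \<in> U'" using AB' by auto
    then have "G (F (q, t)) = (q, t)" using UV(6) by (simp add: homeomorphism_def)
    moreover have "F (q, t) = (z, 0)" using t D(6)[OF q(1)] by (simp add: F_def algebra_simps)
    ultimately show "q = fst (G (z, 0))" by simp
  qed
qed

lemma sdist_frontier: "open \<Omega> \<Longrightarrow> z \<in> frontier \<Omega> \<Longrightarrow> sdist \<Omega> z = 0"
  using frontier_open_disjoint[of \<Omega> z] by (simp add: sdist_def bdist_def)

text \<open>Locally the signed distance is (z - \<xi>(z)) . n(\<xi>(z)), with \<xi> and the unit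
  normal n of class C^1 only. Its gradient turns out to be n(\<xi>(z)), which is C^1 again; this is
  how the second derivative is gained.\<close>

lemma tubular_neighborhood:
  fixes \<Omega> :: "(complex^'n) set"
  assumes def: "C2_defining_function \<Omega> W \<rho>" "open \<Omega>"
  obtains U where "regular_nbhd \<Omega> U" "U \<subseteq> W"
    "\<And>z. z \<in> U \<Longrightarrow> nearest \<Omega> z \<in> frontier \<Omega>"
    "\<And>z. z \<in> U \<Longrightarrow> norm (grad (sdist \<Omega>) z) = 1"
    "\<And>z. z \<in> U \<Longrightarrow> grad (sdist \<Omega>) (nearest \<Omega> z) = grad (sdist \<Omega>) z"
    "\<And>z. z \<in> U \<Longrightarrow> z - nearest \<Omega> z = sdist \<Omega> z *\<^sub>R grad (sdist \<Omega>) z"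
proof -
  note D = C2_defining_functionD[OF def]
  define n where "n q = inverse (norm (grad \<rho> q)) *\<^sub>R grad \<rho> q" for q
  have n1: "norm (n q) = 1" if "q \<in> frontier \<Omega>" for q using D(7)[OF that] by (simp add: n_def)
  define W' where "W' = W \<inter> grad \<rho> -` (- {0})"
  have g: "Ck_on 1 (grad \<rho>) W" using Ck_on_grad[OF D(3,1)] by simp
  have oW': "open W'"
    unfolding W'_def by (rule continuous_open_preimage[OF Ck_on_imp_continuous_on[OF g] D(1)]) auto
  have frW': "frontier \<Omega> \<subseteq> W'" using D(2,7) by (auto simp: W'_def)
  have g': "Ck_on 1 (grad \<rho>) W'" by (rule Ck_on_subset[OF g]) (auto simp: W'_def)
  have "Ck_on 1 (\<lambda>q. inverse (norm (grad \<rho> q))) W'"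
    by (rule Ck_on_compose[OF Ck_on_inverse_norm g' _ oW']) (auto simp: W'_def)
  then have n: "Ck_on 1 n W'"
    unfolding n_def[abs_def] using g' oW' by (intro Ck_on_scaleR)
  have loc: "\<exists>e>0. ball p e \<subseteq> W \<and> Ck_on 2 (sdist \<Omega>) (ball p e) \<and>
      (\<forall>z\<in>ball p e. (\<exists>!q. q \<in> frontier \<Omega> \<and> dist z q = bdist \<Omega> z) \<and> nearest \<Omega> z \<in> frontier \<Omega>
        \<and> grad (sdist \<Omega>) z = n (nearest \<Omega> z) \<and> z - nearest \<Omega> z = sdist \<Omega> z *\<^sub>R n (nearest \<Omega> z))"
    if p: "p \<in> frontier \<Omega>" for p
  proof -
    obtain e \<xi> where e: "e > 0" "ball p e \<subseteq> W" and \<xi>: "Ck_on 1 \<xi> (ball p e)"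
      and uniq: "\<And>z q. z \<in> ball p e \<Longrightarrow> q \<in> frontier \<Omega> \<Longrightarrow> dist z q = bdist \<Omega> z \<Longrightarrow> q = \<xi> z"
      using tubular_local[OF def p] by metis
    let ?B = "ball p e"
    have ex: "\<xi> z \<in> frontier \<Omega> \<and> dist z (\<xi> z) = bdist \<Omega> z" if z: "z \<in> ?B" for z
    proof -
      obtain q where "q \<in> frontier \<Omega>" "infdist z (frontier \<Omega>) = dist z q"
        using infdist_attains_inf[of "frontier \<Omega>" z] p frontier_closed by blast
      with uniq[OF z] show ?thesis by (auto simp: bdist_def)
    qed
    have near: "nearest \<Omega> z = \<xi> z" if "z \<in> ?B" for z
      unfolding nearest_def by (rule the_equality) (use ex[OF that] uniq[OF that] in auto)
    have normal: "z - \<xi> z = sdist \<Omega> z *\<^sub>R n (\<xi> z)" if z: "z \<in> ?B" for z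
    proof -
      obtain t where t: "z - \<xi> z = t *\<^sub>R grad \<rho> (\<xi> z)" "sdist \<Omega> z = t * norm (grad \<rho> (\<xi> z))"
        using nearest_point_normal[OF def] ex[OF z] by metis
      then show ?thesis using D(7) ex[OF z] by (simp add: n_def)
    qed
    have sd: "(z - \<xi> z) \<bullet> n (\<xi> z) = sdist \<Omega> z" if z: "z \<in> ?B" for z
      using normal[OF z] n1[of "\<xi> z"] ex[OF z] by (simp add: dot_square_norm)
    have \<xi>W: "\<xi> ` ?B \<subseteq> W'" using ex frW' by auto
    have n\<xi>: "Ck_on 1 (\<lambda>z. n (\<xi> z)) ?B" by (rule Ck_on_compose[OF n \<xi> \<xi>W open_ball oW'])
    have der: "(sdist \<Omega> has_derivative (\<lambda>v. n (\<xi> z) \<bullet> v)) (at z)" if z: "z \<in> ?B" for z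
    proof -
      have nd: "((\<lambda>z. n (\<xi> z)) has_derivative \<D> (\<lambda>z. n (\<xi> z)) z) (at z)"
        using Ck_on_has_derivative[of 0 "\<lambda>z. n (\<xi> z)" ?B z] n\<xi> z by simp
      have \<xi>d: "(\<xi> has_derivative \<D> \<xi> z) (at z)"
        using Ck_on_has_derivative[of 0 \<xi> ?B z] \<xi> z by simp
      let ?N = "\<D> (\<lambda>z. n (\<xi> z)) z" and ?X = "\<D> \<xi> z"
      have nn: "n (\<xi> z) \<bullet> ?N v = 0" for v
      proof -
        have "((\<lambda>w. n (\<xi> w) \<bullet> n (\<xi> w)) has_derivative (\<lambda>v. n (\<xi> z) \<bullet> ?N v + ?N v \<bullet> n (\<xi> z))) (at z)"
          by (rule has_derivative_inner[OF nd nd])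
        moreover have "((\<lambda>w. n (\<xi> w) \<bullet> n (\<xi> w)) has_derivative (\<lambda>v. 0)) (at z)"
        proof (rule has_derivative_transform_within_open[OF has_derivative_const open_ball z])
          show "1 = n (\<xi> w) \<bullet> n (\<xi> w)" if "w \<in> ?B" for w
            using n1[of "\<xi> w"] ex[OF that] by (simp add: dot_square_norm)
        qed
        ultimately have "(\<lambda>v. n (\<xi> z) \<bullet> ?N v + ?N v \<bullet> n (\<xi> z)) = (\<lambda>v. 0)"
          by (rule has_derivative_unique)
        then show ?thesis by (simp add: fun_eq_iff inner_commute)
      qed
      \<comment> \<open>\<rho> vanishes on the image of \<xi>, so the derivative of \<xi> is
        tangential. Together with \<open>nn\<close>, which comes from |n| = 1, all terms of the
        product rule except \<open>n (\<xi> z) \<bullet> v\<close> drop out.\<close>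
      have nX: "n (\<xi> z) \<bullet> ?X v = 0" for v
      proof -
        have \<xi>zW: "\<xi> z \<in> W" using ex[OF z] D(2) by auto
        have "((\<lambda>w. \<rho> (\<xi> w)) has_derivative (\<lambda>v. grad \<rho> (\<xi> z) \<bullet> ?X v)) (at z)"
          by (rule has_derivative_compose[OF \<xi>d has_derivative_grad[OF D(3,1) \<xi>zW]])
        moreover have "((\<lambda>w. \<rho> (\<xi> w)) has_derivative (\<lambda>v. 0)) (at z)"
        proof (rule has_derivative_transform_within_open[OF has_derivative_const open_ball z])
          show "0 = \<rho> (\<xi> w)" if "w \<in> ?B" for w
            using D(6) ex[OF that] by simp
        qed
        ultimately have "(\<lambda>v. grad \<rho> (\<xi> z) \<bullet> ?X v) = (\<lambda>v. 0)"
          by (rule has_derivative_unique)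
        then show ?thesis by (simp add: fun_eq_iff n_def)
      qed
      have "((\<lambda>w. (w - \<xi> w) \<bullet> n (\<xi> w)) has_derivative (\<lambda>v. (z - \<xi> z) \<bullet> ?N v + (v - ?X v) \<bullet> n (\<xi> z))) (at z)"
        by (rule has_derivative_inner[OF has_derivative_diff[OF has_derivative_ident \<xi>d] nd])
      moreover have "(z - \<xi> z) \<bullet> ?N v + (v - ?X v) \<bullet> n (\<xi> z) = n (\<xi> z) \<bullet> v" for v
        using nn[of v] nX[of v] inner_commute[of "?X v" "n (\<xi> z)"] inner_commute[of v "n (\<xi> z)"]
        unfolding normal[OF z] by (simp add: inner_diff_left)
      ultimately have "((\<lambda>w. (w - \<xi> w) \<bullet> n (\<xi> w)) has_derivative (\<lambda>v. n (\<xi> z) \<bullet> v)) (at z)"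
        by simp
      from has_derivative_transform_within_open[OF this open_ball z sd] show ?thesis by simp
    qed
    have C2: "Ck_on 2 (sdist \<Omega>) ?B"
      unfolding numeral_2_eq_2
    proof (rule Ck_on_SucI[OF open_ball der])
      show "Ck_on (Suc 0) (\<lambda>x. n (\<xi> x) \<bullet> v) ?B" for v
        using Ck_on_bounded_linear[OF bounded_linear_inner_left n\<xi> open_ball] by simp
    qed
    have gr: "grad (sdist \<Omega>) z = n (\<xi> z)" if "z \<in> ?B" for z
      using grad_inner[OF der[OF that]] by (metis vector_eq_rdot inner_commute)
    have "\<exists>!q. q \<in> frontier \<Omega> \<and> dist z q = bdist \<Omega> z" if "z \<in> ?B" for z
      using ex[OF that] uniq[OF that] by blast
    then show ?thesis
      using e C2 gr near normal ex by (intro exI[of _ e]) (auto simp del: mem_ball)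
  qed
  define P where "P p e \<longleftrightarrow> 0 < e \<and> ball p e \<subseteq> W \<and> Ck_on 2 (sdist \<Omega>) (ball p e) \<and>
      (\<forall>z\<in>ball p e. (\<exists>!q. q \<in> frontier \<Omega> \<and> dist z q = bdist \<Omega> z) \<and> nearest \<Omega> z \<in> frontier \<Omega>
        \<and> grad (sdist \<Omega>) z = n (nearest \<Omega> z) \<and> z - nearest \<Omega> z = sdist \<Omega> z *\<^sub>R n (nearest \<Omega> z))"
    for p e
  have "\<forall>p\<in>frontier \<Omega>. \<exists>e. P p e" using loc unfolding P_def by blast
  from bchoice[OF this] obtain e where eP: "\<And>p. p \<in> frontier \<Omega> \<Longrightarrow> P p (e p)" by blast
  have e: "0 < e p" "ball p (e p) \<subseteq> W" "Ck_on 2 (sdist \<Omega>) (ball p (e p))"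
    "z \<in> ball p (e p) \<Longrightarrow> \<exists>!q. q \<in> frontier \<Omega> \<and> dist z q = bdist \<Omega> z"
    "z \<in> ball p (e p) \<Longrightarrow> nearest \<Omega> z \<in> frontier \<Omega>"
    "z \<in> ball p (e p) \<Longrightarrow> grad (sdist \<Omega>) z = n (nearest \<Omega> z)"
    "z \<in> ball p (e p) \<Longrightarrow> z - nearest \<Omega> z = sdist \<Omega> z *\<^sub>R n (nearest \<Omega> z)"
    if "p \<in> frontier \<Omega>" for p z
    using eP[OF that] unfolding P_def by blast+
  define U where "U = (\<Union>p\<in>frontier \<Omega>. ball p (e p))"
  have frU: "frontier \<Omega> \<subseteq> U" using e(1) by (force simp: U_def)
  have oU: "open U" by (auto simp: U_def)
  have self: "nearest \<Omega> q = q" if "q \<in> frontier \<Omega>" for q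
    unfolding nearest_def by (rule the_equality) (use that infdist_zero[of q "frontier \<Omega>"] in \<open>auto simp: bdist_def\<close>)
  have gU: "grad (sdist \<Omega>) z = n (nearest \<Omega> z)" "nearest \<Omega> z \<in> frontier \<Omega>" if "z \<in> U" for z
    using that e(5,6) unfolding U_def by blast+
  show thesis
  proof (rule that[of U])
    show "regular_nbhd \<Omega> U"
      unfolding regular_nbhd_def boundary_nbhd_def
    proof (intro conjI ballI oU frU)
      show "Ck_on 2 (sdist \<Omega>) U"
        by (rule Ck_on_local[OF oU]) (use e(3) in \<open>auto simp: U_def\<close>)
      show "\<exists>!q. q \<in> frontier \<Omega> \<and> dist z q = bdist \<Omega> z" if "z \<in> U" for z
        using that e(4) unfolding U_def by blast
    qed
    show "U \<subseteq> W" using e(2) by (auto simp: U_def)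
    show "norm (grad (sdist \<Omega>) z) = 1" if "z \<in> U" for z using gU[OF that] n1 by simp
    show "grad (sdist \<Omega>) (nearest \<Omega> z) = grad (sdist \<Omega>) z" if "z \<in> U" for z
    proof -
      have "nearest \<Omega> z \<in> U" using gU(2)[OF that] frU by auto
      then show ?thesis using gU self that by simp
    qed
    show "z - nearest \<Omega> z = sdist \<Omega> z *\<^sub>R grad (sdist \<Omega>) z" if "z \<in> U" for z
      using that gU[OF that] e(7) unfolding U_def by force
  qed (rule gU)
qed

section \<open>The forms in real coordinates\<close>

text \<open>The complex structure as a real linear isometry. A (1,0)-vector \<open>X\<close> enters
  the forms below through the two real directions \<open>X\<close> and \<open>rot X\<close>, and it
  is complex tangential when both are orthogonal to \<nu>.\<close>

definition rot :: "complex^'n \<Rightarrow> complex^'n" where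
  "rot X = (\<chi> j. \<i> * X $ j)"

lemma rot_nth [simp]: "rot X $ j = \<i> * X $ j"
  by (simp add: rot_def)

lemma linear_rot: "linear rot"
  by (rule linearI) (simp_all add: vec_eq_iff distrib_left scaleR_conv_of_real)

lemma rot_add: "rot (X + Y) = rot X + rot Y"
  and rot_scaleR: "rot (c *\<^sub>R X) = c *\<^sub>R rot X"
  and rot_0 [simp]: "rot 0 = 0"
  and rot_rot [simp]: "rot (rot X) = - X"
  by (simp_all add: linear_add[OF linear_rot] linear_scale[OF linear_rot] vec_eq_iff flip: mult.assoc)

lemma inner_rot_rot [simp]: "rot X \<bullet> rot Y = X \<bullet> Y"
  by (simp add: inner_vec_def inner_complex_def algebra_simps)

lemma inner_rot_right: "X \<bullet> rot Y = - (rot X \<bullet> Y)"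
  using inner_rot_rot[of X "rot Y"] by simp

lemma inner_rot_self [simp]: "X \<bullet> rot X = 0" "rot X \<bullet> X = 0"
  using inner_rot_right[of X X] by (simp_all add: inner_commute)

lemma norm_rot [simp]: "norm (rot X) = norm X"
  by (simp add: norm_eq_sqrt_inner)

lemma tan_norm_sq_norm: "tan_norm_sq z X = (norm X)\<^sup>2 / 2"
  by (simp add: tan_norm_sq_eq norm_vec_def L2_set_def sum_nonneg)

lemma vec_real_expand:
  "X = (\<Sum>j\<in>UNIV. Re (X $ j) *\<^sub>R axis j 1 + Im (X $ j) *\<^sub>R axis j \<i>)" for X :: "complex^'n"
proof -
  have "(\<Sum>j\<in>UNIV. (Re (X $ j) *\<^sub>R axis j 1 + Im (X $ j) *\<^sub>R axis j \<i>) $ i) = X $ i" for i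
  proof -
    have "(\<Sum>j\<in>UNIV. (Re (X $ j) *\<^sub>R axis j 1 + Im (X $ j) *\<^sub>R axis j \<i>) $ i)
        = (\<Sum>j\<in>UNIV. if j = i then X $ j else 0)"
      by (rule sum.cong) (auto simp: axis_def complex_eq_iff)
    then show ?thesis by simp
  qed
  then show ?thesis by (simp add: vec_eq_iff)
qed

lemma linear_real_expand:
  fixes L :: "complex^'n \<Rightarrow> complex"
  assumes "linear L"
  shows "L X = (\<Sum>j\<in>UNIV. of_real (Re (X $ j)) * L (axis j 1) + of_real (Im (X $ j)) * L (axis j \<i>))"
proof -
  have "L X = L (\<Sum>j\<in>UNIV. Re (X $ j) *\<^sub>R axis j 1 + Im (X $ j) *\<^sub>R axis j \<i>)"
    by (rule arg_cong[OF vec_real_expand])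
  also have "\<dots> = (\<Sum>j\<in>UNIV. L (Re (X $ j) *\<^sub>R axis j 1 + Im (X $ j) *\<^sub>R axis j \<i>))"
    by (rule linear_sum[OF assms])
  also have "\<dots> = (\<Sum>j\<in>UNIV. of_real (Re (X $ j)) * L (axis j 1) + of_real (Im (X $ j)) * L (axis j \<i>))"
    unfolding linear_add[OF assms] linear_scale[OF assms] by (simp add: scaleR_conv_of_real)
  finally show ?thesis .
qed

text \<open>The value is the complex linear part of the real derivative; expanding \<open>F'\<close>
  along the real coordinate directions matches the sum over j term by term.\<close>

lemma del_T10:
  assumes "(F has_derivative F') (at z)"
  shows "del F z (T10 X) = (F' X - \<i> * F' (rot X)) / 2"
proof -
  note L = linear_real_expand[OF has_derivative_linear[OF assms]]
  have "d_z j F z * X $ j = (of_real (Re (X $ j)) * F' (axis j 1) + of_real (Im (X $ j)) * F' (axis j \<i>)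
    - \<i> * (of_real (Re (rot X $ j)) * F' (axis j 1) + of_real (Im (rot X $ j)) * F' (axis j \<i>))) / 2" for j
    unfolding d_z_def frechet_derivative_eqI[OF assms]
    by (subst complex_eq[of "X $ j"]) (simp add: field_simps)
  then show ?thesis
    unfolding del_def T10_def L[of X] L[of "rot X"] sum_distrib_left sum_subtractf[symmetric]
      sum_divide_distrib fst_conv
    by (intro sum.cong refl)
qed

lemma delbar_conj:
  assumes "(F has_derivative F') (at z)"
  shows "delbar F z (conj_tan (T10 X)) = (F' X + \<i> * F' (rot X)) / 2"
proof -
  note L = linear_real_expand[OF has_derivative_linear[OF assms]]
  have "d_zbar j F z * cnj (X $ j) = (of_real (Re (X $ j)) * F' (axis j 1) + of_real (Im (X $ j)) * F' (axis j \<i>)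
    + \<i> * (of_real (Re (rot X $ j)) * F' (axis j 1) + of_real (Im (rot X $ j)) * F' (axis j \<i>))) / 2" for j
    unfolding d_zbar_def frechet_derivative_eqI[OF assms]
    by (subst (1) complex_eq[of "X $ j"]) (simp add: field_simps)
  then show ?thesis
    unfolding delbar_def T10_def conj_tan_def conj_vec_def L[of X] L[of "rot X"]
    by (simp add: sum_divide_distrib sum_distrib_left sum.distrib add_divide_distrib)
qed

lemma has_derivative_of_real:
  "(f has_derivative f') F \<Longrightarrow> ((\<lambda>w. complex_of_real (f w)) has_derivative (\<lambda>v. complex_of_real (f' v))) F"
  by (rule bounded_linear.has_derivative[OF bounded_linear_of_real])

text \<open>For fixed \<open>X\<close> the contracted (0,1)-derivative \<open>G\<close> is known
  from \<open>delbar_conj\<close>, and the Levi form is its (1,0)-derivative in the direction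
  \<open>X\<close>. The mixed second derivatives in \<open>X\<close> and \<open>rot X\<close> enter
  only the imaginary part.\<close>

lemma levi_real:
  assumes "Ck_on 2 f S" "open S" "z \<in> S"
  shows "levi f z X = (\<H> f z X X
    + \<H> f z (rot X) (rot X)) / 4"
proof -
  let ?D = "\<lambda>w. \<D> f w"
  let ?F = "\<lambda>w. complex_of_real (f w)"
  have C: "Ck_on (Suc (Suc 0)) f S" using assms(1) by (simp only: numeral_2_eq_2)
  have fd: "(?F has_derivative (\<lambda>v. complex_of_real (?D w v))) (at w)" if "w \<in> S" for w
    by (rule has_derivative_of_real[OF Ck_on_has_derivative[OF C assms(2) that]])
  have Dd: "((\<lambda>w. ?D w v) has_derivative \<D> (\<lambda>w. ?D w v) z) (at z)" for v
    by (rule Ck_on_has_derivative[of 0, OF _ assms(2,3)]) (use C in simp)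
  have zb: "d_zbar k ?F w = (of_real (?D w (axis k 1)) + \<i> * of_real (?D w (axis k \<i>))) / 2" if "w \<in> S" for k w
    unfolding d_zbar_def frechet_derivative_eqI[OF fd[OF that]] ..
  define E where "E k v = (of_real (\<D> (\<lambda>w. ?D w (axis k 1)) z v)
    + \<i> * of_real (\<D> (\<lambda>w. ?D w (axis k \<i>)) z v)) / 2" for k v
  have zbd: "(d_zbar k ?F has_derivative E k) (at z)" for k
  proof (rule has_derivative_transform_within_open[OF _ assms(2,3) zb[symmetric]])
    show "((\<lambda>w. (complex_of_real (?D w (axis k 1)) + \<i> * complex_of_real (?D w (axis k \<i>))) / 2) has_derivative E k) (at z)"
      unfolding E_def[abs_def] by (auto intro!: derivative_eq_intros has_derivative_of_real Dd)
  qed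
  define G where "G w = (\<Sum>k\<in>UNIV. d_zbar k ?F w * cnj (X $ k))" for w
  have Gd: "(G has_derivative (\<lambda>v. \<Sum>k\<in>UNIV. E k v * cnj (X $ k))) (at z)"
    unfolding G_def[abs_def] by (intro has_derivative_sum has_derivative_mult_left zbd)
  have Geq: "G w = (of_real (?D w X) + \<i> * of_real (?D w (rot X))) / 2" if "w \<in> S" for w
    using delbar_conj[OF fd[OF that], of X] by (simp add: G_def delbar_def conj_tan_def T10_def conj_vec_def)
  define G' where "G' v = (complex_of_real (\<D> (\<lambda>w. ?D w X) z v)
    + \<i> * of_real (\<D> (\<lambda>w. ?D w (rot X)) z v)) / 2" for v
  \<comment> \<open>\<open>G\<close> has two expressions, one through the \<open>d_zbar k\<close>
    and one through real directional derivatives; uniqueness of the derivative turns the first into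
    the second.\<close>
  have "(G has_derivative G') (at z)"
  proof (rule has_derivative_transform_within_open[OF _ assms(2,3) Geq[symmetric]])
    show "((\<lambda>w. (complex_of_real (?D w X) + \<i> * complex_of_real (?D w (rot X))) / 2) has_derivative G') (at z)"
      unfolding G'_def[abs_def] by (auto intro!: derivative_eq_intros has_derivative_of_real Dd)
  qed
  with Gd have GE: "(\<Sum>k\<in>UNIV. E k v * cnj (X $ k)) = G' v" for v
    by (rule fun_cong[OF has_derivative_unique])
  have "levi f z X = Re (\<Sum>k\<in>UNIV. del (d_zbar k ?F) z (T10 X) * cnj (X $ k))"
    unfolding levi_eq by (subst sum.swap) (simp add: del_def T10_def sum_distrib_right)
  also have "(\<Sum>k\<in>UNIV. del (d_zbar k ?F) z (T10 X) * cnj (X $ k)) = (G' X - \<i> * G' (rot X)) / 2"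
    unfolding del_T10[OF zbd] GE[symmetric]
    by (simp add: sum_distrib_left sum_subtractf sum_divide_distrib diff_divide_distrib left_diff_distrib mult.assoc)
  also have "Re ((G' X - \<i> * G' (rot X)) / 2) = (\<D> (\<lambda>w. ?D w X) z X
    + \<D> (\<lambda>w. ?D w (rot X)) z (rot X)) / 4"
    by (simp add: G'_def)
  finally show ?thesis .
qed

lemma cnj_inner_sum: "(\<Sum>j\<in>UNIV. cnj (b $ j) * a $ j) = of_real (a \<bullet> b) + \<i> * of_real (a \<bullet> rot b)"
  for a b :: "complex^'n"
  by (simp add: inner_vec_def inner_complex_def complex_eq_iff sum.distrib sum_subtractf algebra_simps flip: sum_negf)

section \<open>The Hessian of the signed distance and the forms \<alpha> and \<beta>\<close>

locale regular_point =
  fixes \<Omega> U :: "(complex^'n) set" and z :: "complex^'n"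
  assumes reg: "Ck_on 2 (sdist \<Omega>) U" "open U" "z \<in> U"
    and norm_grad: "\<And>w. w \<in> U \<Longrightarrow> norm (grad (sdist \<Omega>) w) = 1"
begin

abbreviation \<nu> :: "complex^'n" where "\<nu> \<equiv> grad (sdist \<Omega>) z"
abbreviation H :: "complex^'n \<Rightarrow> complex^'n" where "H \<equiv> \<D> (grad (sdist \<Omega>)) z"

lemma C2: "Ck_on (Suc (Suc 0)) (sdist \<Omega>) U"
  using reg(1) by (simp only: numeral_2_eq_2)

lemma sdist_deriv: "w \<in> U \<Longrightarrow> (sdist \<Omega> has_derivative (\<lambda>v. grad (sdist \<Omega>) w \<bullet> v)) (at w)"
  by (rule has_derivative_grad[OF C2 reg(2)])

lemma grad_deriv: "(grad (sdist \<Omega>) has_derivative H) (at z)"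
  by (rule Ck_on_has_derivative[OF Ck_on_grad[OF C2 reg(2)] reg(2,3)])

lemma H_linear: "linear H"
  by (rule has_derivative_linear[OF grad_deriv])

lemma norm_nu: "norm \<nu> = 1" and nu_nu: "\<nu> \<bullet> \<nu> = 1"
  using norm_grad[OF reg(3)] by (simp_all add: dot_square_norm)

lemma second_derivative: "\<H> (sdist \<Omega>) z v = (\<lambda>w. H w \<bullet> v)"
proof (rule frechet_derivative_eqI)
  show "((\<lambda>w. \<D> (sdist \<Omega>) w v) has_derivative (\<lambda>w. H w \<bullet> v)) (at z)"
  proof (rule has_derivative_transform_within_open[OF has_derivative_inner_left[OF grad_deriv] reg(2,3)])
    show "grad (sdist \<Omega>) w \<bullet> v = \<D> (sdist \<Omega>) w v" if "w \<in> U" for w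
      using frechet_derivative_eqI[OF sdist_deriv[OF that]] by simp
  qed
qed

lemma H_sym: "H v \<bullet> w = v \<bullet> H w"
  using second_derivative_symmetric[OF reg, of w v] by (simp add: second_derivative inner_commute)

text \<open>The gradient has length 1 on all of \<open>U\<close>, so its derivative is orthogonal to
  it. By symmetry the normal direction then also lies in the kernel of \<open>H\<close>.\<close>

lemma H_normal: "H v \<bullet> \<nu> = 0"
proof -
  have "((\<lambda>w. grad (sdist \<Omega>) w \<bullet> grad (sdist \<Omega>) w) has_derivative (\<lambda>v. \<nu> \<bullet> H v + H v \<bullet> \<nu>)) (at z)"
    by (rule has_derivative_inner[OF grad_deriv grad_deriv])
  moreover have "((\<lambda>w. grad (sdist \<Omega>) w \<bullet> grad (sdist \<Omega>) w) has_derivative (\<lambda>v. 0)) (at z)"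
    by (rule has_derivative_transform_within_open[OF has_derivative_const reg(2,3), of 1])
      (simp add: norm_grad dot_square_norm)
  ultimately have "(\<lambda>v. \<nu> \<bullet> H v + H v \<bullet> \<nu>) = (\<lambda>v. 0)" by (rule has_derivative_unique)
  then show ?thesis by (simp add: fun_eq_iff inner_commute)
qed

lemma H_nu: "H \<nu> = 0"
  using H_sym[of \<nu>] H_normal by (metis inner_eq_zero_iff inner_commute)

lemma levi_sdist: "levi (sdist \<Omega>) z X = (X \<bullet> H X + rot X \<bullet> H (rot X)) / 4"
  unfolding levi_real[OF reg] second_derivative by (simp add: inner_commute)

lemma del_sdist_eq_0: "del (sdistc \<Omega>) z (T10 X) = 0 \<longleftrightarrow> \<nu> \<bullet> X = 0 \<and> \<nu> \<bullet> rot X = 0"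
  unfolding del_T10[OF has_derivative_of_real[OF sdist_deriv[OF reg(3)]]] by (simp add: complex_eq_iff)

lemma d_z_sdist: "w \<in> U \<Longrightarrow> d_z j (sdistc \<Omega>) w = cnj (grad (sdist \<Omega>) w $ j) / 2"
  and d_zbar_sdist: "w \<in> U \<Longrightarrow> d_zbar j (sdistc \<Omega>) w = grad (sdist \<Omega>) w $ j / 2"
  unfolding d_z_def d_zbar_def
  by (simp_all add: frechet_derivative_eqI[OF has_derivative_of_real[OF sdist_deriv]] inner_axis
      inner_complex_def complex_eq_iff)

lemma d_zbar_deriv: "(d_zbar j (sdistc \<Omega>) has_derivative (\<lambda>v. H v $ j / 2)) (at z)"
proof (rule has_derivative_transform_within_open[OF _ reg(2,3) d_zbar_sdist[symmetric]])
  show "((\<lambda>w. grad (sdist \<Omega>) w $ j / 2) has_derivative (\<lambda>v. H v $ j / 2)) (at z)"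
    by (auto intro!: derivative_eq_intros bounded_linear.has_derivative[OF bounded_linear_vec_nth grad_deriv])
qed

lemma d_z_deriv: "(d_z j (sdistc \<Omega>) has_derivative (\<lambda>v. cnj (H v $ j) / 2)) (at z)"
proof (rule has_derivative_transform_within_open[OF _ reg(2,3) d_z_sdist[symmetric]])
  show "((\<lambda>w. cnj (grad (sdist \<Omega>) w $ j) / 2) has_derivative (\<lambda>v. cnj (H v $ j) / 2)) (at z)"
    by (auto intro!: derivative_eq_intros bounded_linear.has_derivative[OF bounded_linear_cnj]
        bounded_linear.has_derivative[OF bounded_linear_vec_nth grad_deriv])
qed

text \<open>Of the Hermitian product with \<nu> only the part along \<open>rot \<nu>\<close>
  survives, because \<open>H\<close> takes values orthogonal to \<nu>. Thus \<alpha> records the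
  entries of the Hessian that couple \<open>X\<close> with the direction
  \<open>rot \<nu>\<close>.\<close>

lemma alpha_T10_eq:
  "alpha \<Omega> z (T10 X) = (of_real (rot \<nu> \<bullet> H (rot X)) + \<i> * of_real (rot \<nu> \<bullet> H X)) / 4"
proof -
  have "cnj (delbar (d_z j (sdistc \<Omega>)) z (conj_tan (T10 X))) = (H X $ j - \<i> * H (rot X) $ j) / 4" for j
    unfolding delbar_conj[OF d_z_deriv] by (simp add: field_simps)
  then have *: "(\<Sum>k\<in>UNIV. cnj (d_zbar k (d_z j (sdistc \<Omega>)) z) * X $ k) = (H X $ j - \<i> * H (rot X) $ j) / 4" for j
    by (simp add: delbar_def conj_tan_def T10_def conj_vec_def)
  have "alpha \<Omega> z (T10 X) = (\<Sum>j\<in>UNIV. cnj (\<nu> $ j) * (H X $ j - \<i> * H (rot X) $ j)) / 4"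
    unfolding alpha_T10 * d_zbar_sdist[OF reg(3)]
    by (simp add: sum_distrib_left sum_divide_distrib)
  also have "(\<Sum>j\<in>UNIV. cnj (\<nu> $ j) * (H X $ j - \<i> * H (rot X) $ j))
    = (\<Sum>j\<in>UNIV. cnj (\<nu> $ j) * H X $ j) - \<i> * (\<Sum>j\<in>UNIV. cnj (\<nu> $ j) * H (rot X) $ j)"
    by (simp add: sum_distrib_left sum_subtractf algebra_simps)
  also have "\<dots> = of_real (rot \<nu> \<bullet> H (rot X)) + \<i> * of_real (rot \<nu> \<bullet> H X)"
    unfolding cnj_inner_sum H_normal by (simp add: inner_commute algebra_simps flip: mult.assoc)
  finally show ?thesis .
qed

lemma alpha_cmod: "(cmod (alpha \<Omega> z (T10 X)))\<^sup>2 = ((rot \<nu> \<bullet> H (rot X))\<^sup>2 + (rot \<nu> \<bullet> H X)\<^sup>2) / 16"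
  unfolding alpha_T10_eq cmod_power2 by (simp add: power_divide add_divide_distrib)

lemma alpha_conj: "alpha \<Omega> z (conj_tan V) = cnj (alpha \<Omega> z V)"
proof -
  have "conj_tan (conj_tan V) = V" by (simp add: conj_tan_def conj_vec_def)
  then show ?thesis by (simp add: alpha_def Re_form_def sum_divide_distrib add.commute)
qed

text \<open>In each summand the cross terms of \<open>H X\<close> and \<open>H (rot X)\<close>
  cancel. Inserting \<open>alpha_cmod\<close>, four times 2 \<beta> becomes the sum of the squared
  lengths of \<open>H X\<close> and \<open>H (rot X)\<close> after their components along
  \<open>rot \<nu>\<close> are removed.\<close>

lemma beta_eq:
  "Re (eval11 (beta \<Omega> z) X X) = ((norm (H X))\<^sup>2 + (norm (H (rot X)))\<^sup>2) / 8 - 2 * (cmod (alpha \<Omega> z (T10 X)))\<^sup>2"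
proof -
  let ?W = "conj_tan (T10 X)"
  have W: "del F z ?W = 0" "delbar F z (T10 X) = 0" for F
    by (simp_all add: del_def delbar_def conj_tan_def T10_def conj_vec_def)
  have a0: "pi_10 (alpha \<Omega> z) (T10 X) = alpha \<Omega> z (T10 X)" "pi_01 (alpha \<Omega> z) ?W = cnj (alpha \<Omega> z (T10 X))"
    "pi_01 (alpha \<Omega> z) (T10 X) = 0"
  proof -
    show "pi_10 (alpha \<Omega> z) (T10 X) = alpha \<Omega> z (T10 X)" by (simp add: pi_10_def T10_def)
    have "(0, snd ?W) = ?W" by (simp add: conj_tan_def T10_def conj_vec_def vec_eq_iff)
    then show "pi_01 (alpha \<Omega> z) ?W = cnj (alpha \<Omega> z (T10 X))" by (simp add: pi_01_def alpha_conj)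
    show "pi_01 (alpha \<Omega> z) (T10 X) = 0"
      by (simp add: pi_01_def T10_def alpha_def Re_form_def delbar_def conj_tan_def conj_vec_def)
  qed
  have w: "wedge (del F z) (delbar G z) (T10 X) ?W = del F z (T10 X) * delbar G z ?W" for F G
    by (simp add: wedge_def W)
  have wa: "wedge (pi_10 (alpha \<Omega> z)) (pi_01 (alpha \<Omega> z)) (T10 X) ?W = of_real ((cmod (alpha \<Omega> z (T10 X)))\<^sup>2)"
    by (simp add: wedge_def a0 complex_norm_square del: of_real_power)
  have t: "del (d_z j (sdistc \<Omega>)) z (T10 X) * delbar (d_zbar j (sdistc \<Omega>)) z ?W
      + del (d_zbar j (sdistc \<Omega>)) z (T10 X) * delbar (d_z j (sdistc \<Omega>)) z ?W
      = of_real (((cmod (H X $ j))\<^sup>2 + (cmod (H (rot X) $ j))\<^sup>2) / 8)" for j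
    unfolding del_T10[OF d_z_deriv] del_T10[OF d_zbar_deriv] delbar_conj[OF d_z_deriv] delbar_conj[OF d_zbar_deriv]
    by (rule complex_eqI; simp only: Re_complex_of_real Im_complex_of_real cmod_power2;
        simp add: power2_eq_square field_simps)
  have n: "(norm v)\<^sup>2 = (\<Sum>j\<in>UNIV. (cmod (v $ j))\<^sup>2)" for v :: "complex^'n"
    by (simp add: norm_vec_def L2_set_def sum_nonneg)
  have arith: "- \<i> * (\<i> * complex_of_real s - 2 * \<i> * complex_of_real a) = of_real (s - 2 * a)" for s a
    by (simp add: complex_eq_iff)
  have "eval11 (beta \<Omega> z) X X = of_real (((norm (H X))\<^sup>2 + (norm (H (rot X)))\<^sup>2) / 8 - 2 * (cmod (alpha \<Omega> z (T10 X)))\<^sup>2)"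
    unfolding eval11_def beta_def w wa distrib_left[symmetric] t n sum.distrib[symmetric] sum_divide_distrib
      sum_distrib_left[symmetric] of_real_sum[symmetric]
    by (rule arith)
  then show ?thesis by (metis Re_complex_of_real)
qed

end

section \<open>The pointwise inequality\<close>

lemma abs_square_diff_bound:
  fixes p e K L :: real
  assumes "\<bar>p\<bar> \<le> K" "\<bar>e\<bar> \<le> L"
  shows "\<bar>(p + e)\<^sup>2 - p\<^sup>2\<bar> \<le> L * (2 * K + L)"
proof -
  have "(p + e)\<^sup>2 - p\<^sup>2 = e * (2 * p + e)" by (simp add: power2_eq_square algebra_simps)
  then have "\<bar>(p + e)\<^sup>2 - p\<^sup>2\<bar> = \<bar>e\<bar> * \<bar>2 * p + e\<bar>" by (simp add: abs_mult)
  also have "\<dots> \<le> L * (2 * K + L)" using assms by (intro mult_mono) auto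
  finally show ?thesis .
qed

text \<open>\<open>B\<close> and \<open>l\<close> are the second and first derivative at a point of \<open>\<psi>\<close>, and \<open>H\<close> and \<open>\<nu>\<close> those of the
  signed distance function, whose value is \<open>- \<delta>\<close>. Then \<open>Q \<eta>\<close> is four times
  $i\partial\bar\partial u - \eta\, i\partial u\wedge\bar\partial u$ for \<open>u = \<psi> - ln \<delta>\<close>.\<close>

locale normal_form =
  fixes \<nu> :: "complex^'n" and H :: "complex^'n \<Rightarrow> complex^'n"
    and B :: "complex^'n \<Rightarrow> complex^'n \<Rightarrow> real" and l :: "complex^'n \<Rightarrow> real"
    and \<delta> S L K :: real
  assumes nu: "\<nu> \<bullet> \<nu> = 1"
    and H_linear: "linear H" and H_sym: "\<And>v w. H v \<bullet> w = v \<bullet> H w" and H_nu: "H \<nu> = 0"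
    and B_add: "\<And>v v' w. B (v + v') w = B v w + B v' w" "\<And>v w w'. B v (w + w') = B v w + B v w'"
    and B_scale: "\<And>c v w. B (c *\<^sub>R v) w = c * B v w" "\<And>c v w. B v (c *\<^sub>R w) = c * B v w"
    and l_linear: "linear l"
    and \<delta>: "0 < \<delta>"
    and B_bound: "\<And>v w. \<bar>B v w\<bar> \<le> S * (norm v * norm w)"
    and l_bound: "\<And>v. \<bar>l v\<bar> \<le> L * norm v"
    and H_bound: "\<And>v. norm (H v) \<le> K * norm v"
begin

definition Q :: "real \<Rightarrow> complex^'n \<Rightarrow> real" where
  "Q \<eta> X = B X X + B (rot X) (rot X) + (X \<bullet> H X + rot X \<bullet> H (rot X)) / \<delta>
    + ((\<nu> \<bullet> X)\<^sup>2 + (\<nu> \<bullet> rot X)\<^sup>2) / \<delta>\<^sup>2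
    - \<eta> * ((l X + \<nu> \<bullet> X / \<delta>)\<^sup>2 + (l (rot X) + \<nu> \<bullet> rot X / \<delta>)\<^sup>2)"

text \<open>Four times the minimum described in the overview, without its last term; the two
  subtracted squares are four times |2 \<alpha>(\<tau>)|^2 with \<alpha> at the same point as
  \<open>H\<close>.\<close>

definition T :: "complex^'n \<Rightarrow> real" where
  "T \<tau> = B \<tau> \<tau> + B (rot \<tau>) (rot \<tau>) + (\<tau> \<bullet> H \<tau> + rot \<tau> \<bullet> H (rot \<tau>)) / \<delta>
    - (rot \<nu> \<bullet> H (rot \<tau>))\<^sup>2 - (rot \<nu> \<bullet> H \<tau>)\<^sup>2"

text \<open>Four times |\<partial>\<psi>(\<tau>) - 2 \<alpha>(\<tau>)|^2, again with \<alpha> at the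
  point of \<open>H\<close>.\<close>

definition R :: "complex^'n \<Rightarrow> real" where
  "R \<tau> = (l \<tau> - rot \<nu> \<bullet> H (rot \<tau>))\<^sup>2 + (l (rot \<tau>) + rot \<nu> \<bullet> H \<tau>)\<^sup>2"

text \<open>The vertex of the parabola in \<open>a\<close>: with p = l(\<tau>) and A =
  \<open>rot \<nu> \<bullet> H (rot \<tau>)\<close>, the terms of \<open>Q\<close> containing
  \<open>a\<close> tend to (1 - \<eta>) a^2 - 2 a (\<eta> p - A). The variable \<open>b\<close> is
  treated alike, with \<open>rot \<tau>\<close> in place of \<tau> and changed signs.\<close>

definition a_opt :: "real \<Rightarrow> complex^'n \<Rightarrow> real" where
  "a_opt \<eta> \<tau> = (\<eta> * l \<tau> - rot \<nu> \<bullet> H (rot \<tau>)) / (1 - \<eta>)"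

definition b_opt :: "real \<Rightarrow> complex^'n \<Rightarrow> real" where
  "b_opt \<eta> \<tau> = - (\<eta> * l (rot \<tau>) + rot \<nu> \<bullet> H \<tau>) / (1 - \<eta>)"

lemma norm_nu: "norm \<nu> = 1"
  using nu by (simp add: norm_eq_sqrt_inner)

lemma bounds_nonneg: "S \<ge> 0" "L \<ge> 0" "K \<ge> 0"
  using B_bound[of \<nu> \<nu>] l_bound[of \<nu>] H_bound[of \<nu>] norm_nu by (auto simp: H_nu linear_0[OF l_linear])

text \<open>The polynomial in \<open>(a, b)\<close> has its minimum at \<open>(a_opt, b_opt)\<close>; the error on the right tends to \<open>0\<close> at the
  boundary if \<open>\<delta> S\<close> does.\<close>

lemma Q_decompose:
  assumes \<eta>: "0 < \<eta>" "\<eta> < 1" and \<tau>: "\<nu> \<bullet> \<tau> = 0" "\<nu> \<bullet> rot \<tau> = 0" and \<delta>1: "\<delta> \<le> 1"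
  shows "\<bar>Q \<eta> (\<tau> + \<delta> *\<^sub>R (a *\<^sub>R \<nu> + b *\<^sub>R rot \<nu>))
      - (T \<tau> - \<eta> / (1 - \<eta>) * R \<tau> + (1 - \<eta>) * ((a - a_opt \<eta> \<tau>)\<^sup>2 + (b - b_opt \<eta> \<tau>)\<^sup>2))\<bar>
    \<le> (6 * (\<delta> * S) + \<delta> * K + \<delta> * (8 * L * (1 + L))) * ((norm \<tau>)\<^sup>2 + a\<^sup>2 + b\<^sup>2)"
proof -
  define Y where "Y = a *\<^sub>R \<nu> + b *\<^sub>R rot \<nu>"
  define m where "m = sqrt (a\<^sup>2 + b\<^sup>2)"
  define t where "t = norm \<tau>"
  have m2: "m\<^sup>2 = a\<^sup>2 + b\<^sup>2" by (simp add: m_def)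
  have m0: "0 \<le> m" "0 \<le> t" by (simp_all add: m_def t_def)
  have rY: "rot Y = a *\<^sub>R rot \<nu> - b *\<^sub>R \<nu>" by (simp add: Y_def rot_add rot_scaleR)
  have "Y \<bullet> Y = a\<^sup>2 + b\<^sup>2"
    using nu by (simp add: Y_def inner_add_left inner_add_right power2_eq_square)
  then have nY: "norm Y = m" by (simp add: m_def norm_eq_sqrt_inner)
  then have nrY: "norm (rot Y) = m" by simp
  have ip: "\<nu> \<bullet> Y = a" "\<nu> \<bullet> rot Y = - b"
    using nu unfolding rY by (simp_all add: Y_def inner_add_right inner_diff_right)
  let ?X = "\<tau> + \<delta> *\<^sub>R Y"
  have rX: "rot ?X = rot \<tau> + \<delta> *\<^sub>R rot Y" by (simp add: rot_add rot_scaleR)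
  have iX: "\<nu> \<bullet> ?X = \<delta> * a" "\<nu> \<bullet> rot ?X = - (\<delta> * b)"
    unfolding rX using \<tau> ip by (simp_all add: inner_add_right)
  note Hl = linear_add[OF H_linear] linear_scale[OF H_linear] linear_diff[OF H_linear] H_nu
  define A where "A = rot \<nu> \<bullet> H (rot \<tau>)"
  define C where "C = rot \<nu> \<bullet> H \<tau>"
  define h where "h = rot \<nu> \<bullet> H (rot \<nu>)"
  have HY: "H Y = b *\<^sub>R H (rot \<nu>)" "H (rot Y) = a *\<^sub>R H (rot \<nu>)"
    unfolding rY by (simp_all add: Y_def Hl)
  have c1: "v \<bullet> H (rot \<nu>) = rot \<nu> \<bullet> H v" for v using H_sym[of "rot \<nu>" v] by (simp add: inner_commute)
  have nuH: "\<nu> \<bullet> H v = 0" for v using H_sym[of \<nu> v] H_nu by simp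
  have YH: "Y \<bullet> H v = b * (rot \<nu> \<bullet> H v)" "rot Y \<bullet> H v = a * (rot \<nu> \<bullet> H v)" for v
    unfolding rY by (simp_all add: Y_def inner_add_left inner_diff_left nuH)
  \<comment> \<open>As \<open>H\<close> kills \<nu>, the normal part acts only through
    \<open>rot \<nu>\<close>, with coefficient \<open>b\<close> in \<open>Y\<close> and
    \<open>a\<close> in \<open>rot Y\<close>. The cross terms carry one factor \<delta>, which the
    division cancels: they survive at the boundary and are the source of \<alpha>.\<close>
  have hess: "(?X \<bullet> H ?X + rot ?X \<bullet> H (rot ?X)) / \<delta>
      = (\<tau> \<bullet> H \<tau> + rot \<tau> \<bullet> H (rot \<tau>)) / \<delta> + 2 * (a * A + b * C) + \<delta> * (m\<^sup>2 * h)"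
  proof -
    have "?X \<bullet> H ?X = \<tau> \<bullet> H \<tau> + 2 * \<delta> * (b * C) + \<delta> * \<delta> * (b * b * h)"
      unfolding Hl HY inner_add_left inner_add_right inner_scaleR_left inner_scaleR_right YH c1[of \<tau>]
        C_def h_def by (simp add: algebra_simps)
    moreover have "rot ?X \<bullet> H (rot ?X) = rot \<tau> \<bullet> H (rot \<tau>) + 2 * \<delta> * (a * A) + \<delta> * \<delta> * (a * a * h)"
      unfolding rX Hl HY inner_add_left inner_add_right inner_scaleR_left inner_scaleR_right YH c1[of "rot \<tau>"]
        A_def h_def by (simp add: algebra_simps)
    ultimately show ?thesis using \<delta> unfolding m2 by (simp add: field_simps power2_eq_square)
  qed
  \<comment> \<open>\<open>e1\<close> and \<open>e2\<close> collect the Hessian of \<psi> on mixed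
    and on normal directions, \<open>e3\<close> and \<open>e4\<close> the first derivative of \<psi>
    in normal directions; each tends to 0 with \<delta> and \<delta> S.\<close>
  define e1 where "e1 = \<delta> * (B \<tau> Y + B Y \<tau> + B (rot \<tau>) (rot Y) + B (rot Y) (rot \<tau>))"
  define e2 where "e2 = \<delta> * (\<delta> * (B Y Y + B (rot Y) (rot Y)))"
  have BX: "B ?X ?X + B (rot ?X) (rot ?X) = B \<tau> \<tau> + B (rot \<tau>) (rot \<tau>) + e1 + e2"
    unfolding rX e1_def e2_def by (simp add: B_add B_scale algebra_simps)
  define p where "p = l \<tau>"
  define q where "q = l (rot \<tau>)"
  define e3 where "e3 = (p + a + \<delta> * l Y)\<^sup>2 - (p + a)\<^sup>2"
  define e4 where "e4 = (q - b + \<delta> * l (rot Y))\<^sup>2 - (q - b)\<^sup>2"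
  have lX: "(l ?X + \<nu> \<bullet> ?X / \<delta>)\<^sup>2 + (l (rot ?X) + \<nu> \<bullet> rot ?X / \<delta>)\<^sup>2 = (p + a)\<^sup>2 + (q - b)\<^sup>2 + e3 + e4"
  proof -
    have "l ?X + \<nu> \<bullet> ?X / \<delta> = p + a + \<delta> * l Y"
      unfolding iX using \<delta> by (simp add: linear_add[OF l_linear] linear_scale[OF l_linear] p_def)
    moreover have "l (rot ?X) + \<nu> \<bullet> rot ?X / \<delta> = q - b + \<delta> * l (rot Y)"
      unfolding iX unfolding rX using \<delta> by (simp add: linear_add[OF l_linear] linear_scale[OF l_linear] q_def)
    ultimately show ?thesis by (simp add: e3_def e4_def)
  qed
  have nX: "((\<nu> \<bullet> ?X)\<^sup>2 + (\<nu> \<bullet> rot ?X)\<^sup>2) / \<delta>\<^sup>2 = a\<^sup>2 + b\<^sup>2"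
    unfolding iX using \<delta> by (simp add: power_mult_distrib flip: distrib_left)
  \<comment> \<open>Completing the square leaves (\<eta> p - A)^2/(1 - \<eta>) + \<eta> p^2,
    regrouped as A^2 + \<eta>/(1 - \<eta>) (p - A)^2. The first part goes into \<open>T\<close>, the
    second is the weighted square in the tangential condition.\<close>
  have square: "(1 - \<eta>) * (x - (\<eta> * p' - A') / (1 - \<eta>))\<^sup>2 = (1 - \<eta>) * x\<^sup>2 - 2 * x * (\<eta> * p' - A')
      + A'\<^sup>2 + \<eta> / (1 - \<eta>) * (p' - A')\<^sup>2 - \<eta> * p'\<^sup>2" for x p' A' :: real
  proof -
    have "1 - \<eta> \<noteq> 0" using \<eta> by simp
    then show ?thesis by (simp add: power2_eq_square divide_simps) (simp add: algebra_simps)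
  qed
  define k where "k = \<eta> / (1 - \<eta>)"
  have main: "Q \<eta> ?X - (T \<tau> - \<eta> / (1 - \<eta>) * R \<tau> + (1 - \<eta>) * ((a - a_opt \<eta> \<tau>)\<^sup>2 + (b - b_opt \<eta> \<tau>)\<^sup>2))
      = e1 + e2 + \<delta> * (m\<^sup>2 * h) - \<eta> * (e3 + e4)"
  proof -
    have s1: "(1 - \<eta>) * (a - a_opt \<eta> \<tau>)\<^sup>2 = (1 - \<eta>) * a\<^sup>2 - 2 * a * (\<eta> * p - A)
      + A\<^sup>2 + k * (p - A)\<^sup>2 - \<eta> * p\<^sup>2"
      unfolding a_opt_def using square[of a p A] by (simp only: A_def p_def k_def)
    have s2: "(1 - \<eta>) * (b - b_opt \<eta> \<tau>)\<^sup>2 = (1 - \<eta>) * b\<^sup>2 + 2 * b * (\<eta> * q + C)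
      + C\<^sup>2 + k * (q + C)\<^sup>2 - \<eta> * q\<^sup>2"
    proof -
      have "b_opt \<eta> \<tau> = (\<eta> * (- q) - C) / (1 - \<eta>)" by (simp add: b_opt_def q_def C_def)
      moreover have "(- q - C)\<^sup>2 = (q + C)\<^sup>2" by (simp add: power2_eq_square algebra_simps)
      ultimately show ?thesis using square[of b "- q" C] by (simp add: k_def algebra_simps)
    qed
    show ?thesis
      unfolding Q_def T_def R_def BX hess nX lX distrib_left[of "1 - \<eta>"] s1 s2
        A_def[symmetric] C_def[symmetric] p_def[symmetric] q_def[symmetric] k_def[symmetric]
      by (simp add: power2_eq_square algebra_simps)
  qed
  have Bb: "\<bar>B v w\<bar> \<le> S * (x * y)" if "norm v = x" "norm w = y" for v w x y
    using B_bound[of v w] that by simp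
  have tm: "t * m \<le> (t\<^sup>2 + m\<^sup>2) / 2" using sum_squares_bound[of t m] by simp
  have E1: "\<bar>e1\<bar> \<le> 2 * (\<delta> * S) * (t\<^sup>2 + m\<^sup>2)"
  proof -
    have "\<bar>B \<tau> Y + B Y \<tau> + B (rot \<tau>) (rot Y) + B (rot Y) (rot \<tau>)\<bar> \<le> 4 * (S * (t * m))"
      using Bb[of \<tau> t Y m] Bb[of Y m \<tau> t] Bb[of "rot \<tau>" t "rot Y" m] Bb[of "rot Y" m "rot \<tau>" t] nY nrY
      by (simp add: t_def mult.commute)
    also have "\<dots> \<le> 4 * (S * ((t\<^sup>2 + m\<^sup>2) / 2))"
      using tm bounds_nonneg(1) by (intro mult_left_mono) auto
    finally have "\<delta> * \<bar>B \<tau> Y + B Y \<tau> + B (rot \<tau>) (rot Y) + B (rot Y) (rot \<tau>)\<bar> \<le> \<delta> * (4 * (S * ((t\<^sup>2 + m\<^sup>2) / 2)))"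
      using \<delta> by (intro mult_left_mono) auto
    then show ?thesis using \<delta> by (simp add: e1_def abs_mult)
  qed
  have E2: "\<bar>e2\<bar> \<le> 2 * (\<delta> * S) * m\<^sup>2"
  proof -
    have "\<bar>B Y Y + B (rot Y) (rot Y)\<bar> \<le> 2 * (S * m\<^sup>2)"
      using Bb[OF nY nY] Bb[OF nrY nrY] by (simp add: power2_eq_square)
    then have "\<delta> * \<bar>B Y Y + B (rot Y) (rot Y)\<bar> \<le> 1 * (2 * (S * m\<^sup>2))"
      using \<delta> \<delta>1 by (intro mult_mono) auto
    then have "\<delta> * (\<delta> * \<bar>B Y Y + B (rot Y) (rot Y)\<bar>) \<le> \<delta> * (1 * (2 * (S * m\<^sup>2)))"
      using \<delta> by (intro mult_left_mono) auto
    then show ?thesis using \<delta> by (simp add: e2_def abs_mult)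
  qed
  have E5: "\<bar>\<delta> * (m\<^sup>2 * h)\<bar> \<le> \<delta> * K * m\<^sup>2"
  proof -
    have "\<bar>h\<bar> \<le> norm (rot \<nu>) * norm (H (rot \<nu>))" unfolding h_def by (rule Cauchy_Schwarz_ineq2)
    also have "\<dots> \<le> K" using H_bound[of "rot \<nu>"] norm_nu by simp
    finally have "\<delta> * m\<^sup>2 * \<bar>h\<bar> \<le> \<delta> * m\<^sup>2 * K" using \<delta> by (intro mult_left_mono) auto
    then show ?thesis using \<delta> by (simp add: abs_mult mult_ac)
  qed
  have ab: "\<bar>a\<bar> \<le> m" "\<bar>b\<bar> \<le> m" by (simp_all add: m_def real_le_rsqrt)
  have lY: "\<bar>\<delta> * l Y\<bar> \<le> \<delta> * L * m" "\<bar>\<delta> * l (rot Y)\<bar> \<le> \<delta> * L * m"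
    using l_bound[of Y] l_bound[of "rot Y"] nY nrY \<delta> by (simp_all add: abs_mult mult.assoc)
  have dLm: "\<delta> * L * m * (2 * (L * t + m) + \<delta> * L * m) \<le> \<delta> * (4 * L * (1 + L)) * (t\<^sup>2 + m\<^sup>2)"
  proof -
    have "\<delta> * (L * m) \<le> 1 * (L * m)" using \<delta>1 bounds_nonneg m0 by (intro mult_right_mono) auto
    then have "2 * (L * t + m) + \<delta> * L * m \<le> 2 * (L * t + m) + L * m" by (simp add: mult.assoc)
    then have "\<delta> * L * m * (2 * (L * t + m) + \<delta> * L * m) \<le> \<delta> * L * m * (2 * (L * t + m) + L * m)"
      using \<delta> bounds_nonneg m0 by (intro mult_left_mono) auto
    also have "\<dots> = \<delta> * L * (2 * L * (t * m) + (2 + L) * m\<^sup>2)" by (simp add: power2_eq_square algebra_simps)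
    also have "\<dots> \<le> \<delta> * L * (4 * (1 + L) * (t\<^sup>2 + m\<^sup>2))"
    proof (intro mult_left_mono)
      have "2 * L * (t * m) \<le> 2 * L * ((t\<^sup>2 + m\<^sup>2) / 2)" using tm bounds_nonneg by (intro mult_left_mono) auto
      moreover have "(2 + L) * m\<^sup>2 \<le> (2 + L) * (t\<^sup>2 + m\<^sup>2)" using bounds_nonneg by (intro mult_left_mono) auto
      ultimately have "2 * L * (t * m) + (2 + L) * m\<^sup>2 \<le> (2 + 2 * L) * (t\<^sup>2 + m\<^sup>2)" by (simp add: algebra_simps)
      also have "\<dots> \<le> 4 * (1 + L) * (t\<^sup>2 + m\<^sup>2)" using bounds_nonneg by (intro mult_right_mono) auto
      finally show "2 * L * (t * m) + (2 + L) * m\<^sup>2 \<le> 4 * (1 + L) * (t\<^sup>2 + m\<^sup>2)" .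
    qed (use \<delta> bounds_nonneg in auto)
    finally show ?thesis by (simp add: mult_ac)
  qed
  have pt: "\<bar>p + a\<bar> \<le> L * t + m" "\<bar>q - b\<bar> \<le> L * t + m"
    using l_bound[of \<tau>] l_bound[of "rot \<tau>"] ab by (auto simp: p_def q_def t_def)
  have E34: "\<bar>e3\<bar> \<le> \<delta> * (4 * L * (1 + L)) * (t\<^sup>2 + m\<^sup>2)" "\<bar>e4\<bar> \<le> \<delta> * (4 * L * (1 + L)) * (t\<^sup>2 + m\<^sup>2)"
    unfolding e3_def e4_def
    using abs_square_diff_bound[OF pt(1) lY(1)] abs_square_diff_bound[OF pt(2) lY(2)] dLm by linarith+
  have "\<bar>\<eta> * (e3 + e4)\<bar> \<le> 1 * (\<bar>e3\<bar> + \<bar>e4\<bar>)"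
    unfolding abs_mult using \<eta> by (intro mult_mono) auto
  then have E6: "\<bar>\<eta> * (e3 + e4)\<bar> \<le> \<delta> * (8 * L * (1 + L)) * (t\<^sup>2 + m\<^sup>2)" using E34 by simp
  have t2: "\<delta> * S * m\<^sup>2 \<le> \<delta> * S * (t\<^sup>2 + m\<^sup>2)" "\<delta> * K * m\<^sup>2 \<le> \<delta> * K * (t\<^sup>2 + m\<^sup>2)"
    using \<delta> bounds_nonneg by (auto intro!: mult_left_mono)
  have t3: "0 \<le> \<delta> * S * (t\<^sup>2 + m\<^sup>2)" using \<delta> bounds_nonneg by simp
  have "\<bar>e1 + e2 + \<delta> * (m\<^sup>2 * h) - \<eta> * (e3 + e4)\<bar>
      \<le> (6 * (\<delta> * S) + \<delta> * K + \<delta> * (8 * L * (1 + L))) * (t\<^sup>2 + m\<^sup>2)"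
    using E1 E2 E5 E6 t2 t3 unfolding distrib_right by linarith
  then have "\<bar>Q \<eta> ?X - (T \<tau> - \<eta> / (1 - \<eta>) * R \<tau> + (1 - \<eta>) * ((a - a_opt \<eta> \<tau>)\<^sup>2 + (b - b_opt \<eta> \<tau>)\<^sup>2))\<bar>
      \<le> (6 * (\<delta> * S) + \<delta> * K + \<delta> * (8 * L * (1 + L))) * (t\<^sup>2 + m\<^sup>2)"
    unfolding main .
  then show ?thesis unfolding Y_def m2 t_def by (simp only: add.assoc)
qed

text \<open>The error factor of \<open>Q_decompose\<close>, enlarged by the cost of replacing |X|^2
  by |\<tau>|^2 in the bound with constant \<open>M\<close>: the two differ by \<delta>^2 (a^2 +
  b^2).\<close>

definition err :: "real \<Rightarrow> real" where
  "err M = 6 * (\<delta> * S) + \<delta> * K + \<delta> * (8 * L * (1 + L)) + 2 * \<bar>M\<bar> * \<delta>\<^sup>2"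

lemma err_nonneg: "err M \<ge> 0"
  using \<delta> bounds_nonneg by (simp add: err_def)

text \<open>The vertex depends linearly on \<tau>, with a constant built from \<open>L\<close> and
  \<open>K\<close> only. This keeps the errors at the vertex proportional to |\<tau>|^2.\<close>

lemma opt_bound:
  assumes "0 < \<eta>" "\<eta> < 1"
  shows "(a_opt \<eta> \<tau>)\<^sup>2 \<le> ((L + K) / (1 - \<eta>))\<^sup>2 * (norm \<tau>)\<^sup>2" "(b_opt \<eta> \<tau>)\<^sup>2 \<le> ((L + K) / (1 - \<eta>))\<^sup>2 * (norm \<tau>)\<^sup>2"
proof -
  have n: "\<bar>rot \<nu> \<bullet> H v\<bar> \<le> K * norm v" for v
    using Cauchy_Schwarz_ineq2[of "rot \<nu>" "H v"] H_bound[of v] norm_nu by simp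
  have l: "\<bar>\<eta> * l v\<bar> \<le> L * norm v" for v
    using mult_mono[of \<eta> 1 "\<bar>l v\<bar>" "L * norm v"] l_bound[of v] assms by (simp add: abs_mult)
  have "\<bar>\<eta> * l \<tau> - rot \<nu> \<bullet> H (rot \<tau>)\<bar> \<le> (L + K) * norm \<tau>" "\<bar>\<eta> * l (rot \<tau>) + rot \<nu> \<bullet> H \<tau>\<bar> \<le> (L + K) * norm \<tau>"
    using n[of "rot \<tau>"] n[of \<tau>] l[of "rot \<tau>"] l[of \<tau>] unfolding norm_rot distrib_right by linarith+
  then have "\<bar>a_opt \<eta> \<tau>\<bar> \<le> (L + K) / (1 - \<eta>) * norm \<tau>" "\<bar>b_opt \<eta> \<tau>\<bar> \<le> (L + K) / (1 - \<eta>) * norm \<tau>"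
    using assms by (simp_all add: a_opt_def b_opt_def divide_right_mono)
  then show "(a_opt \<eta> \<tau>)\<^sup>2 \<le> ((L + K) / (1 - \<eta>))\<^sup>2 * (norm \<tau>)\<^sup>2" "(b_opt \<eta> \<tau>)\<^sup>2 \<le> ((L + K) / (1 - \<eta>))\<^sup>2 * (norm \<tau>)\<^sup>2"
    by (metis abs_ge_zero power2_abs power_mono power_mult_distrib)+
qed

lemma normal_decompose:
  obtains \<tau> a b where "X = \<tau> + \<delta> *\<^sub>R (a *\<^sub>R \<nu> + b *\<^sub>R rot \<nu>)" "\<nu> \<bullet> \<tau> = 0" "\<nu> \<bullet> rot \<tau> = 0"
proof -
  define a where "a = \<nu> \<bullet> X / \<delta>"
  define b where "b = rot \<nu> \<bullet> X / \<delta>"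
  define \<tau> where "\<tau> = X - \<delta> *\<^sub>R (a *\<^sub>R \<nu> + b *\<^sub>R rot \<nu>)"
  have "\<nu> \<bullet> \<tau> = 0" "rot \<nu> \<bullet> \<tau> = 0"
    using \<delta> nu by (simp_all add: \<tau>_def a_def b_def inner_diff_right inner_add_right)
  then show thesis using that[of \<tau> a b] by (simp add: \<tau>_def inner_rot_right)
qed

lemma norm_decomposed:
  assumes "\<nu> \<bullet> \<tau> = 0" "\<nu> \<bullet> rot \<tau> = 0"
  shows "(norm (\<tau> + \<delta> *\<^sub>R (a *\<^sub>R \<nu> + b *\<^sub>R rot \<nu>)))\<^sup>2 = (norm \<tau>)\<^sup>2 + \<delta>\<^sup>2 * (a\<^sup>2 + b\<^sup>2)"
proof -
  define Y where "Y = a *\<^sub>R \<nu> + b *\<^sub>R rot \<nu>"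
  have "rot \<nu> \<bullet> \<tau> = 0" using assms(2) by (simp add: inner_rot_right)
  then have "Y \<bullet> \<tau> = 0" using assms(1) by (simp add: Y_def inner_add_left)
  moreover have "Y \<bullet> Y = a\<^sup>2 + b\<^sup>2"
    using nu by (simp add: Y_def inner_add_left inner_add_right power2_eq_square)
  ultimately show ?thesis
    unfolding power2_norm_eq_inner Y_def[symmetric]
    by (simp add: inner_add_left inner_add_right inner_commute[of \<tau> Y] power2_eq_square)
qed

text \<open>The error multiplies |\<tau>|^2 + a^2 + b^2, and a^2 + b^2 is at most twice the squared
  distance \<open>P\<close> to the vertex plus a multiple of |\<tau>|^2. The part with |\<tau>|^2 is
  absorbed by the gap between \<open>N\<close> and \<open>M\<close>, the part with \<open>P\<close>
  by (1 - \<eta>) P; hence two smallness conditions.\<close>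

lemma Q_lower_bound:
  assumes \<eta>: "0 < \<eta>" "\<eta> < 1" and \<delta>1: "\<delta> \<le> 1"
    and small: "err M * (1 + 4 * ((L + K) / (1 - \<eta>))\<^sup>2) \<le> 2 * (N - M)" "2 * err M \<le> 1 - \<eta>"
    and T: "\<And>\<tau>. \<nu> \<bullet> \<tau> = 0 \<Longrightarrow> \<nu> \<bullet> rot \<tau> = 0 \<Longrightarrow> 2 * N * (norm \<tau>)\<^sup>2 + \<eta> / (1 - \<eta>) * R \<tau> \<le> T \<tau>"
  shows "2 * M * (norm X)\<^sup>2 \<le> Q \<eta> X"
proof -
  obtain \<tau> a b where X: "X = \<tau> + \<delta> *\<^sub>R (a *\<^sub>R \<nu> + b *\<^sub>R rot \<nu>)" and \<tau>: "\<nu> \<bullet> \<tau> = 0" "\<nu> \<bullet> rot \<tau> = 0"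
    by (rule normal_decompose)
  define D where "D = ((L + K) / (1 - \<eta>))\<^sup>2"
  define t where "t = (norm \<tau>)\<^sup>2"
  define P where "P = (a - a_opt \<eta> \<tau>)\<^sup>2 + (b - b_opt \<eta> \<tau>)\<^sup>2"
  have P0: "P \<ge> 0" "t \<ge> 0" by (simp_all add: P_def t_def)
  have sq: "x\<^sup>2 \<le> 2 * (x - y)\<^sup>2 + 2 * y\<^sup>2" for x y :: real
    using zero_le_power2[of "x - 2 * y"] by (simp add: power2_eq_square algebra_simps)
  have ab: "a\<^sup>2 + b\<^sup>2 \<le> 2 * P + 4 * D * t"
  proof -
    have gen: "x + y \<le> 2 * (u + u') + 4 * d"
      if "x \<le> 2 * u + 2 * v" "y \<le> 2 * u' + 2 * v'" "v \<le> d" "v' \<le> d" for x y u u' v v' d :: real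
      using that by argo
    show ?thesis
      unfolding P_def mult.assoc
      by (rule gen[OF sq[of a "a_opt \<eta> \<tau>"] sq[of b "b_opt \<eta> \<tau>"] opt_bound[OF \<eta>, of \<tau>, folded D_def t_def]])
  qed
  have n: "2 * M * (norm X)\<^sup>2 \<le> 2 * M * t + 2 * \<bar>M\<bar> * \<delta>\<^sup>2 * (t + a\<^sup>2 + b\<^sup>2)"
  proof -
    have "M * (\<delta>\<^sup>2 * (a\<^sup>2 + b\<^sup>2)) \<le> \<bar>M\<bar> * (\<delta>\<^sup>2 * (t + a\<^sup>2 + b\<^sup>2))"
      using P0 by (intro mult_mono) auto
    then show ?thesis unfolding X norm_decomposed[OF \<tau>] t_def by (simp add: algebra_simps)
  qed
  have "Q \<eta> X \<ge> T \<tau> - \<eta> / (1 - \<eta>) * R \<tau> + (1 - \<eta>) * P - (err M - 2 * \<bar>M\<bar> * \<delta>\<^sup>2) * (t + a\<^sup>2 + b\<^sup>2)"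
    using Q_decompose[OF \<eta> \<tau> \<delta>1, of a b] unfolding X P_def t_def err_def by (simp add: abs_le_iff)
  then have "Q \<eta> X \<ge> 2 * N * t + (1 - \<eta>) * P + 2 * \<bar>M\<bar> * \<delta>\<^sup>2 * (t + a\<^sup>2 + b\<^sup>2) - err M * (t + a\<^sup>2 + b\<^sup>2)"
    using T[OF \<tau>] unfolding left_diff_distrib t_def by linarith
  moreover have "err M * (t + a\<^sup>2 + b\<^sup>2) \<le> err M * ((1 + 4 * D) * t + 2 * P)"
    using ab err_nonneg by (intro mult_left_mono) (auto simp: algebra_simps)
  moreover have "err M * ((1 + 4 * D) * t + 2 * P) = err M * (1 + 4 * D) * t + 2 * err M * P" by (simp add: algebra_simps)
  moreover have "err M * (1 + 4 * D) * t \<le> 2 * (N - M) * t" "2 * err M * P \<le> (1 - \<eta>) * P"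
    using small P0 unfolding D_def by (intro mult_right_mono; simp)+
  moreover have "2 * (N - M) * t = 2 * N * t - 2 * M * t" by (simp add: algebra_simps)
  ultimately show ?thesis using n by linarith
qed

text \<open>The bound on \<open>Q\<close> is tested on the vector whose normal part sits at the
  vertex; there the squares vanish and only the error in |\<tau>|^2 has to be absorbed.\<close>

lemma T_lower_bound:
  assumes \<eta>: "0 < \<eta>" "\<eta> < 1" and \<delta>1: "\<delta> \<le> 1"
    and small: "err M * (1 + 4 * ((L + K) / (1 - \<eta>))\<^sup>2) \<le> 2 * (M - N)"
    and Q: "\<And>X. 2 * M * (norm X)\<^sup>2 \<le> Q \<eta> X" and \<tau>: "\<nu> \<bullet> \<tau> = 0" "\<nu> \<bullet> rot \<tau> = 0"
  shows "2 * N * (norm \<tau>)\<^sup>2 + \<eta> / (1 - \<eta>) * R \<tau> \<le> T \<tau>"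
proof -
  define a where "a = a_opt \<eta> \<tau>"
  define b where "b = b_opt \<eta> \<tau>"
  define D where "D = ((L + K) / (1 - \<eta>))\<^sup>2"
  define t where "t = (norm \<tau>)\<^sup>2"
  let ?X = "\<tau> + \<delta> *\<^sub>R (a *\<^sub>R \<nu> + b *\<^sub>R rot \<nu>)"
  have t0: "t \<ge> 0" "D \<ge> 0" by (simp_all add: t_def D_def)
  have ab: "a\<^sup>2 + b\<^sup>2 \<le> 4 * D * t"
    using opt_bound[OF \<eta>, of \<tau>] mult_nonneg_nonneg[OF t0(2,1)]
    unfolding a_def b_def D_def[symmetric] t_def[symmetric] mult.assoc by linarith
  have n: "2 * M * (norm ?X)\<^sup>2 \<ge> 2 * M * t - 2 * \<bar>M\<bar> * \<delta>\<^sup>2 * (t + a\<^sup>2 + b\<^sup>2)"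
  proof -
    have "(- M) * (\<delta>\<^sup>2 * (a\<^sup>2 + b\<^sup>2)) \<le> \<bar>M\<bar> * (\<delta>\<^sup>2 * (t + a\<^sup>2 + b\<^sup>2))"
      using t0 by (intro mult_mono) auto
    then show ?thesis unfolding norm_decomposed[OF \<tau>] t_def by (simp add: algebra_simps)
  qed
  have "Q \<eta> ?X \<le> T \<tau> - \<eta> / (1 - \<eta>) * R \<tau> + (err M - 2 * \<bar>M\<bar> * \<delta>\<^sup>2) * (t + a\<^sup>2 + b\<^sup>2)"
    using Q_decompose[OF \<eta> \<tau> \<delta>1, of a b] unfolding t_def err_def a_def b_def by (simp add: abs_le_iff)
  then have "2 * M * t \<le> T \<tau> - \<eta> / (1 - \<eta>) * R \<tau> + err M * (t + a\<^sup>2 + b\<^sup>2)"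
    using n Q[of ?X] unfolding left_diff_distrib by linarith
  moreover have "err M * (t + a\<^sup>2 + b\<^sup>2) \<le> err M * ((1 + 4 * D) * t)"
    using ab err_nonneg by (intro mult_left_mono) (auto simp: algebra_simps)
  moreover have "err M * (1 + 4 * D) * t \<le> 2 * (M - N) * t"
    using small t0 unfolding D_def by (intro mult_right_mono)
  moreover have "2 * (M - N) * t = 2 * M * t - 2 * N * t" by (simp add: algebra_simps)
  ultimately show ?thesis unfolding t_def[symmetric] mult.assoc by linarith
qed

end

text \<open>\<open>H\<^sub>0\<close> is the derivative of the normal field at the nearest boundary point.\<close>

locale boundary_normal_form = normal_form \<nu> H B l \<delta> S L K
  for \<nu> :: "complex^'n" and H B l \<delta> S L K +
  fixes H0 :: "complex^'n \<Rightarrow> complex^'n"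
  assumes H0_linear: "linear H0" and H0_sym: "\<And>v w. H0 v \<bullet> w = v \<bullet> H0 w"
    and H_H0: "\<And>v. H v = H0 v + \<delta> *\<^sub>R H0 (H v)"
    and H0_bound: "\<And>v. norm (H0 v) \<le> K * norm v"
begin

text \<open>Four times the right hand side of the tangential condition; the last four terms are four
  times 2 \<beta> at the boundary point, by \<open>beta_eq\<close>.\<close>

definition T0 :: "complex^'n \<Rightarrow> real" where
  "T0 \<tau> = B \<tau> \<tau> + B (rot \<tau>) (rot \<tau>) + (\<tau> \<bullet> H0 \<tau> + rot \<tau> \<bullet> H0 (rot \<tau>)) / \<delta>
    + (norm (H0 \<tau>))\<^sup>2 + (norm (H0 (rot \<tau>)))\<^sup>2
    - (rot \<nu> \<bullet> H0 (rot \<tau>))\<^sup>2 - (rot \<nu> \<bullet> H0 \<tau>)\<^sup>2"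

definition R0 :: "complex^'n \<Rightarrow> real" where
  "R0 \<tau> = (l \<tau> - rot \<nu> \<bullet> H0 (rot \<tau>))\<^sup>2 + (l (rot \<tau>) + rot \<nu> \<bullet> H0 \<tau>)\<^sup>2"

lemma H0_H_bound: "norm (H0 (H v)) \<le> K * (K * norm v)"
  using H0_bound[of "H v"] mult_left_mono[OF H_bound[of v] bounds_nonneg(3)] by linarith

lemma rot_nu_bound: "norm w \<le> c \<Longrightarrow> \<bar>rot \<nu> \<bullet> w\<bar> \<le> c"
  using Cauchy_Schwarz_ineq2[of "rot \<nu>" w] norm_nu by simp

lemma rot_nu_H: "rot \<nu> \<bullet> H v = rot \<nu> \<bullet> H0 v + \<delta> * (rot \<nu> \<bullet> H0 (H v))"
  by (subst H_H0) (simp add: inner_add_right)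

lemma rot_nu_diff_bound: "\<bar>\<delta> * (rot \<nu> \<bullet> H0 (H v))\<bar> \<le> \<delta> * (K * K) * norm v"
  using mult_left_mono[OF rot_nu_bound[OF H0_H_bound[of v]], of \<delta>] \<delta> by (simp add: abs_mult mult.assoc)

lemma square_change_bound:
  assumes "\<bar>p\<bar> \<le> c * n" "\<bar>e\<bar> \<le> \<delta> * (K * K) * n" "\<delta> \<le> 1" "n \<ge> 0"
  shows "\<bar>(p + e)\<^sup>2 - p\<^sup>2\<bar> \<le> \<delta> * (K * K * (2 * c + K * K)) * n\<^sup>2"
proof -
  have "\<bar>(p + e)\<^sup>2 - p\<^sup>2\<bar> \<le> \<delta> * (K * K) * n * (2 * (c * n) + \<delta> * (K * K) * n)"
    by (rule abs_square_diff_bound[OF assms(1,2)])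
  also have "\<dots> \<le> \<delta> * (K * K) * n * (2 * (c * n) + 1 * (K * K) * n)"
    using assms(3,4) \<delta> bounds_nonneg by (intro mult_left_mono add_left_mono mult_right_mono) auto
  also have "\<dots> = \<delta> * (K * K * (2 * c + K * K)) * n\<^sup>2"
    by (simp add: power2_eq_square algebra_simps)
  finally show ?thesis .
qed

lemma T_T0:
  assumes "\<delta> \<le> 1"
  shows "\<bar>T \<tau> - T0 \<tau>\<bar> \<le> \<delta> * (2 * (K * (K * K)) + 2 * (K * K * (2 * K + K * K))) * (norm \<tau>)\<^sup>2"
proof -
  \<comment> \<open>\<open>H_H0\<close> is inserted twice. The first use yields the square of
    \<open>H0 v\<close> as the term of order 1 after division by \<delta>, the second exposes the
    remainder of order \<delta>.\<close>
  have q: "v \<bullet> H v / \<delta> = v \<bullet> H0 v / \<delta> + (norm (H0 v))\<^sup>2 + \<delta> * (H0 v \<bullet> H0 (H v))" for v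
  proof -
    have "v \<bullet> H v = v \<bullet> H0 v + \<delta> * (H0 v \<bullet> H v)" by (subst H_H0) (simp add: inner_add_right H0_sym)
    moreover have "H0 v \<bullet> H v = (norm (H0 v))\<^sup>2 + \<delta> * (H0 v \<bullet> H0 (H v))"
      by (subst H_H0) (simp add: inner_add_right power2_norm_eq_inner)
    ultimately show ?thesis using \<delta> by (simp add: field_simps)
  qed
  have qb: "\<bar>\<delta> * (H0 v \<bullet> H0 (H v))\<bar> \<le> \<delta> * (K * (K * K)) * (norm v)\<^sup>2" for v
  proof -
    have "\<bar>H0 v \<bullet> H0 (H v)\<bar> \<le> norm (H0 v) * norm (H0 (H v))" by (rule Cauchy_Schwarz_ineq2)
    also have "\<dots> \<le> (K * norm v) * (K * (K * norm v))"
      using bounds_nonneg by (intro mult_mono H0_bound H0_H_bound) auto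
    finally have "\<delta> * \<bar>H0 v \<bullet> H0 (H v)\<bar> \<le> \<delta> * ((K * norm v) * (K * (K * norm v)))"
      using \<delta> by (intro mult_left_mono) auto
    then show ?thesis using \<delta> by (simp add: abs_mult power2_eq_square mult_ac)
  qed
  have d: "\<bar>(rot \<nu> \<bullet> H v)\<^sup>2 - (rot \<nu> \<bullet> H0 v)\<^sup>2\<bar> \<le> \<delta> * (K * K * (2 * K + K * K)) * (norm v)\<^sup>2" for v
    unfolding rot_nu_H
    by (rule square_change_bound[OF rot_nu_bound[OF H0_bound] rot_nu_diff_bound assms]) simp
  have "T \<tau> - T0 \<tau> = \<delta> * (H0 \<tau> \<bullet> H0 (H \<tau>)) + \<delta> * (H0 (rot \<tau>) \<bullet> H0 (H (rot \<tau>)))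
      - ((rot \<nu> \<bullet> H (rot \<tau>))\<^sup>2 - (rot \<nu> \<bullet> H0 (rot \<tau>))\<^sup>2) - ((rot \<nu> \<bullet> H \<tau>)\<^sup>2 - (rot \<nu> \<bullet> H0 \<tau>)\<^sup>2)"
    unfolding T_def T0_def add_divide_distrib q by simp
  then show ?thesis
    using qb[of \<tau>] qb[of "rot \<tau>"] d[of \<tau>] d[of "rot \<tau>"] unfolding norm_rot distrib_left distrib_right by linarith
qed

lemma R_R0:
  assumes "\<delta> \<le> 1"
  shows "\<bar>R \<tau> - R0 \<tau>\<bar> \<le> \<delta> * (2 * (K * K * (2 * (L + K) + K * K))) * (norm \<tau>)\<^sup>2"
proof -
  have b: "\<bar>l v - rot \<nu> \<bullet> H0 w\<bar> \<le> (L + K) * norm v" "\<bar>l v + rot \<nu> \<bullet> H0 w\<bar> \<le> (L + K) * norm v" if "norm w = norm v" for v w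
    using l_bound[of v] rot_nu_bound[OF H0_bound[of w]] unfolding distrib_right that by linarith+
  have "\<bar>(l \<tau> - rot \<nu> \<bullet> H0 (rot \<tau>) + - (\<delta> * (rot \<nu> \<bullet> H0 (H (rot \<tau>)))))\<^sup>2 - (l \<tau> - rot \<nu> \<bullet> H0 (rot \<tau>))\<^sup>2\<bar>
      \<le> \<delta> * (K * K * (2 * (L + K) + K * K)) * (norm \<tau>)\<^sup>2"
    using rot_nu_diff_bound[of "rot \<tau>"] by (intro square_change_bound b assms) simp_all
  moreover have "\<bar>(l (rot \<tau>) + rot \<nu> \<bullet> H0 \<tau> + \<delta> * (rot \<nu> \<bullet> H0 (H \<tau>)))\<^sup>2 - (l (rot \<tau>) + rot \<nu> \<bullet> H0 \<tau>)\<^sup>2\<bar>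
      \<le> \<delta> * (K * K * (2 * (L + K) + K * K)) * (norm \<tau>)\<^sup>2"
    using rot_nu_diff_bound[of \<tau>] b(2)[of \<tau> "rot \<tau>"] by (intro square_change_bound assms) simp_all
  moreover have e: "l \<tau> - rot \<nu> \<bullet> H (rot \<tau>) = l \<tau> - rot \<nu> \<bullet> H0 (rot \<tau>) + - (\<delta> * (rot \<nu> \<bullet> H0 (H (rot \<tau>))))"
    "l (rot \<tau>) + rot \<nu> \<bullet> H \<tau> = l (rot \<tau>) + rot \<nu> \<bullet> H0 \<tau> + \<delta> * (rot \<nu> \<bullet> H0 (H \<tau>))"
    by (simp_all add: rot_nu_H)
  ultimately have "\<bar>R \<tau> - R0 \<tau>\<bar> \<le> 2 * (\<delta> * (K * K * (2 * (L + K) + K * K)) * (norm \<tau>)\<^sup>2)"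
    unfolding R_def R0_def e by linarith
  then show ?thesis by (simp only: mult_ac)
qed

definition err0 :: "real \<Rightarrow> real" where
  "err0 k = \<delta> * (2 * (K * (K * K)) + 2 * (K * K * (2 * K + K * K))) + k * (\<delta> * (2 * (K * K * (2 * (L + K) + K * K))))"

lemma T0_imp_T:
  assumes "\<delta> \<le> 1" "k \<ge> 0" "err0 k \<le> 2 * (N - N')"
    and "2 * N * (norm \<tau>)\<^sup>2 + k * R0 \<tau> \<le> T0 \<tau>"
  shows "2 * N' * (norm \<tau>)\<^sup>2 + k * R \<tau> \<le> T \<tau>"
proof -
  have "\<bar>k * R \<tau> - k * R0 \<tau>\<bar> \<le> k * (\<delta> * (2 * (K * K * (2 * (L + K) + K * K))) * (norm \<tau>)\<^sup>2)"
    using mult_left_mono[OF R_R0[OF assms(1), of \<tau>] assms(2)] assms(2)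
    by (simp add: abs_mult flip: right_diff_distrib)
  moreover have "err0 k * (norm \<tau>)\<^sup>2 \<le> 2 * (N - N') * (norm \<tau>)\<^sup>2" by (rule mult_right_mono[OF assms(3)]) simp
  ultimately show ?thesis
    using T_T0[OF assms(1), of \<tau>] assms(4) unfolding err0_def by (simp add: algebra_simps abs_le_iff)
qed

lemma T_imp_T0:
  assumes "\<delta> \<le> 1" "k \<ge> 0" "err0 k \<le> 2 * (N - N')"
    and "2 * N * (norm \<tau>)\<^sup>2 + k * R \<tau> \<le> T \<tau>"
  shows "2 * N' * (norm \<tau>)\<^sup>2 + k * R0 \<tau> \<le> T0 \<tau>"
proof -
  have "\<bar>k * R \<tau> - k * R0 \<tau>\<bar> \<le> k * (\<delta> * (2 * (K * K * (2 * (L + K) + K * K))) * (norm \<tau>)\<^sup>2)"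
    using mult_left_mono[OF R_R0[OF assms(1), of \<tau>] assms(2)] assms(2)
    by (simp add: abs_mult flip: right_diff_distrib)
  moreover have "err0 k * (norm \<tau>)\<^sup>2 \<le> 2 * (N - N') * (norm \<tau>)\<^sup>2" by (rule mult_right_mono[OF assms(3)]) simp
  ultimately show ?thesis
    using T_T0[OF assms(1), of \<tau>] assms(4) unfolding err0_def by (simp add: algebra_simps abs_le_iff)
qed

end

section \<open>The gain from adding a multiple of |z|^2\<close>

lemma weighted_square_le:
  fixes p x y k k' \<kappa> :: real
  assumes "0 < k" "k < k'" "\<kappa> = 1 / k - 1 / k'"
  shows "k * (p + x)\<^sup>2 \<le> k' * p\<^sup>2 + x\<^sup>2 / \<kappa>"
proof -
  have \<kappa>: "\<kappa> = (k' - k) / (k * k')" using assms by (simp add: diff_frac_eq)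
  have pos: "k' - k > 0" "k * k' > 0" using assms by auto
  \<comment> \<open>Multiplied by k' - k, the difference of the two sides is a perfect square, so
    the weight \<kappa> is the best possible.\<close>
  have "(k' - k) * (k' * p\<^sup>2 + x\<^sup>2 / \<kappa> - k * (p + x)\<^sup>2) = ((k' - k) * p - k * x)\<^sup>2"
    unfolding \<kappa> using pos by (simp add: field_simps) (simp add: power2_eq_square algebra_simps)
  then have "0 \<le> (k' - k) * (k' * p\<^sup>2 + x\<^sup>2 / \<kappa> - k * (p + x)\<^sup>2)" by simp
  then show ?thesis using pos(1) by (simp add: zero_le_mult_iff)
qed

text \<open>The vectors \<tau> and \<open>rot \<tau>\<close> are orthogonal and of equal length, so
  this is Bessel's inequality without a factor 2, which would spoil the constant in the gain. The
  vector \<open>y\<close> is |\<tau>|^2 times the component of \<open>z\<close> orthogonal to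
  both.\<close>

lemma bessel_rot: "(z \<bullet> \<tau>)\<^sup>2 + (z \<bullet> rot \<tau>)\<^sup>2 \<le> (norm z)\<^sup>2 * (norm \<tau>)\<^sup>2"
proof (cases "\<tau> = 0")
  case True
  then show ?thesis by simp
next
  case False
  define n where "n = \<tau> \<bullet> \<tau>"
  have n: "n > 0" using False by (simp add: n_def)
  have rn: "rot \<tau> \<bullet> rot \<tau> = n" by (simp add: n_def)
  define y where "y = n *\<^sub>R z - (z \<bullet> \<tau>) *\<^sub>R \<tau> - (z \<bullet> rot \<tau>) *\<^sub>R rot \<tau>"
  have "y \<bullet> \<tau> = 0" "y \<bullet> rot \<tau> = 0"
    unfolding y_def by (simp_all add: inner_diff_left n_def[symmetric])
  then have "y \<bullet> y = n * (y \<bullet> z)"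
    by (subst (2) y_def) (simp add: inner_diff_right)
  also have "y \<bullet> z = n * (z \<bullet> z) - (z \<bullet> \<tau>)\<^sup>2 - (z \<bullet> rot \<tau>)\<^sup>2"
    by (simp add: y_def inner_diff_left inner_commute[of \<tau> z] inner_commute[of "rot \<tau>" z] power2_eq_square)
  finally have "0 \<le> n * (n * (z \<bullet> z) - (z \<bullet> \<tau>)\<^sup>2 - (z \<bullet> rot \<tau>)\<^sup>2)" using inner_ge_zero[of y] by simp
  then have "0 \<le> n * (z \<bullet> z) - (z \<bullet> \<tau>)\<^sup>2 - (z \<bullet> rot \<tau>)\<^sup>2" using n by (simp add: zero_le_mult_iff)
  then show ?thesis by (simp add: n_def power2_norm_eq_inner mult.commute)
qed

text \<open>The choice of \<open>c\<close> maximizes \<open>2 c - 2 c\<^sup>2 r\<^sup>2 / \<kappa>\<close>.\<close>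

lemma quadratic_gain:
  fixes p q t N k k' \<kappa> r c W :: real and z \<tau> :: "complex^'n"
  assumes k: "0 < k" "k < k'" "\<kappa> = 1 / k - 1 / k'" and r: "0 < r" "norm z \<le> r" and c: "c = \<kappa> / (2 * r\<^sup>2)"
    and le: "2 * N * (norm \<tau>)\<^sup>2 + k' * (p\<^sup>2 + q\<^sup>2) \<le> W"
  shows "2 * (N + \<kappa> / (2 * r\<^sup>2)) * (norm \<tau>)\<^sup>2 + k * ((p + 2 * c * (z \<bullet> \<tau>))\<^sup>2 + (q + 2 * c * (z \<bullet> rot \<tau>))\<^sup>2)
    \<le> W + 4 * c * (norm \<tau>)\<^sup>2"
proof -
  have \<kappa>: "\<kappa> > 0" using k by (simp add: frac_less2)
  have "k * (p + 2 * c * (z \<bullet> \<tau>))\<^sup>2 \<le> k' * p\<^sup>2 + (2 * c * (z \<bullet> \<tau>))\<^sup>2 / \<kappa>"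
    "k * (q + 2 * c * (z \<bullet> rot \<tau>))\<^sup>2 \<le> k' * q\<^sup>2 + (2 * c * (z \<bullet> rot \<tau>))\<^sup>2 / \<kappa>"
    by (rule weighted_square_le[OF k])+
  then have "k * ((p + 2 * c * (z \<bullet> \<tau>))\<^sup>2 + (q + 2 * c * (z \<bullet> rot \<tau>))\<^sup>2)
    \<le> k' * (p\<^sup>2 + q\<^sup>2) + 4 * c\<^sup>2 / \<kappa> * ((z \<bullet> \<tau>)\<^sup>2 + (z \<bullet> rot \<tau>)\<^sup>2)"
    by (simp add: power_mult_distrib add_divide_distrib distrib_left)
  also have "4 * c\<^sup>2 / \<kappa> * ((z \<bullet> \<tau>)\<^sup>2 + (z \<bullet> rot \<tau>)\<^sup>2) \<le> 4 * c\<^sup>2 / \<kappa> * (r\<^sup>2 * (norm \<tau>)\<^sup>2)"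
  proof (rule mult_left_mono)
    have "(norm z)\<^sup>2 * (norm \<tau>)\<^sup>2 \<le> r\<^sup>2 * (norm \<tau>)\<^sup>2"
      using r by (intro mult_right_mono power_mono) auto
    with bessel_rot[of z \<tau>] show "(z \<bullet> \<tau>)\<^sup>2 + (z \<bullet> rot \<tau>)\<^sup>2 \<le> r\<^sup>2 * (norm \<tau>)\<^sup>2" by linarith
  qed (use \<kappa> in auto)
  also have "4 * c\<^sup>2 / \<kappa> * (r\<^sup>2 * (norm \<tau>)\<^sup>2) = \<kappa> / r\<^sup>2 * (norm \<tau>)\<^sup>2"
    unfolding c using \<kappa> r by (simp add: power2_eq_square field_simps)
  finally have "k * ((p + 2 * c * (z \<bullet> \<tau>))\<^sup>2 + (q + 2 * c * (z \<bullet> rot \<tau>))\<^sup>2)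
    \<le> k' * (p\<^sup>2 + q\<^sup>2) + \<kappa> / r\<^sup>2 * (norm \<tau>)\<^sup>2" by simp
  \<comment> \<open>The Hessian of c |z|^2 contributes 4c = 2 \<kappa>/r^2. Half of it has just been
    spent on the cross terms; the other half is the gain 2 (\<kappa>/(2 r^2)).\<close>
  moreover have "4 * c = 2 * (\<kappa> / r\<^sup>2)" unfolding c by simp
  moreover have "2 * (N + \<kappa> / (2 * r\<^sup>2)) * (norm \<tau>)\<^sup>2 = 2 * N * (norm \<tau>)\<^sup>2 + \<kappa> / r\<^sup>2 * (norm \<tau>)\<^sup>2"
    using r by (simp add: field_simps)
  ultimately show ?thesis using le by simp
qed

section \<open>The conditions in terms of the normal form\<close>

text \<open>The conclusions of \<open>tubular_neighborhood\<close> as assumptions: they pass to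
  smaller neighborhoods of the boundary, so later arguments can shrink \<open>U\<close>
  freely.\<close>

locale tube =
  fixes \<Omega> U :: "(complex^'n) set"
  assumes open_domain: "open \<Omega>"
    and nbhd: "boundary_nbhd \<Omega> U" and C2_sdist: "Ck_on 2 (sdist \<Omega>) U"
    and nearest_frontier: "\<And>z. z \<in> U \<Longrightarrow> nearest \<Omega> z \<in> frontier \<Omega>"
    and norm_grad: "\<And>z. z \<in> U \<Longrightarrow> norm (grad (sdist \<Omega>) z) = 1"
    and grad_nearest: "\<And>z. z \<in> U \<Longrightarrow> grad (sdist \<Omega>) (nearest \<Omega> z) = grad (sdist \<Omega>) z"
    and nearest_diff: "\<And>z. z \<in> U \<Longrightarrow> z - nearest \<Omega> z = sdist \<Omega> z *\<^sub>R grad (sdist \<Omega>) z"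
begin

abbreviation d :: "complex^'n \<Rightarrow> real" where "d \<equiv> sdist \<Omega>"
abbreviation \<nu> :: "complex^'n \<Rightarrow> complex^'n" where "\<nu> \<equiv> grad (sdist \<Omega>)"
abbreviation H :: "complex^'n \<Rightarrow> complex^'n \<Rightarrow> complex^'n" where
  "H z \<equiv> \<D> (grad (sdist \<Omega>)) z"

lemma open_U: "open U" and frontier_U: "frontier \<Omega> \<subseteq> U"
  using nbhd by (auto simp: boundary_nbhd_def)

lemma regular_point: "z \<in> U \<Longrightarrow> regular_point \<Omega> U z"
  by unfold_locales (auto simp: C2_sdist open_U norm_grad)

lemma sdist_deriv: "z \<in> U \<Longrightarrow> (d has_derivative (\<lambda>v. \<nu> z \<bullet> v)) (at z)"
  using regular_point.sdist_deriv[OF regular_point] by blast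

lemmas grad_deriv = regular_point.grad_deriv[OF regular_point]
  and H_linear = regular_point.H_linear[OF regular_point]
  and H_sym = regular_point.H_sym[OF regular_point]
  and H_nu = regular_point.H_nu[OF regular_point]
  and nu_nu = regular_point.nu_nu[OF regular_point]

lemma sdist_inside: "z \<in> U \<Longrightarrow> z \<in> \<Omega> \<Longrightarrow> d z < 0"
proof -
  assume z: "z \<in> U" "z \<in> \<Omega>"
  have "z \<notin> frontier \<Omega>" using frontier_open_disjoint[OF open_domain] z(2) by blast
  moreover have "closed (frontier \<Omega>)" "frontier \<Omega> \<noteq> {}" using nearest_frontier[OF z(1)] by auto
  ultimately have "bdist \<Omega> z \<noteq> 0" unfolding bdist_def using in_closed_iff_infdist_zero by blast
  then show "d z < 0" using z(2) infdist_nonneg[of z "frontier \<Omega>"] by (simp add: sdist_def bdist_def)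
qed

lemma bdist_inside: "z \<in> \<Omega> \<Longrightarrow> bdist \<Omega> z = - d z"
  by (simp add: sdist_def)

text \<open>Differentiate the identity \<nu>(z - d(z) \<nu>(z)) = \<nu>(z). The term from the
  derivative of \<open>d\<close> points along \<nu> and is killed by the Hessian at the nearest
  point.\<close>

lemma H_nearest:
  assumes z: "z \<in> U"
  shows "H z v = H (nearest \<Omega> z) v + (- d z) *\<^sub>R H (nearest \<Omega> z) (H z v)"
proof -
  let ?\<xi> = "\<lambda>w. w - d w *\<^sub>R \<nu> w"
  have \<xi>: "?\<xi> w = nearest \<Omega> w" if "w \<in> U" for w
    using nearest_diff[OF that] by (simp add: algebra_simps)
  have nU: "nearest \<Omega> z \<in> U" using nearest_frontier[OF z] frontier_U by auto
  have "(?\<xi> has_derivative (\<lambda>v. v - (d z *\<^sub>R H z v + (\<nu> z \<bullet> v) *\<^sub>R \<nu> z))) (at z)"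
    by (rule has_derivative_diff[OF has_derivative_ident has_derivative_scaleR[OF sdist_deriv[OF z] grad_deriv[OF z]]])
  then have "((\<lambda>w. \<nu> (?\<xi> w)) has_derivative
      (\<lambda>v. H (nearest \<Omega> z) (v - (d z *\<^sub>R H z v + (\<nu> z \<bullet> v) *\<^sub>R \<nu> z)))) (at z)"
    by (rule has_derivative_compose) (use grad_deriv[OF nU] \<xi>[OF z] in simp)
  then have "(\<nu> has_derivative (\<lambda>v. H (nearest \<Omega> z) (v - (d z *\<^sub>R H z v + (\<nu> z \<bullet> v) *\<^sub>R \<nu> z)))) (at z)"
  proof (rule has_derivative_transform_within_open[OF _ open_U z])
    show "\<nu> (?\<xi> w) = \<nu> w" if "w \<in> U" for w
      unfolding \<xi>[OF that] by (rule grad_nearest[OF that])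
  qed
  then have "H z = (\<lambda>v. H (nearest \<Omega> z) (v - (d z *\<^sub>R H z v + (\<nu> z \<bullet> v) *\<^sub>R \<nu> z)))"
    by (rule frechet_derivative_eqI)
  then have "H z v = H (nearest \<Omega> z) (v - (d z *\<^sub>R H z v + (\<nu> z \<bullet> v) *\<^sub>R \<nu> z))" by (rule fun_cong)
  also have "\<dots> = H (nearest \<Omega> z) v - d z *\<^sub>R H (nearest \<Omega> z) (H z v)"
    using H_nu[OF nU] unfolding grad_nearest[OF z]
    by (simp add: linear_diff[OF H_linear[OF nU]] linear_add[OF H_linear[OF nU]] linear_scale[OF H_linear[OF nU]])
  finally show ?thesis by simp
qed

end

section \<open>Pointwise size of first and second derivatives\<close>

definition C1_size :: "('a::euclidean_space \<Rightarrow> real) \<Rightarrow> 'a \<Rightarrow> real" where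
  "C1_size f x = (\<Sum>b\<in>Basis. \<bar>\<D> f x b\<bar>)"

definition C2_size :: "('a::euclidean_space \<Rightarrow> real) \<Rightarrow> 'a \<Rightarrow> real" where
  "C2_size f x = (\<Sum>b\<in>Basis. \<Sum>c\<in>Basis. \<bar>\<H> f x b c\<bar>)"

lemma linear_norm_le_sum:
  fixes f :: "'a::euclidean_space \<Rightarrow> 'b::real_normed_vector"
  assumes "linear f"
  shows "norm (f v) \<le> (\<Sum>b\<in>Basis. norm (f b)) * norm v"
proof -
  have "norm (f v) = norm (\<Sum>b\<in>Basis. (v \<bullet> b) *\<^sub>R f b)"
    by (subst euclidean_representation[of v, symmetric])
      (simp only: linear_sum[OF assms] linear_scale[OF assms])
  also have "\<dots> \<le> (\<Sum>b\<in>Basis. norm v * norm (f b))"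
    by (rule sum_norm_le) (simp add: mult_right_mono Basis_le_norm)
  finally show ?thesis by (simp add: sum_distrib_left mult.commute[of _ "norm v"])
qed

locale C2_at =
  fixes f :: "'a::euclidean_space \<Rightarrow> real" and S and x
  assumes C2: "Ck_on 2 f S" and openS: "open S" and xS: "x \<in> S"
begin

abbreviation D1 :: "'a \<Rightarrow> 'a \<Rightarrow> real" where "D1 y \<equiv> \<D> f y"
abbreviation D2 :: "'a \<Rightarrow> 'a \<Rightarrow> real" where "D2 v \<equiv> \<H> f x v"

lemma C2': "Ck_on (Suc (Suc 0)) f S"
  using C2 by (simp only: numeral_2_eq_2)

lemma D1_deriv: "y \<in> S \<Longrightarrow> (f has_derivative D1 y) (at y)"
  by (rule Ck_on_has_derivative[OF C2' openS])

lemma D1_linear: "y \<in> S \<Longrightarrow> linear (D1 y)"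
  using has_derivative_linear[OF D1_deriv] .

lemma D2_deriv: "((\<lambda>y. D1 y v) has_derivative D2 v) (at x)"
  by (rule Ck_on_has_derivative[of 0, OF _ openS xS]) (use C2' in simp)

lemma D2_linear: "linear (D2 v)"
  using has_derivative_linear[OF D2_deriv] .

lemma D2_sym: "D2 v w = D2 w v"
  by (rule second_derivative_symmetric[OF C2 openS xS])

lemma D2_add: "D2 (v + v') w = D2 v w + D2 v' w" "D2 v (w + w') = D2 v w + D2 v w'"
  and D2_scale: "D2 (c *\<^sub>R v) w = c * D2 v w" "D2 v (c *\<^sub>R w) = c * D2 v w"
proof -
  show *: "D2 v (w + w') = D2 v w + D2 v w'" for v w w'
    by (rule linear_add[OF D2_linear])
  show "D2 (v + v') w = D2 v w + D2 v' w"
    using *[of w v v'] by (simp only: D2_sym[of _ w])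
  show **: "D2 v (c *\<^sub>R w) = c * D2 v w" for v w
    using linear_scale[OF D2_linear, of v c w] by simp
  show "D2 (c *\<^sub>R v) w = c * D2 v w"
    using **[of w v] by (simp only: D2_sym[of _ w])
qed

lemma D1_bound: "\<bar>D1 x v\<bar> \<le> C1_size f x * norm v"
  using linear_norm_le_sum[OF D1_linear[OF xS], of v] by (simp add: C1_size_def)

lemma D2_bound: "\<bar>D2 v w\<bar> \<le> C2_size f x * (norm v * norm w)"
proof -
  have "\<bar>D2 v w\<bar> = norm (D2 w v)" by (simp add: D2_sym)
  also have "\<dots> \<le> (\<Sum>b\<in>Basis. norm (D2 w b)) * norm v" by (rule linear_norm_le_sum[OF D2_linear])
  also have "\<dots> \<le> (\<Sum>b\<in>Basis. (\<Sum>c\<in>Basis. norm (D2 b c)) * norm w) * norm v"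
  proof (intro mult_right_mono sum_mono norm_ge_zero)
    show "norm (D2 w b) \<le> (\<Sum>c\<in>Basis. norm (D2 b c)) * norm w" for b
      using linear_norm_le_sum[OF D2_linear, of b w] by (simp only: D2_sym[of w b])
  qed
  also have "\<dots> = C2_size f x * (norm v * norm w)"
    by (simp add: C2_size_def mult.assoc flip: sum_distrib_right)
  finally show ?thesis .
qed

end

lemma C2_size_nonneg: "C2_size f x \<ge> 0" and C1_size_nonneg: "C1_size f x \<ge> 0"
  by (simp_all add: C2_size_def C1_size_def sum_nonneg)

context tube
begin

text \<open>\<open>L\<close> and \<open>K\<close> will be uniform near the boundary, whereas the
  bound for the second derivatives is tied to the point: it may blow up, and only its product with
  the distance is controlled.\<close>

abbreviation normal_form_at :: "(complex^'n \<Rightarrow> real) \<Rightarrow> complex^'n \<Rightarrow> real \<Rightarrow> real \<Rightarrow> bool" where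
  "normal_form_at \<psi> z L K \<equiv> boundary_normal_form (\<nu> z) (H z) (\<H> \<psi> z) (\<D> \<psi> z)
    (- d z) (C2_size \<psi> z) L K (H (nearest \<Omega> z))"

lemma boundary_normal_form:
  assumes z: "z \<in> U" "z \<in> \<Omega>" and \<psi>: "Ck_on 2 \<psi> S" "open S" "z \<in> S"
    and L: "C1_size \<psi> z \<le> L"
    and K: "\<And>v. norm (H z v) \<le> K * norm v" "\<And>v. norm (H (nearest \<Omega> z) v) \<le> K * norm v"
  shows "normal_form_at \<psi> z L K"
proof -
  interpret C2_at \<psi> S z by unfold_locales (use \<psi> in auto)
  have nU: "nearest \<Omega> z \<in> U" using nearest_frontier[OF z(1)] frontier_U by auto
  show ?thesis
  proof (intro boundary_normal_form.intro normal_form.intro boundary_normal_form_axioms.intro)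
    show "\<bar>D1 z v\<bar> \<le> L * norm v" for v
      using D1_bound[of v] mult_right_mono[OF L norm_ge_zero[of v]] by linarith
    show "H z v = H (nearest \<Omega> z) v + (- d z) *\<^sub>R H (nearest \<Omega> z) (H z v)" for v
      by (rule H_nearest[OF z(1)])
  qed (use z nU \<psi> K sdist_inside[OF z] in \<open>simp_all add: nu_nu H_linear H_sym H_nu D2_add D2_scale D1_linear D2_bound\<close>)
qed

text \<open>All quantities are quarters of those of the normal form: the square is
  \<open>R0\<close>/4, the right hand side \<open>T0\<close>/4, and \<open>tan_norm_sq\<close> is
  |\<tau>|^2/2, which accounts for 2 N.\<close>

lemma tangential_iff:
  assumes z: "z \<in> U" "z \<in> \<Omega>" and \<psi>: "Ck_on 2 \<psi> S" "open S" "z \<in> S"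
    and bform: "boundary_normal_form (\<nu> z) (H z) (\<H> \<psi> z) (\<D> \<psi> z)
    (- d z) S0 L K (H (nearest \<Omega> z))"
  shows "N * tan_norm_sq z \<tau> + k *
            (cmod (del (\<lambda>w. complex_of_real (\<psi> w)) z (T10 \<tau>) - 2 * alpha \<Omega> (nearest \<Omega> z) (T10 \<tau>)))\<^sup>2
        \<le> levi \<psi> z \<tau> + inverse (- d z) * levi d (nearest \<Omega> z) \<tau> + 2 * Re (eval11 (beta \<Omega> (nearest \<Omega> z)) \<tau> \<tau>)
      \<longleftrightarrow> 2 * N * (norm \<tau>)\<^sup>2 + k * boundary_normal_form.R0 (\<nu> z) (\<D> \<psi> z) (H (nearest \<Omega> z)) \<tau>
        \<le> boundary_normal_form.T0 (\<nu> z) (\<H> \<psi> z)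
          (- d z) (H (nearest \<Omega> z)) \<tau>"
proof -
  interpret boundary_normal_form "\<nu> z" "H z" "\<H> \<psi> z"
    "\<D> \<psi> z" "- d z" S0 L K "H (nearest \<Omega> z)" by (rule bform)
  interpret C2_at \<psi> S z by unfold_locales (use \<psi> in auto)
  have nU: "nearest \<Omega> z \<in> U" using nearest_frontier[OF z(1)] frontier_U by auto
  interpret r: regular_point \<Omega> U "nearest \<Omega> z" by (rule regular_point[OF nU])
  have sq: "(cmod (del (\<lambda>w. complex_of_real (\<psi> w)) z (T10 \<tau>) - 2 * alpha \<Omega> (nearest \<Omega> z) (T10 \<tau>)))\<^sup>2
      = R0 \<tau> / 4"
    unfolding del_T10[OF has_derivative_of_real[OF D1_deriv[OF xS]]] r.alpha_T10_eq grad_nearest[OF z(1)] cmod_power2 R0_def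
    by (simp add: power2_eq_square field_simps)
  have T: "levi \<psi> z \<tau> + inverse (- d z) * levi d (nearest \<Omega> z) \<tau> + 2 * Re (eval11 (beta \<Omega> (nearest \<Omega> z)) \<tau> \<tau>)
      = T0 \<tau> / 4"
    unfolding levi_real[OF \<psi>] r.levi_sdist r.beta_eq r.alpha_cmod grad_nearest[OF z(1)] T0_def
    using sdist_inside[OF z] by (simp add: field_simps)
  show ?thesis
  proof -
    have "N * tan_norm_sq z \<tau> + k * (R0 \<tau> / 4) = (2 * N * (norm \<tau>)\<^sup>2 + k * R0 \<tau>) / 4"
      by (simp add: tan_norm_sq_norm add_divide_distrib)
    then show ?thesis unfolding sq T by (simp only: divide_le_cancel) simp
  qed
qed

lemma del_sdist_iff: "z \<in> U \<Longrightarrow> del (sdistc \<Omega>) z (T10 \<tau>) = 0 \<longleftrightarrow> \<nu> z \<bullet> \<tau> = 0 \<and> \<nu> z \<bullet> rot \<tau> = 0"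
  by (rule regular_point.del_sdist_eq_0[OF regular_point])

text \<open>For \<lambda> = -e^(-\<eta> u) every second derivative is \<eta> (-\<lambda>) times that
  of \<open>u\<close> minus \<eta> times the product of first derivatives, so a positive factor
  splits off. In the proof, \<open>u1\<close> and \<open>u2\<close> are the derivatives of u =
  \<psi> - ln (-d), and \<open>E\<close> is -\<lambda>.\<close>

lemma levi_lam:
  assumes z: "z \<in> U" "z \<in> \<Omega>" and \<psi>: "Ck_on 2 \<psi> S" "open S" "z \<in> S"
    and \<rho>: "\<And>w. w \<in> S \<Longrightarrow> \<rho> w = d w * exp (- \<psi> w)"
    and nf: "normal_form (\<nu> z) (H z) (\<H> \<psi> z) (\<D> \<psi> z) (- d z) S0 L K"
  shows "levi (lam \<eta> \<rho>) z X = (- lam \<eta> \<rho> z) * \<eta> / 4 *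
      normal_form.Q (\<nu> z) (H z) (\<H> \<psi> z)
        (\<D> \<psi> z) (- d z) \<eta> X"
    and "- lam \<eta> \<rho> z > 0"
proof -
  interpret normal_form "\<nu> z" "H z" "\<H> \<psi> z"
    "\<D> \<psi> z" "- d z" S0 L K by (rule nf)
  define V where "V = S \<inter> U \<inter> \<Omega>"
  have V: "open V" "z \<in> V" using z \<psi> open_U open_domain by (auto simp: V_def)
  have \<psi>V: "Ck_on 2 \<psi> V" by (rule Ck_on_subset[OF \<psi>(1)]) (auto simp: V_def)
  interpret C2_at \<psi> V z by unfold_locales (use V \<psi>V in auto)
  interpret r: regular_point \<Omega> U z by (rule regular_point[OF z(1)])
  have neg: "d w < 0" if "w \<in> V" for w using that sdist_inside by (auto simp: V_def)
  define E where "E w = exp (- \<eta> * (\<psi> w - ln (- d w)))" for w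
  have E: "E w = exp (- \<psi> w * \<eta>) * (- d w) powr \<eta>" if "w \<in> V" for w
    using neg[OF that] by (simp add: E_def powr_def algebra_simps flip: exp_add)
  have lamE: "- E w = lam \<eta> \<rho> w" if "w \<in> V" for w
  proof -
    have "- \<rho> w = exp (- \<psi> w) * (- d w)" using \<rho> that by (simp add: V_def)
    then have "(- \<rho> w) powr \<eta> = exp (- \<psi> w) powr \<eta> * (- d w) powr \<eta>" using neg[OF that] by (simp only: powr_mult)
    then show ?thesis unfolding lam_def E[OF that] by (simp add: exp_powr_real)
  qed
  define u1 where "u1 w v = D1 w v - (\<nu> w \<bullet> v) / d w" for w v
  have Ed: "(E has_derivative (\<lambda>v. E w * (- \<eta> * u1 w v))) (at w)" if w: "w \<in> V" for w
  proof -
    have wU: "w \<in> U" using w by (auto simp: V_def)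
    have "((\<lambda>w. - \<eta> * (\<psi> w - ln (- d w))) has_derivative (\<lambda>v. - \<eta> * u1 w v)) (at w)"
      using neg[OF w] D1_deriv[OF w] sdist_deriv[OF wU]
      by (auto intro!: derivative_eq_intros simp: u1_def divide_inverse)
    from has_derivative_exp[OF this] show ?thesis unfolding E_def[abs_def] by (simp add: mult_ac)
  qed
  have lamd: "(lam \<eta> \<rho> has_derivative (\<lambda>v. E w * (\<eta> * u1 w v))) (at w)" if w: "w \<in> V" for w
    by (rule has_derivative_transform_within_open[OF _ V(1) w lamE]) (use has_derivative_minus[OF Ed[OF w]] in simp)
  define u2 where "u2 v h = D2 v h - ((H z h \<bullet> v) / d z - (\<nu> z \<bullet> v) * (\<nu> z \<bullet> h) / (d z)\<^sup>2)" for v h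
  have u1d: "((\<lambda>w. u1 w v) has_derivative u2 v) (at z)" for v
  proof -
    have "((\<lambda>w. (\<nu> w \<bullet> v) / d w) has_derivative (\<lambda>h. (H z h \<bullet> v) / d z - (\<nu> z \<bullet> v) * (\<nu> z \<bullet> h) / (d z)\<^sup>2)) (at z)"
    proof -
      have "d z \<noteq> 0" using neg[OF V(2)] by simp
      from has_derivative_divide[OF has_derivative_inner_left[OF grad_deriv[OF z(1)], of v] sdist_deriv[OF z(1)] this]
      show ?thesis by (simp add: power2_eq_square divide_inverse mult_ac)
    qed
    from has_derivative_diff[OF D2_deriv this] show ?thesis unfolding u1_def[abs_def] u2_def[abs_def] by simp
  qed
  have second: "\<H> (lam \<eta> \<rho>) z v h
      = \<eta> * E z * (u2 v h - \<eta> * u1 z v * u1 z h)" for v h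
  proof -
    have "((\<lambda>w. E w * (\<eta> * u1 w v)) has_derivative (\<lambda>h. E z * (\<eta> * u2 v h) + (E z * (- \<eta> * u1 z h)) * (\<eta> * u1 z v))) (at z)"
      by (intro has_derivative_mult Ed V has_derivative_mult_right u1d)
    then have "((\<lambda>w. \<D> (lam \<eta> \<rho>) w v) has_derivative
       (\<lambda>h. E z * (\<eta> * u2 v h) + (E z * (- \<eta> * u1 z h)) * (\<eta> * u1 z v))) (at z)"
    proof (rule has_derivative_transform_within_open[OF _ V])
      show "E w * (\<eta> * u1 w v) = \<D> (lam \<eta> \<rho>) w v" if "w \<in> V" for w
        by (simp only: frechet_derivative_eqI[OF lamd[OF that]])
    qed
    from frechet_derivative_eqI[OF this] show ?thesis by (simp add: algebra_simps)
  qed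
  have C2E: "Ck_on 2 E V"
  proof -
    have dV: "Ck_on 2 d V" by (rule Ck_on_subset[OF C2_sdist]) (auto simp: V_def)
    have "Ck_on 2 (\<lambda>w. ln (- d w)) V"
      by (rule Ck_on_compose[OF Ck_on_ln_real Ck_on_uminus[OF dV V(1)] _ V(1)]) (use neg in auto)
    then have "Ck_on 2 (\<lambda>w. - \<eta> * (\<psi> w - ln (- d w))) V"
      by (intro Ck_on_mult[OF Ck_on_const] Ck_on_diff \<psi>V V(1))
    then show ?thesis unfolding E_def[abs_def] by (rule Ck_on_compose[OF Ck_on_exp_real]) (use V in auto)
  qed
  have C2lam: "Ck_on 2 (lam \<eta> \<rho>) V"
    by (rule Ck_on_transfer[OF V(1) Ck_on_uminus[OF C2E V(1)] lamE])
  have alg: "(\<eta> * e * (a - (h / c - x * x / c\<^sup>2) - \<eta> * (p - x / c) * (p - x / c))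
      + \<eta> * e * (b - (k / c - y * y / c\<^sup>2) - \<eta> * (q - y / c) * (q - y / c))) / 4
      = - (- e) * \<eta> / 4 * (a + b + (h + k) / - c + (x\<^sup>2 + y\<^sup>2) / (- c)\<^sup>2
        - \<eta> * ((p + x / - c)\<^sup>2 + (q + y / - c)\<^sup>2))" for e a b h k x y p q c :: real
  proof -
    define x' where "x' = x / c"
    define y' where "y' = y / c"
    define h' where "h' = h / c"
    define k' where "k' = k / c"
    have e: "x * x / c\<^sup>2 = x' * x'" "y * y / c\<^sup>2 = y' * y'" "x / - c = - x'" "y / - c = - y'"
      "(x\<^sup>2 + y\<^sup>2) / (- c)\<^sup>2 = x' * x' + y' * y'" "(h + k) / - c = - h' - k'"
      by (simp_all add: h'_def k'_def x'_def y'_def power2_eq_square add_divide_distrib)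
    show ?thesis
      unfolding e unfolding x'_def[symmetric] y'_def[symmetric] h'_def[symmetric] k'_def[symmetric]
      by (simp add: power2_eq_square field_simps)
  qed
  from levi_real[OF C2lam V, of X]
  show "levi (lam \<eta> \<rho>) z X = (- lam \<eta> \<rho> z) * \<eta> / 4 * Q \<eta> X"
    unfolding second lamE[OF V(2), symmetric] Q_def u1_def u2_def inner_commute[of "H z X" X]
      inner_commute[of "H z (rot X)" "rot X"] alg .
  show "- lam \<eta> \<rho> z > 0"
    unfolding lamE[OF V(2), symmetric] E_def by simp
qed

end

section \<open>Uniformity near the boundary\<close>

lemma boundary_nbhd_Int: "boundary_nbhd \<Omega> U \<Longrightarrow> boundary_nbhd \<Omega> V \<Longrightarrow> boundary_nbhd \<Omega> (U \<inter> V)"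
  by (auto simp: boundary_nbhd_def)

lemma boundary_nbhd_less:
  fixes f :: "'a::topological_space \<Rightarrow> real"
  assumes "boundary_nbhd \<Omega> U" "continuous_on U f" "\<And>z. z \<in> frontier \<Omega> \<Longrightarrow> f z < c"
  shows "boundary_nbhd \<Omega> {z\<in>U. f z < c}"
proof -
  have "{z\<in>U. f z < c} = U \<inter> f -` {..<c}" by auto
  then show ?thesis
    using assms continuous_open_preimage[OF assms(2), of "{..<c}"] by (auto simp: boundary_nbhd_def)
qed

text \<open>The boundary is compact, and a strict bound for a continuous function on it persists on
  an open neighborhood. All uniform constants below arise in this way.\<close>

lemma boundary_nbhd_bounded:
  fixes f :: "'a::heine_borel \<Rightarrow> real"
  assumes "boundary_nbhd \<Omega> U" "continuous_on U f" "bounded \<Omega>"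
  obtains C where "C \<ge> 0" "boundary_nbhd \<Omega> {z\<in>U. f z < C}"
proof -
  have "compact (frontier \<Omega>)" using assms(3) by (simp add: compact_frontier_bounded)
  moreover have "continuous_on (frontier \<Omega>) f"
    using assms(1,2) by (auto simp: boundary_nbhd_def intro: continuous_on_subset)
  ultimately have "bounded (f ` frontier \<Omega>)" by (intro compact_imp_bounded compact_continuous_image)
  then obtain B where B: "\<And>z. z \<in> frontier \<Omega> \<Longrightarrow> \<bar>f z\<bar> \<le> B"
    by (auto simp: bounded_iff)
  have "boundary_nbhd \<Omega> {z\<in>U. f z < \<bar>B\<bar> + 1}"
    by (rule boundary_nbhd_less[OF assms(1,2)]) (use B in fastforce)
  then show thesis using that[of "\<bar>B\<bar> + 1"] by simp
qed

text \<open>By compactness of the boundary. The growth condition is phrased through the distance,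
  while the estimates produce arbitrary neighborhoods.\<close>

lemma boundary_nbhd_bdist:
  fixes \<Omega> :: "(complex^'n) set"
  assumes "boundary_nbhd \<Omega> V" "bounded \<Omega>" "frontier \<Omega> \<noteq> {}"
  obtains t where "t > 0" "\<And>z. bdist \<Omega> z < t \<Longrightarrow> z \<in> V"
proof -
  have "compact (frontier \<Omega>)" using assms(2) by (simp add: compact_frontier_bounded)
  then obtain t where t: "t > 0" "(\<Union>p\<in>frontier \<Omega>. ball p t) \<subseteq> V"
    using compact_subset_open_imp_ball_epsilon_subset[of "frontier \<Omega>" V] assms(1)
    by (auto simp: boundary_nbhd_def)
  show thesis
  proof (rule that[OF t(1)])
    fix z assume z: "bdist \<Omega> z < t"
    obtain p where "p \<in> frontier \<Omega>" "infdist z (frontier \<Omega>) = dist z p"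
      using infdist_attains_inf[OF frontier_closed assms(3)] by blast
    moreover from this have "z \<in> ball p t" using z by (simp add: bdist_def dist_commute)
    ultimately show "z \<in> V" using t(2) by blast
  qed
qed

lemma exists_small:
  fixes C \<theta> :: real
  assumes "C \<ge> 0" "\<theta> > 0"
  obtains e where "0 < e" "e \<le> 1" "e * C \<le> \<theta>"
proof (rule that[of "min 1 (\<theta> / (C + 1))"])
  have "min 1 (\<theta> / (C + 1)) * C \<le> \<theta> / (C + 1) * (C + 1)"
    using assms by (intro mult_mono) auto
  then show "min 1 (\<theta> / (C + 1)) * C \<le> \<theta>" using assms by simp
qed (use assms in auto)

context normal_form
begin

lemma err_le:
  assumes "\<delta> \<le> e" "\<delta> * S \<le> e" "e \<le> 1"
  shows "err M \<le> e * (6 + K + 8 * L * (1 + L) + 2 * \<bar>M\<bar>)"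
proof -
  have "\<delta>\<^sup>2 \<le> 1 * e" unfolding power2_eq_square using assms \<delta> by (intro mult_mono) auto
  then have "2 * \<bar>M\<bar> * \<delta>\<^sup>2 \<le> 2 * \<bar>M\<bar> * e" by (intro mult_left_mono) auto
  moreover have "\<delta> * K \<le> e * K" "\<delta> * (8 * L * (1 + L)) \<le> e * (8 * L * (1 + L))"
    using assms bounds_nonneg by (intro mult_right_mono; simp)+
  ultimately show ?thesis
    using assms(2) unfolding err_def distrib_left by (simp add: algebra_simps)
qed

end

context boundary_normal_form
begin

lemma err0_le:
  assumes "\<delta> \<le> e" "k \<ge> 0"
  shows "err0 k \<le> e * (2 * (K * (K * K)) + 2 * (K * K * (2 * K + K * K)) + k * (2 * (K * K * (2 * (L + K) + K * K))))"
proof -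
  have "err0 k = \<delta> * (2 * (K * (K * K)) + 2 * (K * K * (2 * K + K * K)) + k * (2 * (K * K * (2 * (L + K) + K * K))))"
    unfolding err0_def by (simp add: algebra_simps)
  then show ?thesis using assms bounds_nonneg by (simp add: mult_right_mono)
qed

end

context tube
begin

definition Q_form :: "(complex^'n \<Rightarrow> real) \<Rightarrow> complex^'n \<Rightarrow> real \<Rightarrow> complex^'n \<Rightarrow> real" where
  "Q_form \<psi> z = normal_form.Q (\<nu> z) (H z) (\<H> \<psi> z)
        (\<D> \<psi> z) (- d z)"

definition T_form :: "(complex^'n \<Rightarrow> real) \<Rightarrow> complex^'n \<Rightarrow> complex^'n \<Rightarrow> real" where
  "T_form \<psi> z = boundary_normal_form.T0 (\<nu> z) (\<H> \<psi> z) (- d z) (H (nearest \<Omega> z))"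

definition R_form :: "(complex^'n \<Rightarrow> real) \<Rightarrow> complex^'n \<Rightarrow> complex^'n \<Rightarrow> real" where
  "R_form \<psi> z = boundary_normal_form.R0 (\<nu> z) (\<D> \<psi> z) (H (nearest \<Omega> z))"

text \<open>Uniform convergence to 0 of distance times Hessian, which is the smallness of \<delta> S
  that the error bounds ask for.\<close>

definition small_hessian :: "(complex^'n \<Rightarrow> real) \<Rightarrow> bool" where
  "small_hessian \<psi> \<longleftrightarrow> (\<forall>e>0. \<exists>V. boundary_nbhd \<Omega> V \<and> (\<forall>z\<in>V \<inter> U \<inter> \<Omega>. - d z * C2_size \<psi> z \<le> e))"

lemma nbhd_sdist_less: "e > 0 \<Longrightarrow> boundary_nbhd \<Omega> {z\<in>U. - d z < e}"
  by (rule boundary_nbhd_less[OF nbhd])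
    (auto intro!: continuous_intros Ck_on_imp_continuous_on[OF C2_sdist] simp: sdist_frontier[OF open_domain])

text \<open>\<open>K\<close> and \<open>L\<close> come from continuity on the compact boundary and
  are fixed before \<open>e\<close>; this order matters, because \<open>e\<close> will be chosen in
  terms of them.\<close>

lemma uniform_normal_form:
  assumes bd: "bounded \<Omega>" and \<psi>: "Ck_on 1 \<psi> U" "Ck_on 2 \<psi> (U \<inter> \<Omega>)" and small: "small_hessian \<psi>"
  obtains K L where "K \<ge> 0" "L \<ge> 0" "\<And>e. e > 0 \<Longrightarrow> \<exists>V. boundary_nbhd \<Omega> V \<and> V \<subseteq> U \<and>
    (\<forall>z\<in>V \<inter> \<Omega>. normal_form_at \<psi> z L K \<and> - d z \<le> e \<and> - d z * C2_size \<psi> z \<le> e)"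
proof -
  have "continuous_on U (\<lambda>z. \<Sum>b\<in>Basis. norm (H z b))"
  proof (intro continuous_on_sum continuous_on_norm)
    show "continuous_on U (\<lambda>z. H z b)" for b
      using Ck_on_grad[of 1 d U] C2_sdist open_U by (auto simp: numeral_2_eq_2)
  qed
  from boundary_nbhd_bounded[OF nbhd this bd] obtain K where
    K: "K \<ge> 0" "boundary_nbhd \<Omega> {z\<in>U. (\<Sum>b\<in>Basis. norm (H z b)) < K}" by blast
  have "continuous_on U (C1_size \<psi>)"
    unfolding C1_size_def[abs_def]
    by (intro continuous_on_sum continuous_on_rabs) (use \<psi>(1) in auto)
  from boundary_nbhd_bounded[OF nbhd this bd] obtain L where
    L: "L \<ge> 0" "boundary_nbhd \<Omega> {z\<in>U. C1_size \<psi> z < L}" by blast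
  have HK: "norm (H z v) \<le> K * norm v" if "z \<in> {z\<in>U. (\<Sum>b\<in>Basis. norm (H z b)) < K}" for z v
  proof -
    have "norm (H z v) \<le> (\<Sum>b\<in>Basis. norm (H z b)) * norm v"
      using that H_linear by (intro linear_norm_le_sum) auto
    also have "\<dots> \<le> K * norm v" using that by (intro mult_right_mono) auto
    finally show ?thesis .
  qed
  show thesis
  proof (rule that[OF K(1) L(1)])
    fix e :: real assume e: "e > 0"
    obtain V1 where V1: "boundary_nbhd \<Omega> V1" "\<And>z. z \<in> V1 \<inter> U \<inter> \<Omega> \<Longrightarrow> - d z * C2_size \<psi> z \<le> e"
      using small e unfolding small_hessian_def by blast
    define V where "V = ({z\<in>U. (\<Sum>b\<in>Basis. norm (H z b)) < K} \<inter> {z\<in>U. C1_size \<psi> z < L}) \<inter> (V1 \<inter> {z\<in>U. - d z < e})"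
    have "boundary_nbhd \<Omega> V"
      unfolding V_def by (intro boundary_nbhd_Int K L V1 nbhd_sdist_less e)
    moreover have "normal_form_at \<psi> z L K \<and> - d z \<le> e \<and> - d z * C2_size \<psi> z \<le> e" if z: "z \<in> V \<inter> \<Omega>" for z
    proof (intro conjI)
      have zU: "z \<in> U" "z \<in> \<Omega>" using z by (auto simp: V_def)
      have "nearest \<Omega> z \<in> {z\<in>U. (\<Sum>b\<in>Basis. norm (H z b)) < K}"
        using nearest_frontier[OF zU(1)] K(2) by (auto simp: boundary_nbhd_def)
      with z show "normal_form_at \<psi> z L K"
        by (intro boundary_normal_form[OF zU \<psi>(2)] HK open_Int open_U open_domain) (auto simp: V_def)
    qed (use z V1(2) in \<open>auto simp: V_def\<close>)
    moreover have "V \<subseteq> U" by (auto simp: V_def)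
    ultimately show "\<exists>V. boundary_nbhd \<Omega> V \<and> V \<subseteq> U \<and>
    (\<forall>z\<in>V \<inter> \<Omega>. normal_form_at \<psi> z L K \<and> - d z \<le> e \<and> - d z * C2_size \<psi> z \<le> e)" by blast
  qed
qed

lemma uniform_bounds:
  assumes bd: "bounded \<Omega>" and \<psi>: "Ck_on 1 \<psi> U" "Ck_on 2 \<psi> (U \<inter> \<Omega>)" and small: "small_hessian \<psi>"
    and \<eta>: "0 < \<eta>" "\<eta> < 1" and \<theta>: "0 < \<theta>"
  obtains V K L where "boundary_nbhd \<Omega> V" "V \<subseteq> U"
    "\<And>z. z \<in> V \<inter> \<Omega> \<Longrightarrow> normal_form_at \<psi> z L K"
    "\<And>z. z \<in> V \<inter> \<Omega> \<Longrightarrow> - d z \<le> 1"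
    "\<And>z. z \<in> V \<inter> \<Omega> \<Longrightarrow> normal_form.err (- d z) (C2_size \<psi> z) L K M * (1 + 4 * ((L + K) / (1 - \<eta>))\<^sup>2) \<le> \<theta>"
    "\<And>z. z \<in> V \<inter> \<Omega> \<Longrightarrow> 2 * normal_form.err (- d z) (C2_size \<psi> z) L K M \<le> 1 - \<eta>"
    "\<And>z. z \<in> V \<inter> \<Omega> \<Longrightarrow> boundary_normal_form.err0 (- d z) L K (\<eta> / (1 - \<eta>)) \<le> \<theta>"
proof -
  obtain K L where KL: "K \<ge> 0" "L \<ge> 0" and ex: "\<And>e. e > 0 \<Longrightarrow> \<exists>V. boundary_nbhd \<Omega> V \<and> V \<subseteq> U \<and>
    (\<forall>z\<in>V \<inter> \<Omega>. normal_form_at \<psi> z L K \<and> - d z \<le> e \<and> - d z * C2_size \<psi> z \<le> e)"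
    using uniform_normal_form[OF bd \<psi> small] by blast
  define k where "k = \<eta> / (1 - \<eta>)"
  have k: "k \<ge> 0" using \<eta> by (simp add: k_def)
  define C1 where "C1 = 6 + K + 8 * L * (1 + L) + 2 * \<bar>M\<bar>"
  define D where "D = 1 + 4 * ((L + K) / (1 - \<eta>))\<^sup>2"
  define C2 where "C2 = 2 * (K * (K * K)) + 2 * (K * K * (2 * K + K * K)) + k * (2 * (K * K * (2 * (L + K) + K * K)))"
  have C0: "C1 \<ge> 0" "D \<ge> 1" "C2 \<ge> 0" using KL k by (auto simp: C1_def C2_def D_def)
  \<comment> \<open>A single constant dominating the coefficients of all three error conditions, so
    that one choice of \<open>e\<close> serves for each of them.\<close>
  define C where "C = C1 * D + 2 * C1 + C2"
  have Cge: "C \<ge> 0" "C1 * D \<le> C" "2 * C1 \<le> C" "C2 \<le> C" using C0 by (auto simp: C_def)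
  have "min \<theta> (1 - \<eta>) > 0" using \<eta> \<theta> by simp
  from exists_small[OF Cge(1) this] obtain e where e: "0 < e" "e \<le> 1" "e * C \<le> min \<theta> (1 - \<eta>)" by blast
  obtain V where V: "boundary_nbhd \<Omega> V" "V \<subseteq> U" and
    Vz: "\<And>z. z \<in> V \<inter> \<Omega> \<Longrightarrow> normal_form_at \<psi> z L K \<and> - d z \<le> e \<and> - d z * C2_size \<psi> z \<le> e"
    using ex[OF e(1)] by blast
  have le: "e * x \<le> min \<theta> (1 - \<eta>)" if "x \<le> C" for x
    using mult_left_mono[OF that, of e] e by linarith
  show thesis
  proof (rule that[OF V])
    fix z assume z: "z \<in> V \<inter> \<Omega>"
    interpret b: boundary_normal_form "\<nu> z" "H z" "\<H> \<psi> z"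
      "\<D> \<psi> z" "- d z" "C2_size \<psi> z" L K "H (nearest \<Omega> z)" using Vz[OF z] by blast
    show "normal_form_at \<psi> z L K" by (rule b.boundary_normal_form_axioms)
    show "- d z \<le> 1" using Vz[OF z] e by auto
    have err: "b.err M \<le> e * C1" unfolding C1_def by (rule b.err_le) (use Vz[OF z] e in auto)
    have "b.err M * D \<le> e * (C1 * D)" using mult_right_mono[OF err, of D] C0 by (simp add: mult.assoc)
    then show "b.err M * (1 + 4 * ((L + K) / (1 - \<eta>))\<^sup>2) \<le> \<theta>"
      using le[OF Cge(2)] unfolding D_def[symmetric] by linarith
    show "2 * b.err M \<le> 1 - \<eta>" using le[OF Cge(3)] err by linarith
    have "b.err0 k \<le> e * C2" unfolding C2_def by (rule b.err0_le) (use Vz[OF z] k in auto)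
    then show "b.err0 (\<eta> / (1 - \<eta>)) \<le> \<theta>" using le[OF Cge(4)] unfolding k_def[symmetric] by linarith
  qed
qed

lemma T_form_imp_Q_form:
  assumes bd: "bounded \<Omega>" and \<psi>: "Ck_on 1 \<psi> U" "Ck_on 2 \<psi> (U \<inter> \<Omega>)" and small: "small_hessian \<psi>"
    and \<eta>: "0 < \<eta>" "\<eta> < 1" and MN: "M < N"
    and T: "\<And>z \<tau>. z \<in> U \<inter> \<Omega> \<Longrightarrow> \<nu> z \<bullet> \<tau> = 0 \<Longrightarrow> \<nu> z \<bullet> rot \<tau> = 0 \<Longrightarrow>
      2 * N * (norm \<tau>)\<^sup>2 + \<eta> / (1 - \<eta>) * R_form \<psi> z \<tau> \<le> T_form \<psi> z \<tau>"
  obtains V where "boundary_nbhd \<Omega> V" "V \<subseteq> U" "\<And>z X. z \<in> V \<inter> \<Omega> \<Longrightarrow> 2 * M * (norm X)\<^sup>2 \<le> Q_form \<psi> z \<eta> X"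
proof -
  have pos: "N - M > 0" using MN by simp
  obtain V K L where V: "boundary_nbhd \<Omega> V" "V \<subseteq> U"
    and Vz: "\<And>z. z \<in> V \<inter> \<Omega> \<Longrightarrow> normal_form_at \<psi> z L K"
    "\<And>z. z \<in> V \<inter> \<Omega> \<Longrightarrow> - d z \<le> 1"
    "\<And>z. z \<in> V \<inter> \<Omega> \<Longrightarrow> normal_form.err (- d z) (C2_size \<psi> z) L K M * (1 + 4 * ((L + K) / (1 - \<eta>))\<^sup>2) \<le> N - M"
    "\<And>z. z \<in> V \<inter> \<Omega> \<Longrightarrow> 2 * normal_form.err (- d z) (C2_size \<psi> z) L K M \<le> 1 - \<eta>"
    "\<And>z. z \<in> V \<inter> \<Omega> \<Longrightarrow> boundary_normal_form.err0 (- d z) L K (\<eta> / (1 - \<eta>)) \<le> N - M"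
    by (rule uniform_bounds[OF bd \<psi> small \<eta> pos, where M = M]) (rule that; assumption)
  show thesis
  proof (rule that[OF V])
    fix z X assume z: "z \<in> V \<inter> \<Omega>"
    interpret b: boundary_normal_form "\<nu> z" "H z" "\<H> \<psi> z"
      "\<D> \<psi> z" "- d z" "C2_size \<psi> z" L K "H (nearest \<Omega> z)" by (rule Vz(1)[OF z])
    show "2 * M * (norm X)\<^sup>2 \<le> Q_form \<psi> z \<eta> X"
      unfolding Q_form_def
    \<comment> \<open>The gap between \<open>N\<close> and \<open>M\<close> is halved: one half pays
      for moving the Hessian from the nearest point to \<open>z\<close>, the other for the normal
      directions.\<close>
    proof (rule b.Q_lower_bound[OF \<eta> Vz(2)[OF z], where N = "(M + N) / 2"])
      show "b.err M * (1 + 4 * ((L + K) / (1 - \<eta>))\<^sup>2) \<le> 2 * ((M + N) / 2 - M)" using Vz(3)[OF z] by argo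
      show "2 * b.err M \<le> 1 - \<eta>" by (rule Vz(4)[OF z])
      fix \<tau> assume \<tau>: "\<nu> z \<bullet> \<tau> = 0" "\<nu> z \<bullet> rot \<tau> = 0"
      show "2 * ((M + N) / 2) * (norm \<tau>)\<^sup>2 + \<eta> / (1 - \<eta>) * b.R \<tau> \<le> b.T \<tau>"
      proof (rule b.T0_imp_T[OF Vz(2)[OF z], where N = N])
        show "b.err0 (\<eta> / (1 - \<eta>)) \<le> 2 * (N - (M + N) / 2)" using Vz(5)[OF z] by argo
        show "2 * N * (norm \<tau>)\<^sup>2 + \<eta> / (1 - \<eta>) * b.R0 \<tau> \<le> b.T0 \<tau>"
          using T[OF _ \<tau>] z V(2) unfolding R_form_def T_form_def by blast
      qed (use \<eta> in simp)
    qed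
  qed
qed

lemma Q_form_imp_T_form:
  assumes bd: "bounded \<Omega>" and \<psi>: "Ck_on 1 \<psi> U" "Ck_on 2 \<psi> (U \<inter> \<Omega>)" and small: "small_hessian \<psi>"
    and \<eta>: "0 < \<eta>" "\<eta> < 1" and MN: "N < M"
    and Q: "\<And>z X. z \<in> U \<inter> \<Omega> \<Longrightarrow> 2 * M * (norm X)\<^sup>2 \<le> Q_form \<psi> z \<eta> X"
  obtains V where "boundary_nbhd \<Omega> V" "V \<subseteq> U"
    "\<And>z \<tau>. z \<in> V \<inter> \<Omega> \<Longrightarrow> \<nu> z \<bullet> \<tau> = 0 \<Longrightarrow> \<nu> z \<bullet> rot \<tau> = 0 \<Longrightarrow>
      2 * N * (norm \<tau>)\<^sup>2 + \<eta> / (1 - \<eta>) * R_form \<psi> z \<tau> \<le> T_form \<psi> z \<tau>"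
proof -
  have pos: "M - N > 0" using MN by simp
  obtain V K L where V: "boundary_nbhd \<Omega> V" "V \<subseteq> U"
    and Vz: "\<And>z. z \<in> V \<inter> \<Omega> \<Longrightarrow> normal_form_at \<psi> z L K"
    "\<And>z. z \<in> V \<inter> \<Omega> \<Longrightarrow> - d z \<le> 1"
    "\<And>z. z \<in> V \<inter> \<Omega> \<Longrightarrow> normal_form.err (- d z) (C2_size \<psi> z) L K M * (1 + 4 * ((L + K) / (1 - \<eta>))\<^sup>2) \<le> M - N"
    "\<And>z. z \<in> V \<inter> \<Omega> \<Longrightarrow> boundary_normal_form.err0 (- d z) L K (\<eta> / (1 - \<eta>)) \<le> M - N"
    by (rule uniform_bounds[OF bd \<psi> small \<eta> pos, where M = M]) (rule that; assumption)
  show thesis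
  proof (rule that[OF V])
    fix z \<tau> assume z: "z \<in> V \<inter> \<Omega>" and \<tau>: "\<nu> z \<bullet> \<tau> = 0" "\<nu> z \<bullet> rot \<tau> = 0"
    interpret b: boundary_normal_form "\<nu> z" "H z" "\<H> \<psi> z"
      "\<D> \<psi> z" "- d z" "C2_size \<psi> z" L K "H (nearest \<Omega> z)" by (rule Vz(1)[OF z])
    show "2 * N * (norm \<tau>)\<^sup>2 + \<eta> / (1 - \<eta>) * R_form \<psi> z \<tau> \<le> T_form \<psi> z \<tau>"
      unfolding R_form_def T_form_def
    proof (rule b.T_imp_T0[OF Vz(2)[OF z], where N = "(M + N) / 2"])
      show "b.err0 (\<eta> / (1 - \<eta>)) \<le> 2 * ((M + N) / 2 - N)" using Vz(4)[OF z] by argo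
      show "2 * ((M + N) / 2) * (norm \<tau>)\<^sup>2 + \<eta> / (1 - \<eta>) * b.R \<tau> \<le> b.T \<tau>"
      proof (rule b.T_lower_bound[OF \<eta> Vz(2)[OF z] _ _ \<tau>, where M = M])
        show "b.err M * (1 + 4 * ((L + K) / (1 - \<eta>))\<^sup>2) \<le> 2 * (M - (M + N) / 2)" using Vz(3)[OF z] by argo
        show "2 * M * (norm X)\<^sup>2 \<le> b.Q \<eta> X" for X
          using Q[of z X] z V(2) unfolding Q_form_def by blast
      qed
    qed (use \<eta> in simp)
  qed
qed

end

section \<open>The growth condition as a pointwise estimate\<close>

lemma C2_size_le_C2_norm:
  assumes "z \<in> A"
  shows "ennreal (C2_size f z) \<le> C2_norm f A"
proof -
  have "ennreal (C2_size f z) = (\<Sum>b\<in>Basis. \<Sum>c\<in>Basis.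
      ennreal \<bar>\<H> f z b c\<bar>)"
    by (simp add: C2_size_def sum_nonneg flip: sum_ennreal)
  also have "\<dots> \<le> (\<Sum>b\<in>Basis. \<Sum>c\<in>Basis.
      SUP x\<in>A. ennreal (norm (\<H> f x b c)))"
    by (intro sum_mono SUP_upper2[OF assms]) simp
  also have "\<dots> \<le> C2_norm f A"
    unfolding C2_norm_def by (intro add_increasing) auto
  finally show ?thesis .
qed

lemma (in tube) small_C2_growth_imp:
  assumes "small_C2_growth \<Omega> U' \<phi>" "U \<subseteq> U'"
  shows "small_hessian \<phi>"
  unfolding small_hessian_def
proof (intro allI impI)
  fix e :: real assume e: "e > 0"
  have "((\<lambda>\<epsilon>. ennreal \<epsilon> * C2_norm \<phi> {z \<in> \<Omega> \<inter> U'. bdist \<Omega> z > \<epsilon>}) \<longlongrightarrow> 0) (at_right 0)"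
    using assms(1) by (simp add: small_C2_growth_def)
  then have "eventually (\<lambda>\<epsilon>. ennreal \<epsilon> * C2_norm \<phi> {z \<in> \<Omega> \<inter> U'. bdist \<Omega> z > \<epsilon>} < ennreal (e / 2)) (at_right 0)"
    by (rule order_tendstoD(2)) (use e in simp)
  then obtain t where t: "t > 0" "\<And>\<epsilon>. 0 < \<epsilon> \<Longrightarrow> \<epsilon> < t \<Longrightarrow>
      ennreal \<epsilon> * C2_norm \<phi> {z \<in> \<Omega> \<inter> U'. bdist \<Omega> z > \<epsilon>} < ennreal (e / 2)"
    by (auto simp: eventually_at_right_field)
  have "- d z * C2_size \<phi> z \<le> e" if z: "z \<in> U" "z \<in> \<Omega>" "- d z < t" for z
  proof -
    \<comment> \<open>Half the distance, so that \<open>z\<close> itself belongs to the set over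
      which the norm is taken; the lost factor 2 is why e/2 was used.\<close>
    define \<epsilon> where "\<epsilon> = - d z / 2"
    have \<epsilon>: "0 < \<epsilon>" "\<epsilon> < t" using sdist_inside[OF z(1,2)] z(3) by (auto simp: \<epsilon>_def)
    have "z \<in> {z \<in> \<Omega> \<inter> U'. bdist \<Omega> z > \<epsilon>}"
      using z assms(2) bdist_inside[OF z(2)] sdist_inside[OF z(1,2)] by (auto simp: \<epsilon>_def)
    then have "ennreal \<epsilon> * ennreal (C2_size \<phi> z) \<le> ennreal \<epsilon> * C2_norm \<phi> {z \<in> \<Omega> \<inter> U'. bdist \<Omega> z > \<epsilon>}"
      by (intro mult_left_mono C2_size_le_C2_norm) auto
    also have "\<dots> < ennreal (e / 2)" by (rule t(2)[OF \<epsilon>])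
    finally have "ennreal (\<epsilon> * C2_size \<phi> z) < ennreal (e / 2)"
      using \<epsilon> C2_size_nonneg[of \<phi> z] by (simp add: ennreal_mult)
    then have "\<epsilon> * C2_size \<phi> z < e / 2"
      using \<epsilon> C2_size_nonneg[of \<phi> z] by (simp add: ennreal_less_iff)
    then show ?thesis by (simp add: \<epsilon>_def)
  qed
  then show "\<exists>V. boundary_nbhd \<Omega> V \<and> (\<forall>z\<in>V \<inter> U \<inter> \<Omega>. - d z * C2_size \<phi> z \<le> e)"
    using nbhd_sdist_less[OF t(1)] by (intro exI[of _ "{z\<in>U. - d z < t}"]) auto
qed

lemma C2_norm_le:
  fixes f :: "'a::euclidean_space \<Rightarrow> real" and B C :: real
  assumes "\<And>x. x \<in> A \<Longrightarrow> \<bar>f x\<bar> \<le> C" "\<And>x. x \<in> A \<Longrightarrow> C1_size f x \<le> C" "\<And>x. x \<in> A \<Longrightarrow> C2_size f x \<le> B"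
    "0 \<le> B" "0 \<le> C"
  shows "C2_norm f A \<le> ennreal (C + DIM('a) * C + DIM('a) * (DIM('a) * B))"
proof -
  have b1: "\<bar>\<D> f x b\<bar> \<le> C" if "x \<in> A" "b \<in> Basis" for x b
  proof -
    have "\<bar>\<D> f x b\<bar> \<le> C1_size f x"
      unfolding C1_size_def by (rule member_le_sum[of b Basis "\<lambda>b. \<bar>\<D> f x b\<bar>"]) (use that in auto)
    then show ?thesis using assms(2)[OF that(1)] by simp
  qed
  have b2: "\<bar>\<H> f x b c\<bar> \<le> B"
    if "x \<in> A" "b \<in> Basis" "c \<in> Basis" for x b c
  proof -
    let ?g = "\<lambda>b c. \<bar>\<H> f x b c\<bar>"
    have "?g b c \<le> (\<Sum>c\<in>Basis. ?g b c)" by (rule member_le_sum[of c Basis "?g b"]) (use that in auto)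
    also have "\<dots> \<le> C2_size f x"
      unfolding C2_size_def by (rule member_le_sum[of b Basis "\<lambda>b. \<Sum>c\<in>Basis. ?g b c"]) (use that in \<open>auto intro: sum_nonneg\<close>)
    finally show ?thesis using assms(3)[OF that(1)] by simp
  qed
  have "C2_norm f A \<le> ennreal C + (\<Sum>b\<in>(Basis::'a set). ennreal C) + (\<Sum>b\<in>(Basis::'a set). \<Sum>c\<in>(Basis::'a set). ennreal B)"
    unfolding C2_norm_def
    by (intro add_mono sum_mono SUP_least ennreal_leI) (use assms(1) b1 b2 in auto)
  also have "\<dots> = ennreal (C + DIM('a) * C + DIM('a) * (DIM('a) * B))"
    using assms(4,5) by (simp add: ennreal_mult ennreal_plus ennreal_of_nat_eq_real_of_nat)
  finally show ?thesis .
qed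

text \<open>The points at distance above \<epsilon> fall into two groups. Closer than
  \<open>t\<close> to the boundary, the Hessian is at most a small constant over \<epsilon>; farther
  away, it is bounded independently of \<epsilon>. Multiplication by \<epsilon> makes the first
  small and the second vanish in the limit.\<close>

lemma small_C2_growthI:
  fixes \<phi> :: "complex^'n \<Rightarrow> real"
  assumes C: "0 \<le> C" and C1: "\<And>z. z \<in> \<Omega> \<inter> U \<Longrightarrow> \<bar>\<phi> z\<bar> \<le> C" "\<And>z. z \<in> \<Omega> \<inter> U \<Longrightarrow> C1_size \<phi> z \<le> C"
    and C2: "\<And>z. z \<in> \<Omega> \<inter> U \<Longrightarrow> bdist \<Omega> z * C2_size \<phi> z \<le> C"
    and small: "\<And>e. e > 0 \<Longrightarrow> \<exists>t>0. \<forall>z\<in>\<Omega> \<inter> U. bdist \<Omega> z < t \<longrightarrow> bdist \<Omega> z * C2_size \<phi> z \<le> e"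
  shows "small_C2_growth \<Omega> U \<phi>"
proof -
  define n where "n = real DIM(complex^'n)"
  have n: "n > 0" by (simp add: n_def)
  have ev: "eventually (\<lambda>\<epsilon>. ennreal \<epsilon> * C2_norm \<phi> {z \<in> \<Omega> \<inter> U. bdist \<Omega> z > \<epsilon>} < ennreal e) (at_right 0)"
    if e: "e > 0" for e
  proof -
    obtain t where t: "t > 0" "\<And>z. z \<in> \<Omega> \<inter> U \<Longrightarrow> bdist \<Omega> z < t \<Longrightarrow> bdist \<Omega> z * C2_size \<phi> z \<le> e / (2 * (n * n))"
      using small[of "e / (2 * (n * n))"] e n by auto
    have "((\<lambda>\<epsilon>. \<epsilon> * (C + n * C) + n * (n * (e / (2 * (n * n)) + \<epsilon> * (C / t)))) \<longlongrightarrow>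
        0 * (C + n * C) + n * (n * (e / (2 * (n * n)) + 0 * (C / t)))) (at_right 0)"
      by (intro tendsto_intros)
    moreover have "0 * (C + n * C) + n * (n * (e / (2 * (n * n)) + 0 * (C / t))) < e" using n e by simp
    ultimately have "eventually (\<lambda>\<epsilon>. \<epsilon> * (C + n * C) + n * (n * (e / (2 * (n * n)) + \<epsilon> * (C / t))) < e) (at_right 0)"
      by (rule order_tendstoD(2))
    moreover have "eventually (\<lambda>\<epsilon>. \<epsilon> > 0) (at_right (0::real))" by (simp add: eventually_at_right_less)
    ultimately show ?thesis
    proof eventually_elim
      case (elim \<epsilon>)
      \<comment> \<open>The sum of the two bounds. The norm adds up n^2 second derivatives, each at
        most \<open>B\<close>, so the first part contributes e/2 after multiplication by
        \<epsilon>.\<close>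
      define B where "B = e / (2 * (n * n)) / \<epsilon> + C / t"
      have B: "0 \<le> B" using e n elim t C by (simp add: B_def)
      have size: "C2_size \<phi> z \<le> B" if z: "z \<in> {z \<in> \<Omega> \<inter> U. bdist \<Omega> z > \<epsilon>}" for z
      proof (cases "bdist \<Omega> z < t")
        case True
        have "\<epsilon> * C2_size \<phi> z \<le> bdist \<Omega> z * C2_size \<phi> z"
          using z C2_size_nonneg[of \<phi> z] by (intro mult_right_mono) auto
        then have "\<epsilon> * C2_size \<phi> z \<le> e / (2 * (n * n))" using t(2)[of z] z True by auto
        then have "C2_size \<phi> z \<le> e / (2 * (n * n)) / \<epsilon>" using elim(2)
          by (subst pos_le_divide_eq) (simp_all add: mult.commute)
        moreover have "C / t \<ge> 0" using C t by simp
        ultimately show ?thesis by (simp add: B_def)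
      next
        case False
        then have "t * C2_size \<phi> z \<le> bdist \<Omega> z * C2_size \<phi> z"
          using C2_size_nonneg[of \<phi> z] by (intro mult_right_mono) auto
        then have "t * C2_size \<phi> z \<le> C" using C2[of z] z by auto
        then have "C2_size \<phi> z \<le> C / t" using t by (simp add: le_divide_eq mult.commute)
        moreover have "e / (2 * (n * n)) / \<epsilon> \<ge> 0" using e n elim by simp
        ultimately show ?thesis by (simp add: B_def)
      qed
      have "C2_norm \<phi> {z \<in> \<Omega> \<inter> U. bdist \<Omega> z > \<epsilon>} \<le> ennreal (C + n * C + n * (n * B))"
        unfolding n_def
      proof (rule C2_norm_le)
        fix z assume z: "z \<in> {z \<in> \<Omega> \<inter> U. bdist \<Omega> z > \<epsilon>}"
        then have "z \<in> \<Omega> \<inter> U" by simp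
        then show "\<bar>\<phi> z\<bar> \<le> C" "C1_size \<phi> z \<le> C" by (rule C1)+
        show "C2_size \<phi> z \<le> B" by (rule size[OF z])
      qed (rule B C)+
      then have "ennreal \<epsilon> * C2_norm \<phi> {z \<in> \<Omega> \<inter> U. bdist \<Omega> z > \<epsilon>} \<le> ennreal \<epsilon> * ennreal (C + n * C + n * (n * B))"
        by (rule mult_left_mono) simp
      also have "\<dots> = ennreal (\<epsilon> * (C + n * C + n * (n * B)))"
        using elim B C n by (simp add: ennreal_mult)
      also have "\<epsilon> * (C + n * C + n * (n * B)) = \<epsilon> * (C + n * C) + n * (n * (e / (2 * (n * n)) + \<epsilon> * (C / t)))"
        using elim by (simp add: B_def algebra_simps)
      also have "ennreal \<dots> < ennreal e" using elim e by (intro ennreal_lessI)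
      finally show ?case .
    qed
  qed
  show ?thesis
    unfolding small_C2_growth_def
  proof (rule order_tendstoI)
    fix a :: ennreal assume a: "0 < a"
    show "eventually (\<lambda>\<epsilon>. ennreal \<epsilon> * C2_norm \<phi> {z \<in> \<Omega> \<inter> U. bdist \<Omega> z > \<epsilon>} < a) (at_right 0)"
    proof (cases a)
      case (real r)
      then show ?thesis using ev[of r] a by simp
    next
      case top
      have "eventually (\<lambda>\<epsilon>. ennreal \<epsilon> * C2_norm \<phi> {z \<in> \<Omega> \<inter> U. bdist \<Omega> z > \<epsilon>} < ennreal 1) (at_right 0)"
        by (rule ev) simp
      then show ?thesis by eventually_elim (use top in \<open>metis ennreal_less_top less_trans\<close>)
    qed
  qed simp
qed

section \<open>Extension across the boundary\<close>

text \<open>Here \<open>q\<close> is only continuous: f (q - q(p)) is a bounded multiple of |y - p|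
  times something tending to 0, so it has derivative 0.\<close>

lemma has_derivative_mult_vanish:
  fixes f q :: "'a::real_normed_vector \<Rightarrow> real"
  assumes f: "(f has_derivative f') (at p)" and "f p = 0" and q: "isCont q p"
  shows "((\<lambda>x. f x * q x) has_derivative (\<lambda>v. f' v * q p)) (at p)"
proof -
  obtain K where K: "\<And>v. norm (f' v) \<le> norm v * K"
    using bounded_linear.bounded[OF has_derivative_bounded_linear[OF f]] by blast
  have q0: "((\<lambda>y. q y - q p) \<longlongrightarrow> 0) (at p)" using q by (simp add: isCont_def LIM_zero)
  have f0: "((\<lambda>y. (f y - f' (y - p)) / norm (y - p)) \<longlongrightarrow> 0) (at p)"
  proof (rule tendsto_rabs_zero_cancel)
    show "((\<lambda>y. \<bar>(f y - f' (y - p)) / norm (y - p)\<bar>) \<longlongrightarrow> 0) (at p)"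
      using f assms(2) by (simp add: has_derivative_iff_norm)
  qed
  have "((\<lambda>y. f' (y - p) / norm (y - p) * (q y - q p)) \<longlongrightarrow> 0) (at p)"
  proof (rule Lim_null_comparison)
    show "((\<lambda>y. K * \<bar>q y - q p\<bar>) \<longlongrightarrow> 0) (at p)"
      using tendsto_mult_right_zero[OF tendsto_rabs_zero[OF q0]] .
    have "\<bar>f' v\<bar> / norm v \<le> K" if "v \<noteq> 0" for v
      using K[of v] that by (simp add: divide_le_eq mult.commute)
    then show "eventually (\<lambda>y. norm (f' (y - p) / norm (y - p) * (q y - q p)) \<le> K * \<bar>q y - q p\<bar>) (at p)"
      unfolding eventually_at
    proof (intro exI[of _ 1] conjI ballI impI)
      fix y assume "y \<noteq> p \<and> dist y p < 1"
      then have "\<bar>f' (y - p)\<bar> / norm (y - p) * \<bar>q y - q p\<bar> \<le> K * \<bar>q y - q p\<bar>"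
        using \<open>\<And>v. v \<noteq> 0 \<Longrightarrow> \<bar>f' v\<bar> / norm v \<le> K\<close>[of "y - p"] by (intro mult_right_mono) auto
      then show "norm (f' (y - p) / norm (y - p) * (q y - q p)) \<le> K * \<bar>q y - q p\<bar>" by (simp add: abs_mult)
    qed simp
  qed
  from tendsto_add[OF tendsto_mult_zero[OF f0 q0] this]
  have "((\<lambda>y. f y * (q y - q p) / norm (y - p)) \<longlongrightarrow> 0) (at p)"
    by (simp add: diff_divide_distrib algebra_simps)
  then have "((\<lambda>y. \<bar>f y * (q y - q p) / norm (y - p)\<bar>) \<longlongrightarrow> 0) (at p)" by (rule tendsto_rabs_zero)
  then have "((\<lambda>x. f x * (q x - q p)) has_derivative (\<lambda>v. 0)) (at p)"
    using assms(2) by (simp add: has_derivative_iff_norm)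
  from has_derivative_add[OF has_derivative_mult_left[OF f, of "q p"] this]
  show ?thesis by (simp add: algebra_simps)
qed

text \<open>The only second order term that involves second derivatives of \<open>g\<close> is
  \<open>f\<close> times them, which extends continuously by 0 to the zeros of \<open>f\<close>. At
  such zeros the derivative of \<open>f\<close> times a first derivative of \<open>g\<close> exists
  by \<open>has_derivative_mult_vanish\<close>.\<close>

lemma Ck_on_2_mult_vanishing:
  fixes f g :: "'a::euclidean_space \<Rightarrow> real"
  assumes U: "open U" and f: "Ck_on 2 f U" and g: "Ck_on 1 g U" "Ck_on 2 g {x\<in>U. f x \<noteq> 0}"
    and small: "\<And>v w. continuous_on U (\<lambda>x. if f x = 0 then 0
      else f x * \<H> g x v w)"
  shows "Ck_on 2 (\<lambda>x. f x * g x) U"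
  unfolding numeral_2_eq_2
proof (rule Ck_on_SucI[OF U])
  have f2: "Ck_on (Suc (Suc 0)) f U" using f by (simp only: numeral_2_eq_2)
  have g1: "Ck_on (Suc 0) g U" using g(1) by simp
  have "{x\<in>U. f x \<noteq> 0} = U \<inter> f -` (- {0})" by auto
  then have oV: "open {x\<in>U. f x \<noteq> 0}"
    using continuous_open_preimage[OF Ck_on_imp_continuous_on[OF f] U, of "- {0}"] by auto
  have g2: "Ck_on (Suc (Suc 0)) g {x\<in>U. f x \<noteq> 0}" using g(2) by (simp only: numeral_2_eq_2)
  show "((\<lambda>x. f x * g x) has_derivative (\<lambda>v. f x * \<D> g x v + \<D> f x v * g x)) (at x)"
    if "x \<in> U" for x
    by (rule has_derivative_mult[OF Ck_on_has_derivative[OF f2 U that] Ck_on_has_derivative[OF g1 U that]])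
  fix v
  have "Ck_on (Suc 0) (\<lambda>x. f x * \<D> g x v) U"
  proof (rule Ck_on_SucI[OF U])
    fix x assume x: "x \<in> U"
    note fd = Ck_on_has_derivative[OF f2 U x]
    have "continuous_on U (\<lambda>y. \<D> g y v)" using g1 by simp
    then have cont: "isCont (\<lambda>y. \<D> g y v) x" using U x by (simp add: continuous_on_eq_continuous_at)
    show "((\<lambda>x. f x * \<D> g x v) has_derivative
      (\<lambda>w. \<D> f x w * \<D> g x v + (if f x = 0 then 0
      else f x * \<H> g x v w))) (at x)"
    proof (cases "f x = 0")
      case True
      then show ?thesis using has_derivative_mult_vanish[OF fd True cont] by simp
    next
      case False
      have "((\<lambda>y. \<D> g y v) has_derivative
          \<H> g x v) (at x)"
        by (rule Ck_on_has_derivative[of 0, OF _ oV]) (use g2 x False in auto)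
      from has_derivative_mult[OF fd this] False show ?thesis by (simp add: add.commute)
    qed
  next
    fix w
    have "continuous_on U (\<lambda>x. \<D> f x w * \<D> g x v)"
    proof (rule continuous_on_mult)
      show "continuous_on U (\<lambda>x. \<D> f x w)"
        using f2 by (auto intro: differentiable_imp_continuous_on)
      show "continuous_on U (\<lambda>x. \<D> g x v)" using g1 by simp
    qed
    from continuous_on_add[OF this small[of v w]]
    show "Ck_on 0 (\<lambda>x. \<D> f x w * \<D> g x v + (if f x = 0 then 0
      else f x * \<H> g x v w)) U" by simp
  qed
  moreover have "Ck_on (Suc 0) (\<lambda>x. \<D> f x v * g x) U"
    using f2 g1 by (intro Ck_on_mult U) auto
  ultimately show "Ck_on (Suc 0) (\<lambda>x. f x * \<D> g x v + \<D> f x v * g x) U"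
    by (rule Ck_on_add[OF _ _ U])
qed

lemma isCont_cut_off:
  fixes F :: "'a::metric_space \<Rightarrow> 'b::real_normed_vector"
  assumes "open \<Omega>" "isCont F x" "x \<in> frontier \<Omega> \<Longrightarrow> F x = 0"
  shows "isCont (\<lambda>x. if x \<in> closure \<Omega> then 0 else F x) x"
proof -
  consider "x \<in> \<Omega>" | "x \<notin> closure \<Omega>" | "x \<in> frontier \<Omega>"
    using assms(1) by (auto simp: frontier_def interior_open)
  then show ?thesis
  proof cases
    case 1
    have "eventually (\<lambda>y. (if y \<in> closure \<Omega> then 0 else F y) = 0) (nhds x)"
      using eventually_nhds_in_open[OF assms(1) 1] by eventually_elim (use closure_subset in auto)
    from isCont_cong[OF this] show ?thesis by simp
  next
    case 2
    have "eventually (\<lambda>y. (if y \<in> closure \<Omega> then 0 else F y) = F y) (nhds x)"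
      by (rule eventually_mono[OF eventually_nhds_in_open[of "- closure \<Omega>" x]]) (use 2 in auto)
    from isCont_cong[OF this] show ?thesis using assms(2) by simp
  next
    case 3
    then have "(F \<longlongrightarrow> 0) (at x)" using assms(2,3) by (simp add: isCont_def)
    then have "((\<lambda>y. norm (F y)) \<longlongrightarrow> 0) (at x)" by (rule tendsto_norm_zero)
    then have "((\<lambda>y. if y \<in> closure \<Omega> then 0 else F y) \<longlongrightarrow> 0) (at x)"
      by (rule Lim_null_comparison[rotated]) simp
    then show ?thesis using 3 by (simp add: isCont_def frontier_def)
  qed
qed

text \<open>At a boundary point the cut off function is dominated by \<open>G\<close>, whose value
  and derivative vanish there, so its difference quotient tends to 0 as well.\<close>

lemma Ck_on_1_cut_off:
  fixes G :: "'a::euclidean_space \<Rightarrow> real"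
  assumes \<Omega>: "open \<Omega>" and U: "open U" and G: "Ck_on 1 G U"
    and zero: "\<And>p. p \<in> frontier \<Omega> \<Longrightarrow> p \<in> U \<Longrightarrow> G p = 0"
      "\<And>p v. p \<in> frontier \<Omega> \<Longrightarrow> p \<in> U \<Longrightarrow> \<D> G p v = 0"
  shows "Ck_on 1 (\<lambda>x. if x \<in> closure \<Omega> then 0 else G x) U"
proof -
  have G1: "Ck_on (Suc 0) G U" using G by simp
  have "Ck_on (Suc 0) (\<lambda>x. if x \<in> closure \<Omega> then 0 else G x) U"
  proof (rule Ck_on_SucI[OF U])
    fix x assume x: "x \<in> U"
    note Gd = Ck_on_has_derivative[OF G1 U x]
    consider "x \<in> \<Omega>" | "x \<notin> closure \<Omega>" | "x \<in> frontier \<Omega>"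
      using \<Omega> by (auto simp: frontier_def interior_open)
    then show "((\<lambda>x. if x \<in> closure \<Omega> then 0 else G x) has_derivative
        (\<lambda>v. if x \<in> closure \<Omega> then 0 else \<D> G x v)) (at x)"
    proof cases
      case 1
      then have c: "x \<in> closure \<Omega>" using closure_subset by blast
      have "((\<lambda>x. if x \<in> closure \<Omega> then 0 else G x) has_derivative (\<lambda>v. 0)) (at x)"
        by (rule has_derivative_transform_within_open[OF has_derivative_const \<Omega> 1, of 0])
          (use closure_subset in auto)
      then show ?thesis using c by simp
    next
      case 2
      have "((\<lambda>x. if x \<in> closure \<Omega> then 0 else G x) has_derivative \<D> G x) (at x)"
        by (rule has_derivative_transform_within_open[OF Gd, of "- closure \<Omega>"]) (use 2 in auto)
      then show ?thesis using 2 by simp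
    next
      case 3
      have c: "x \<in> closure \<Omega>" using 3 by (simp add: frontier_def)
      have z: "G x = 0" "\<D> G x = (\<lambda>v. 0)" using zero[OF 3 x] by auto
      have "((\<lambda>y. norm (G y / norm (y - x))) \<longlongrightarrow> 0) (at x)"
        using Gd z by (intro tendsto_norm_zero) (simp add: has_derivative_def netlimit_at divide_inverse mult.commute)
      then have "((\<lambda>y. (if y \<in> closure \<Omega> then 0 else G y) / norm (y - x)) \<longlongrightarrow> 0) (at x)"
        by (rule Lim_null_comparison[rotated]) simp
      then have "((\<lambda>x. if x \<in> closure \<Omega> then 0 else G x) has_derivative (\<lambda>v. 0)) (at x)"
        using c by (simp add: has_derivative_def netlimit_at divide_inverse mult.commute)
      then show ?thesis using c by simp
    qed
  next
    fix v
    have "isCont (\<lambda>x. if x \<in> closure \<Omega> then 0 else \<D> G x v) x" if x: "x \<in> U" for x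
    proof (rule isCont_cut_off[OF \<Omega>])
      have "continuous_on U (\<lambda>x. \<D> G x v)" using G1 by simp
      then show "isCont (\<lambda>x. \<D> G x v) x" using U x by (simp add: continuous_on_eq_continuous_at)
    qed (use zero x in auto)
    then show "Ck_on 0 (\<lambda>x. if x \<in> closure \<Omega> then 0 else \<D> G x v) U"
      by (simp add: continuous_at_imp_continuous_on)
  qed
  then show ?thesis by simp
qed

section \<open>Reflection of a function across the boundary\<close>

context tube
begin

lemma sdist_outside: "z \<in> U \<Longrightarrow> z \<notin> closure \<Omega> \<Longrightarrow> d z > 0"
proof -
  assume z: "z \<in> U" "z \<notin> closure \<Omega>"
  then have "z \<notin> frontier \<Omega>" "z \<notin> \<Omega>" using closure_subset by (auto simp: frontier_def)
  moreover have "closed (frontier \<Omega>)" "frontier \<Omega> \<noteq> {}" using nearest_frontier[OF z(1)] by auto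
  ultimately have "bdist \<Omega> z \<noteq> 0" unfolding bdist_def using in_closed_iff_infdist_zero by blast
  then show "d z > 0" using \<open>z \<notin> \<Omega>\<close> infdist_nonneg[of z "frontier \<Omega>"] by (simp add: sdist_def bdist_def)
qed

lemma sdist_neg_imp: "d z < 0 \<Longrightarrow> z \<in> \<Omega>"
  using infdist_nonneg[of z "frontier \<Omega>"] by (auto simp: sdist_def bdist_def split: if_splits)

lemma sdist_eq_0_iff: "z \<in> U \<Longrightarrow> d z = 0 \<longleftrightarrow> z \<in> frontier \<Omega>"
proof -
  assume z: "z \<in> U"
  have "z \<in> frontier \<Omega> \<longleftrightarrow> z \<in> closure \<Omega> \<and> z \<notin> \<Omega>" using open_domain by (simp add: frontier_def interior_open)
  then show "d z = 0 \<longleftrightarrow> z \<in> frontier \<Omega>"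
    using sdist_inside[OF z] sdist_outside[OF z] sdist_frontier[OF open_domain, of z] by force
qed

lemma subtube:
  assumes "boundary_nbhd \<Omega> V" "V \<subseteq> U"
  shows "tube \<Omega> V"
  using assms open_domain nearest_frontier norm_grad grad_nearest nearest_diff Ck_on_subset[OF C2_sdist assms(2)]
  by unfold_locales (auto simp: subset_iff)

text \<open>The same requirement as \<open>small_hessian\<close>, stated as limits at single
  boundary points and in fixed directions, a form in which limits of sums and products apply
  directly.\<close>

definition vanishing_hessian :: "(complex^'n \<Rightarrow> real) \<Rightarrow> (complex^'n) set \<Rightarrow> bool" where
  "vanishing_hessian g A \<longleftrightarrow> (\<forall>p\<in>frontier \<Omega>. \<forall>v w.
    ((\<lambda>z. d z * \<H> g z v w) \<longlongrightarrow> 0) (at p within A))"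

text \<open>The direction \<open>m\<close> stands for a smooth approximation of the normal field, which itself is only $C^1$.\<close>

definition reflect :: "(complex^'n \<Rightarrow> complex^'n) \<Rightarrow> real \<Rightarrow> complex^'n \<Rightarrow> complex^'n" where
  "reflect m t z = z - (t * d z) *\<^sub>R m z"

lemma reflect_C2: "Ck_on 2 m U \<Longrightarrow> Ck_on 2 (reflect m t) U"
  unfolding reflect_def[abs_def]
  by (intro Ck_on_diff Ck_on_ident Ck_on_scaleR Ck_on_mult Ck_on_const C2_sdist open_U)

lemma reflect_frontier: "p \<in> frontier \<Omega> \<Longrightarrow> reflect m t p = p"
  by (simp add: reflect_def sdist_frontier[OF open_domain])

lemma reflect_deriv_frontier:
  assumes m: "Ck_on 2 m U" and p: "p \<in> frontier \<Omega>"
  shows "\<D> (reflect m t) p v = v - (t * (\<nu> p \<bullet> v)) *\<^sub>R m p"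
proof -
  have pU: "p \<in> U" using p frontier_U by auto
  have "Ck_on (Suc (Suc 0)) m U" using m by (simp only: numeral_2_eq_2)
  note md = Ck_on_has_derivative[OF this open_U pU]
  have "((\<lambda>z. z - (t * d z) *\<^sub>R m z) has_derivative
      (\<lambda>v. v - ((t * d p) *\<^sub>R \<D> m p v + (t * (\<nu> p \<bullet> v)) *\<^sub>R m p))) (at p)"
    by (intro has_derivative_diff has_derivative_ident has_derivative_scaleR md has_derivative_mult_right sdist_deriv pU)
  from frechet_derivative_eqI[OF this] show ?thesis
    unfolding reflect_def[abs_def] by (simp add: sdist_frontier[OF open_domain p])
qed

text \<open>Along the segment from \<open>z\<close> to its image the slope of \<open>d\<close> in
  the direction \<open>m z\<close> is at least 1/2, so a step of length factor t at least 4 lowers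
  \<open>d\<close> by at least 2 d(z). The image is therefore inside, and no closer to the boundary
  than \<open>z\<close> in signed distance; this comparison is what controls the reflected
  Hessian.\<close>

lemma reflect_inside_local:
  assumes m: "Ck_on 2 m U" and near: "norm (\<nu> p - m p) < 1 / 4" and p: "p \<in> frontier \<Omega>" and t: "4 \<le> t"
  obtains e where "e > 0" "ball p e \<subseteq> U" "\<And>z. z \<in> ball p e \<Longrightarrow> reflect m t z \<in> U"
    "\<And>z. z \<in> ball p e \<Longrightarrow> z \<notin> closure \<Omega> \<Longrightarrow> reflect m t z \<in> \<Omega> \<and> d z \<le> - d (reflect m t z)"
proof -
  have pU: "p \<in> U" using p frontier_U by auto
  have "isCont \<nu> p" using grad_deriv[OF pU] by (rule has_derivative_continuous)
  then obtain e1 where e1: "e1 > 0" "\<And>w. dist w p < e1 \<Longrightarrow> dist (\<nu> w) (\<nu> p) < 1 / 8"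
    unfolding continuous_at_eps_delta by (metis zero_less_divide_1_iff zero_less_numeral)
  have "isCont m p" using Ck_on_imp_continuous_on[OF m] open_U pU by (simp add: continuous_on_eq_continuous_at)
  then obtain e2 where e2: "e2 > 0" "\<And>w. dist w p < e2 \<Longrightarrow> dist (m w) (m p) < 1 / 8"
    unfolding continuous_at_eps_delta by (metis zero_less_divide_1_iff zero_less_numeral)
  obtain e3 where e3: "e3 > 0" "ball p e3 \<subseteq> U" using open_U pU openE by blast
  define e4 where "e4 = min e1 e3"
  have e4: "e4 > 0" using e1 e3 by (simp add: e4_def)
  have "isCont (reflect m t) p"
    using Ck_on_imp_continuous_on[OF reflect_C2[OF m]] open_U pU by (simp add: continuous_on_eq_continuous_at)
  then obtain e5 where e5: "e5 > 0" "\<And>w. dist w p < e5 \<Longrightarrow> dist (reflect m t w) p < e4"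
    unfolding continuous_at_eps_delta reflect_frontier[OF p] using e4 by blast
  define e where "e = min (min e2 e4) e5"
  have b4: "ball p e4 \<subseteq> U" using e3 by (auto simp: e4_def)
  show thesis
  proof (rule that)
    show "e > 0" using e2 e4 e5 by (simp add: e_def)
    show "ball p e \<subseteq> U" using b4 by (auto simp: e_def)
    fix z assume z: "z \<in> ball p e"
    have z4: "z \<in> ball p e4" using z by (simp add: e_def)
    have R4: "reflect m t z \<in> ball p e4" using e5(2)[of z] z by (simp add: e_def dist_commute)
    then show "reflect m t z \<in> U" using b4 by auto
    assume out: "z \<notin> closure \<Omega>"
    have dz: "d z > 0" using sdist_outside[OF _ out] z4 b4 by auto
    define u where "u = reflect m t z - z"
    have u: "u = - (t * d z) *\<^sub>R m z" by (simp add: u_def reflect_def)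
    have "((\<lambda>s. d (z + s *\<^sub>R u)) has_derivative (\<lambda>h. h * (\<nu> (z + s *\<^sub>R u) \<bullet> u))) (at s)"
      and seg: "z + s *\<^sub>R u \<in> ball p e4" if "0 \<le> s" "s \<le> 1" for s
    proof -
      have "z + s *\<^sub>R u = (1 - s) *\<^sub>R z + s *\<^sub>R reflect m t z" by (simp add: u_def algebra_simps)
      then show *: "z + s *\<^sub>R u \<in> ball p e4"
        using convexD[OF convex_ball z4 R4, of "1 - s" s] that by simp
      have "((\<lambda>s. d (z + s *\<^sub>R u)) has_derivative (\<lambda>h. \<nu> (z + s *\<^sub>R u) \<bullet> (h *\<^sub>R u))) (at s)"
        by (rule has_derivative_compose[where f = "\<lambda>s. z + s *\<^sub>R u"])
          (use sdist_deriv * b4 in \<open>auto intro!: derivative_eq_intros\<close>)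
      then show "((\<lambda>s. d (z + s *\<^sub>R u)) has_derivative (\<lambda>h. h * (\<nu> (z + s *\<^sub>R u) \<bullet> u))) (at s)" by simp
    qed
    \<comment> \<open>Mean value theorem along the segment, which stays in the ball by
      convexity.\<close>
    then have "\<exists>s\<in>{0<..<1}. d (z + 1 *\<^sub>R u) - d (z + 0 *\<^sub>R u) = (\<lambda>h. h * (\<nu> (z + s *\<^sub>R u) \<bullet> u)) (1 - 0)"
      by (intro mvt_simple[where f = "\<lambda>s. d (z + s *\<^sub>R u)"]) (auto intro: has_derivative_at_withinI)
    then obtain s where s: "0 < s" "s < 1" "d (reflect m t z) - d z = \<nu> (z + s *\<^sub>R u) \<bullet> u"
      by (auto simp: u_def)
    define w where "w = z + s *\<^sub>R u"
    have w: "w \<in> ball p e4" using seg[of s] s by (simp add: w_def)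
    have wU: "w \<in> U" using w b4 by auto
    \<comment> \<open>The budget is 1/2: at most 1/4 for the approximation of \<nu> by
      \<open>m\<close> at \<open>p\<close>, and 1/8 each for moving from \<open>p\<close> to
      \<open>z\<close> and to \<open>w\<close>.\<close>
    have "norm (m z - \<nu> w) \<le> norm (m z - m p) + norm (\<nu> p - m p) + norm (\<nu> w - \<nu> p)"
      by (rule order_trans[OF _ order_trans[OF norm_triangle_ineq4[of "m z - m p - (\<nu> p - m p)" "\<nu> w - \<nu> p"]
            add_right_mono[OF norm_triangle_ineq4[of "m z - m p" "\<nu> p - m p"]]]]) simp
    also have "\<dots> \<le> 1 / 8 + 1 / 4 + 1 / 8"
    proof (intro add_mono)
      show "norm (m z - m p) \<le> 1 / 8" using e2(2)[of z] z by (simp add: e_def dist_norm norm_minus_commute)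
      show "norm (\<nu> w - \<nu> p) \<le> 1 / 8" using e1(2)[of w] w by (simp add: e4_def dist_norm norm_minus_commute)
    qed (use near in simp)
    finally have "norm (m z - \<nu> w) \<le> 1 / 2" by simp
    then have "\<bar>\<nu> w \<bullet> (m z - \<nu> w)\<bar> \<le> 1 / 2"
      using Cauchy_Schwarz_ineq2[of "\<nu> w" "m z - \<nu> w"] norm_grad[OF wU] by simp
    then have "\<nu> w \<bullet> m z \<ge> 1 / 2" using nu_nu[OF wU] unfolding inner_diff_right by linarith
    then have "4 * (1 / 2) \<le> t * (\<nu> w \<bullet> m z)" using t by (intro mult_mono) auto
    then have "d z * 2 \<le> d z * (t * (\<nu> w \<bullet> m z))" using dz by (intro mult_left_mono) auto
    moreover have "d (reflect m t z) = d z - d z * (t * (\<nu> w \<bullet> m z))"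
    proof -
      have "d (reflect m t z) - d z = \<nu> w \<bullet> u" using s(3) by (simp only: w_def)
      then show ?thesis unfolding u by (simp add: mult_ac)
    qed
    ultimately have le: "d z \<le> - d (reflect m t z)" by simp
    then have "d (reflect m t z) < 0" using dz by simp
    with le show "reflect m t z \<in> \<Omega> \<and> d z \<le> - d (reflect m t z)" using sdist_neg_imp by blast
  qed
qed

lemma second_derivative_compose:
  fixes R :: "complex^'n \<Rightarrow> complex^'n"
  assumes g: "Ck_on 2 g S" "open S" and R: "Ck_on 2 R T" "open T" "R ` T \<subseteq> S" and z: "z \<in> T"
  shows "\<H> (\<lambda>x. g (R x)) z v w =
    (\<Sum>b\<in>Basis. (\<D> R z v \<bullet> b) *
        (\<Sum>c\<in>Basis. (\<D> R z w \<bullet> c) * \<H> g (R z) b c)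
      + (\<H> R z v w \<bullet> b) * \<D> g (R z) b)"
proof -
  have g2: "Ck_on (Suc (Suc 0)) g S" and R2: "Ck_on (Suc (Suc 0)) R T" using g(1) R(1) by (simp_all only: numeral_2_eq_2)
  let ?G = "\<lambda>y. \<D> g y" and ?R = "\<lambda>y. \<D> R y"
  have RS: "R y \<in> S" if "y \<in> T" for y using R(3) that by auto
  have d1: "\<D> (\<lambda>x. g (R x)) y v = (\<Sum>b\<in>Basis. (?R y v \<bullet> b) * ?G (R y) b)" if y: "y \<in> T" for y
  proof -
    note gd = Ck_on_has_derivative[OF g2 g(2) RS[OF y]]
    have "((\<lambda>x. g (R x)) has_derivative (\<lambda>v. ?G (R y) (?R y v))) (at y)"
      by (rule has_derivative_compose[OF Ck_on_has_derivative[OF R2 R(2) y] gd])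
    from frechet_derivative_eqI[OF this] show ?thesis using frechet_derivative_expand[OF gd, of "?R y v"] by simp
  qed
  have Rd: "((\<lambda>y. ?R y v) has_derivative \<D> (\<lambda>y. ?R y v) z) (at z)"
    by (rule Ck_on_has_derivative[of 0, OF _ R(2) z]) (use R2 in simp)
  have Gd: "((\<lambda>y. ?G (R y) b) has_derivative (\<lambda>w. \<D> (\<lambda>y. ?G y b) (R z) (?R z w))) (at z)" for b
    by (rule has_derivative_compose[OF Ck_on_has_derivative[OF R2 R(2) z] Ck_on_has_derivative[of 0, OF _ g(2) RS[OF z]]])
      (use g2 in simp)
  have ex: "\<D> (\<lambda>y. ?G y b) (R z) u
      = (\<Sum>c\<in>Basis. (u \<bullet> c) * \<D> (\<lambda>y. ?G y b) (R z) c)" for b u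
  proof -
    have "((\<lambda>y. ?G y b) has_derivative \<D> (\<lambda>y. ?G y b) (R z)) (at (R z))"
      by (rule Ck_on_has_derivative[of 0, OF _ g(2) RS[OF z]]) (use g2 in simp)
    from frechet_derivative_expand[OF this, of u] show ?thesis by simp
  qed
  have "((\<lambda>y. \<Sum>b\<in>Basis. (?R y v \<bullet> b) * ?G (R y) b) has_derivative
      (\<lambda>w. \<Sum>b\<in>Basis. (?R z v \<bullet> b) * \<D> (\<lambda>y. ?G y b) (R z) (?R z w)
        + (\<D> (\<lambda>y. ?R y v) z w \<bullet> b) * ?G (R z) b)) (at z)"
    by (intro has_derivative_sum has_derivative_mult has_derivative_inner_left Rd Gd)
  then have "((\<lambda>y. \<D> (\<lambda>x. g (R x)) y v) has_derivative
      (\<lambda>w. \<Sum>b\<in>Basis. (?R z v \<bullet> b) * \<D> (\<lambda>y. ?G y b) (R z) (?R z w)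
        + (\<D> (\<lambda>y. ?R y v) z w \<bullet> b) * ?G (R z) b)) (at z)"
    by (rule has_derivative_transform_within_open[OF _ R(2) z]) (simp only: d1)
  from frechet_derivative_eqI[OF this] show ?thesis by (simp only: ex[of _ "?R z w"])
qed

end

lemma frechet_derivative_cong_open:
  assumes "open S" "x \<in> S" "\<And>y. y \<in> S \<Longrightarrow> f y = g y"
  shows "\<D> f x = \<D> g x"
proof -
  have "(f has_derivative f') (at x) \<longleftrightarrow> (g has_derivative f') (at x)" for f'
    using has_derivative_transform_within_open[OF _ assms(1,2), of f f' UNIV g]
      has_derivative_transform_within_open[OF _ assms(1,2), of g f' UNIV f] assms(3) by auto
  then show ?thesis unfolding frechet_derivative_def by simp
qed

lemma second_derivative_cong_open:
  assumes "open S" "x \<in> S" "\<And>y. y \<in> S \<Longrightarrow> f y = g y"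
  shows "\<H> f x v = \<H> g x v"
  by (rule frechet_derivative_cong_open[OF assms(1,2)])
    (simp only: frechet_derivative_cong_open[OF assms(1) _ assms(3)])

lemma derivatives_lincomb:
  fixes f h :: "'a::euclidean_space \<Rightarrow> real"
  assumes f: "Ck_on 2 f S" and h: "Ck_on 2 h S" and S: "open S" and x: "x \<in> S"
  shows "\<D> (\<lambda>y. a * f y + b * h y) x v
      = a * \<D> f x v + b * \<D> h x v"
    and "\<H> (\<lambda>y. a * f y + b * h y) x v w
      = a * \<H> f x v w
      + b * \<H> h x v w"
proof -
  interpret f: C2_at f S x by unfold_locales (use assms in auto)
  interpret h: C2_at h S x by unfold_locales (use assms in auto)
  have d1: "\<D> (\<lambda>y. a * f y + b * h y) y v
      = a * \<D> f y v + b * \<D> h y v" if "y \<in> S" for y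
  proof -
    have "((\<lambda>y. a * f y + b * h y) has_derivative (\<lambda>v. a * f.D1 y v + b * h.D1 y v)) (at y)"
      by (intro has_derivative_add has_derivative_mult_right f.D1_deriv h.D1_deriv that)
    from frechet_derivative_eqI[OF this] show ?thesis by simp
  qed
  show "\<D> (\<lambda>y. a * f y + b * h y) x v
      = a * \<D> f x v + b * \<D> h x v" by (rule d1[OF x])
  have "((\<lambda>y. a * f.D1 y v + b * h.D1 y v) has_derivative (\<lambda>w. a * f.D2 v w + b * h.D2 v w)) (at x)"
    by (intro has_derivative_add has_derivative_mult_right f.D2_deriv h.D2_deriv)
  from frechet_derivative_eqI[OF this]
  show "\<H> (\<lambda>y. a * f y + b * h y) x v w
      = a * f.D2 v w + b * h.D2 v w"
    using frechet_derivative_cong_open[OF S x d1] by simp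
qed

context tube
begin

text \<open>In the chain rule, second derivatives of \<open>g\<close> occur at the image point,
  whose distance is at least d(z), so the factor d(z) makes them vanish. First derivatives of
  \<open>g\<close> meet second derivatives of the reflection; both stay bounded and the factor d(z)
  tends to 0.\<close>

lemma reflected_hessian_tendsto:
  assumes g: "Ck_on 1 g U" "Ck_on 2 g (U \<inter> \<Omega>)" "vanishing_hessian g (U \<inter> \<Omega>)"
    and m: "Ck_on 2 m U" and V: "open V" "V \<subseteq> U" and p: "p \<in> frontier \<Omega>" "p \<in> V"
    and R: "\<And>z. z \<in> V - closure \<Omega> \<Longrightarrow> reflect m t z \<in> U \<inter> \<Omega> \<and> d z \<le> - d (reflect m t z)"
  shows "((\<lambda>z. d z * \<H> (\<lambda>x. g (reflect m t x)) z v w) \<longlongrightarrow> 0)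
    (at p within V - closure \<Omega>)"
proof -
  let ?R = "reflect m t" and ?T = "V - closure \<Omega>"
  have pU: "p \<in> U" using p V by auto
  have T: "open ?T" "?T \<subseteq> U" using V by (auto simp: open_Diff)
  have R2U: "Ck_on 2 ?R U" by (rule reflect_C2[OF m])
  have R2T: "Ck_on 2 ?R ?T" by (rule Ck_on_subset[OF R2U T(2)])
  have tend: "(f \<longlongrightarrow> f p) (at p within ?T)" if "continuous_on U f" for f :: "complex^'n \<Rightarrow> 'b::topological_space"
    using that open_U pU by (metis continuous_on_eq_continuous_at isCont_def tendsto_within_subset subset_UNIV)
  have R2': "Ck_on (Suc (Suc 0)) ?R U" using R2U by (simp only: numeral_2_eq_2)
  have tR: "(?R \<longlongrightarrow> p) (at p within ?T)"
    using tend[OF Ck_on_imp_continuous_on[OF R2U]] reflect_frontier[OF p(1)] by simp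
  have tR1: "((\<lambda>z. \<D> ?R z v) \<longlongrightarrow> \<D> ?R p v) (at p within ?T)" for v
    by (rule tend) (use R2' in \<open>auto intro: differentiable_imp_continuous_on\<close>)
  have tR2: "((\<lambda>z. \<H> ?R z v w) \<longlongrightarrow>
      \<H> ?R p v w) (at p within ?T)" for v w
    by (rule tend) (use R2' in auto)
  have td: "(d \<longlongrightarrow> 0) (at p within ?T)"
    using tend[OF Ck_on_imp_continuous_on[OF C2_sdist]] sdist_frontier[OF open_domain p(1)] by simp
  have tg1: "((\<lambda>z. \<D> g (?R z) b) \<longlongrightarrow> \<D> g p b) (at p within ?T)" for b
  proof -
    have "continuous_on U (\<lambda>z. \<D> g z b)" using g(1) by simp
    then have "isCont (\<lambda>z. \<D> g z b) p" using open_U pU by (simp add: continuous_on_eq_continuous_at)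
    from isCont_tendsto_compose[OF this tR] show ?thesis .
  qed
  have tg2: "((\<lambda>z. d z * \<H> g (?R z) b c) \<longlongrightarrow> 0) (at p within ?T)" for b c
  proof -
    \<comment> \<open>A limit at \<open>p\<close> ignores the point \<open>p\<close>, so the image
      points have to avoid it; they do, being in \<Omega>.\<close>
    have "p \<notin> \<Omega>" by (rule frontier_open_disjoint[OF open_domain p(1)])
    then have "filterlim ?R (at p within U \<inter> \<Omega>) (at p within ?T)"
      unfolding filterlim_at using tR R by (auto simp: eventually_at_filter intro!: always_eventually)
    moreover have "((\<lambda>z. d z * \<H> g z b c) \<longlongrightarrow> 0) (at p within U \<inter> \<Omega>)"
      using g(3) p(1) unfolding vanishing_hessian_def by blast
    ultimately have "((\<lambda>z. d (?R z) * \<H> g (?R z) b c) \<longlongrightarrow> 0) (at p within ?T)"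
      by (rule filterlim_compose[rotated])
    from tendsto_norm_zero[OF this] show ?thesis
    proof (rule Lim_null_comparison[rotated])
      show "eventually (\<lambda>z. norm (d z * \<H> g (?R z) b c)
          \<le> norm (d (?R z) * \<H> g (?R z) b c)) (at p within ?T)"
        unfolding eventually_at_filter
      proof (intro always_eventually allI impI)
        fix z assume z: "z \<in> ?T"
        have "\<bar>d z\<bar> \<le> \<bar>d (?R z)\<bar>" using R[OF z] sdist_outside[of z] z T by auto
        then show "norm (d z * \<H> g (?R z) b c) \<le> norm (d (?R z) * \<H> g (?R z) b c)"
          by (simp add: abs_mult mult_right_mono)
      qed
    qed
  qed
  let ?S = "\<lambda>z. \<Sum>b\<in>Basis. (\<D> ?R z v \<bullet> b) *
        (\<Sum>c\<in>Basis. (\<D> ?R z w \<bullet> c) * (d z * \<H> g (?R z) b c))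
      + (\<H> ?R z v w \<bullet> b) * (d z * \<D> g (?R z) b)"
  have "(?S
    \<longlongrightarrow> (\<Sum>b\<in>Basis. (\<D> ?R p v \<bullet> b) * (\<Sum>c\<in>Basis. (\<D> ?R p w \<bullet> c) * 0)
      + (\<H> ?R p v w \<bullet> b) * (0 * \<D> g p b))) (at p within ?T)"
    by (intro tendsto_sum tendsto_add tendsto_mult tendsto_inner tendsto_const tR1 tR2 td tg1 tg2)
  then have lim: "(?S \<longlongrightarrow> 0) (at p within ?T)"
    by simp
  show ?thesis
  proof (rule Lim_transform_eventually[OF lim])
    show "eventually (\<lambda>z. ?S z = d z * \<H> (\<lambda>x. g (?R x)) z v w) (at p within ?T)"
      unfolding eventually_at_filter
    proof (intro always_eventually allI impI)
      fix z assume z: "z \<in> ?T"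
      have RT: "?R ` ?T \<subseteq> U \<inter> \<Omega>" using R by auto
      show "?S z = d z * \<H> (\<lambda>x. g (?R x)) z v w"
        unfolding second_derivative_compose[OF g(2) open_Int[OF open_U open_domain] R2T T(1) RT z]
        by (simp add: sum_distrib_left distrib_left mult_ac)
    qed
  qed
qed

text \<open>Not the product but the factor \<open>g\<close> is extended, and only as a C^1 function;
  its Hessian outside again vanishes after multiplication by \<open>d\<close>, and then
  \<open>Ck_on_2_mult_vanishing\<close> makes the product C^2.\<close>

lemma defining_function_extension:
  assumes bd: "bounded \<Omega>" and g: "Ck_on 1 g U" "Ck_on 2 g (U \<inter> \<Omega>)" "vanishing_hessian g (U \<inter> \<Omega>)"
    and pos: "\<And>p. p \<in> frontier \<Omega> \<Longrightarrow> g p > 0"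
  obtains W \<rho> where "C2_defining_function \<Omega> W \<rho>" "W \<subseteq> U" "\<And>z. z \<in> W \<inter> \<Omega> \<Longrightarrow> \<rho> z = d z * g z"
proof -
  have "compact (frontier \<Omega>)" using bd by (simp add: compact_frontier_bounded)
  moreover have "continuous_on (frontier \<Omega>) \<nu>"
    using grad_deriv frontier_U
    by (intro continuous_at_imp_continuous_on) (auto intro: has_derivative_continuous)
  \<comment> \<open>Stone-Weierstrass on the compact boundary; the tolerance 1/4 is the one required
    by \<open>reflect_inside_local\<close>.\<close>
  ultimately obtain m where m: "polynomial_function m" "\<And>p. p \<in> frontier \<Omega> \<Longrightarrow> norm (\<nu> p - m p) < 1 / 4"
    using Stone_Weierstrass_polynomial_function[of "frontier \<Omega>" \<nu> "1/4"] by auto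
  have m2: "Ck_on 2 m U" by (rule Ck_on_polynomial_function[OF m(1) open_U])
  define P where "P p e \<longleftrightarrow> 0 < e \<and> ball p e \<subseteq> U \<and> (\<forall>z\<in>ball p e. reflect m 4 z \<in> U \<and> reflect m 8 z \<in> U \<and>
      (z \<notin> closure \<Omega> \<longrightarrow> reflect m 4 z \<in> \<Omega> \<and> d z \<le> - d (reflect m 4 z) \<and> reflect m 8 z \<in> \<Omega> \<and> d z \<le> - d (reflect m 8 z)))"
    for p e
  have "\<exists>e. P p e" if p: "p \<in> frontier \<Omega>" for p
  proof -
    obtain e4 where e4: "e4 > 0" "ball p e4 \<subseteq> U" "\<And>z. z \<in> ball p e4 \<Longrightarrow> reflect m 4 z \<in> U"
      "\<And>z. z \<in> ball p e4 \<Longrightarrow> z \<notin> closure \<Omega> \<Longrightarrow> reflect m 4 z \<in> \<Omega> \<and> d z \<le> - d (reflect m 4 z)"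
      using reflect_inside_local[OF m2 m(2)[OF p] p, of 4] by auto
    obtain e8 where e8: "e8 > 0" "ball p e8 \<subseteq> U" "\<And>z. z \<in> ball p e8 \<Longrightarrow> reflect m 8 z \<in> U"
      "\<And>z. z \<in> ball p e8 \<Longrightarrow> z \<notin> closure \<Omega> \<Longrightarrow> reflect m 8 z \<in> \<Omega> \<and> d z \<le> - d (reflect m 8 z)"
      using reflect_inside_local[OF m2 m(2)[OF p] p, of 8] by auto
    have "P p (min e4 e8)"
      unfolding P_def
    proof (intro conjI ballI)
      show "0 < min e4 e8" using e4 e8 by simp
      show "ball p (min e4 e8) \<subseteq> U" using e4 by auto
      fix z assume "z \<in> ball p (min e4 e8)"
      then have z: "z \<in> ball p e4" "z \<in> ball p e8" by auto
      show "reflect m 4 z \<in> U" "reflect m 8 z \<in> U" by (rule e4(3)[OF z(1)], rule e8(3)[OF z(2)])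
      show "z \<notin> closure \<Omega> \<longrightarrow> reflect m 4 z \<in> \<Omega> \<and> d z \<le> - d (reflect m 4 z) \<and> reflect m 8 z \<in> \<Omega> \<and> d z \<le> - d (reflect m 8 z)"
        using e4(4)[OF z(1)] e8(4)[OF z(2)] by blast
    qed
    then show ?thesis by blast
  qed
  then have "\<forall>p\<in>frontier \<Omega>. \<exists>e. P p e" by blast
  from bchoice[OF this] obtain e where e: "\<And>p. p \<in> frontier \<Omega> \<Longrightarrow> P p (e p)" by blast
  define V where "V = (\<Union>p\<in>frontier \<Omega>. ball p (e p))"
  have V: "open V" "frontier \<Omega> \<subseteq> V" "V \<subseteq> U"
    using e unfolding V_def P_def by (auto simp: subset_iff) (metis centre_in_ball mem_ball)
  have RU: "reflect m 4 z \<in> U" "reflect m 8 z \<in> U" if "z \<in> V" for z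
    using that e unfolding V_def P_def by blast+
  have Rout: "reflect m 4 z \<in> \<Omega> \<and> d z \<le> - d (reflect m 4 z)" "reflect m 8 z \<in> \<Omega> \<and> d z \<le> - d (reflect m 8 z)"
    if "z \<in> V - closure \<Omega>" for z
    using that e unfolding V_def P_def by blast+
  have gR1: "Ck_on 1 (\<lambda>x. g (reflect m t x)) V" if "\<And>z. z \<in> V \<Longrightarrow> reflect m t z \<in> U" for t
    by (rule Ck_on_compose[OF g(1) Ck_on_subset[OF _ V(3)] _ V(1) open_U])
      (use that Ck_on_le[OF reflect_C2[OF m2], of 1] in auto)
  \<comment> \<open>The weights \<open>2, -1\<close> and step lengths \<open>4, 8\<close> satisfy \<open>2 - 1 = 1\<close> and \<open>2 * 4 - 8 = 0\<close>, so that the reflected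
    function agrees with \<open>g\<close> to first order on the boundary\<close>
  define G where "G z = 2 * g (reflect m 4 z) + (- 1) * g (reflect m 8 z) - g z" for z
  define k where "k z = g z + (if z \<in> closure \<Omega> then 0 else G z)" for z
  have gV: "Ck_on 1 g V" by (rule Ck_on_subset[OF g(1) V(3)])
  have G1: "Ck_on 1 G V"
    unfolding G_def[abs_def] by (intro Ck_on_diff Ck_on_add Ck_on_mult Ck_on_const gR1 RU gV V(1))
  have kin: "k z = g z" if "z \<in> closure \<Omega>" for z using that by (simp add: k_def)
  have kout: "k z = 2 * g (reflect m 4 z) + (- 1) * g (reflect m 8 z)" if "z \<notin> closure \<Omega>" for z
    using that by (simp add: k_def G_def)
  have Gd0: "\<D> G p v = 0" if p: "p \<in> frontier \<Omega>" for p v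
  proof -
    have pU: "p \<in> U" and pV: "p \<in> V" using p V by auto
    have gd: "(g has_derivative \<D> g p) (at p)"
      using Ck_on_has_derivative[of 0 g U p] g(1) open_U pU by simp
    let ?g = "\<D> g p"
    have Rd: "((\<lambda>x. g (reflect m t x)) has_derivative (\<lambda>v. ?g (v - (t * (\<nu> p \<bullet> v)) *\<^sub>R m p))) (at p)" for t
    proof -
      have "Ck_on (Suc (Suc 0)) (reflect m t) U" using reflect_C2[OF m2] by (simp only: numeral_2_eq_2)
      moreover have "\<D> (reflect m t) p = (\<lambda>v. v - (t * (\<nu> p \<bullet> v)) *\<^sub>R m p)"
        by (intro ext reflect_deriv_frontier m2 p)
      ultimately have "(reflect m t has_derivative (\<lambda>v. v - (t * (\<nu> p \<bullet> v)) *\<^sub>R m p)) (at p)"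
        using Ck_on_has_derivative[OF _ open_U pU] by metis
      from has_derivative_compose[OF this, of g ?g] show ?thesis using gd reflect_frontier[OF p] by simp
    qed
    have "(G has_derivative (\<lambda>v. 2 * ?g (v - (4 * (\<nu> p \<bullet> v)) *\<^sub>R m p) + (- 1) * ?g (v - (8 * (\<nu> p \<bullet> v)) *\<^sub>R m p) - ?g v)) (at p)"
      unfolding G_def[abs_def] by (intro has_derivative_diff has_derivative_add has_derivative_mult_right Rd gd)
    from frechet_derivative_eqI[OF this] show ?thesis
      using linear_diff[OF has_derivative_linear[OF gd]] linear_scale[OF has_derivative_linear[OF gd]] by simp
  qed
  have G0: "G p = 0" if "p \<in> frontier \<Omega>" for p using reflect_frontier[OF that] by (simp add: G_def)
  \<comment> \<open>\<open>k\<close> was written as \<open>g\<close> plus a cut off correction so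
    that C^1 regularity across the boundary reduces to \<open>G\<close> vanishing there to first
    order.\<close>
  have k1: "Ck_on 1 k V"
    unfolding k_def[abs_def]
    by (rule Ck_on_add[OF gV Ck_on_1_cut_off[OF open_domain V(1) G1 G0 Gd0] V(1)])
  have gRT: "Ck_on 2 (\<lambda>x. g (reflect m t x)) (V - closure \<Omega>)"
    if "\<And>z. z \<in> V - closure \<Omega> \<Longrightarrow> reflect m t z \<in> U \<inter> \<Omega>" for t
    by (rule Ck_on_compose[OF g(2) Ck_on_subset[OF reflect_C2[OF m2]]])
      (use that V open_U open_domain in auto)
  have g4: "Ck_on 2 (\<lambda>x. g (reflect m 4 x)) (V - closure \<Omega>)" and g8: "Ck_on 2 (\<lambda>x. g (reflect m 8 x)) (V - closure \<Omega>)"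
    by (rule gRT; use RU Rout in auto)+
  have oT: "open (V - closure \<Omega>)" "open (V \<inter> \<Omega>)" using V open_domain by auto
  have "Ck_on 2 (\<lambda>x. 2 * g (reflect m 4 x) + (- 1) * g (reflect m 8 x)) (V - closure \<Omega>)"
    by (intro Ck_on_add Ck_on_mult Ck_on_const g4 g8 oT(1))
  moreover have "2 * g (reflect m 4 x) + (- 1) * g (reflect m 8 x) = k x" if "x \<in> V - closure \<Omega>" for x
    using kout[of x] that by simp
  ultimately have kT: "Ck_on 2 k (V - closure \<Omega>)"
    by (rule Ck_on_transfer[OF oT(1)])
  have inside: "k z = g z" if "z \<in> V \<inter> \<Omega>" for z using kin closure_subset that by blast
  have kI: "Ck_on 2 k (V \<inter> \<Omega>)"
    by (rule Ck_on_transfer[OF oT(2) Ck_on_subset[OF g(2)]]) (use V inside in auto)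
  have "{x\<in>V. d x \<noteq> 0} = (V - closure \<Omega>) \<union> (V \<inter> \<Omega>)"
    using sdist_eq_0_iff V(3) open_domain by (auto simp: frontier_def interior_open)
  then have k2: "Ck_on 2 k {x\<in>V. d x \<noteq> 0}" and oN: "open {x\<in>V. d x \<noteq> 0}"
    using oT kT kI by (auto intro!: Ck_on_local[of "(V - closure \<Omega>) \<union> (V \<inter> \<Omega>)"])
  have dV: "Ck_on 2 d V" by (rule Ck_on_subset[OF C2_sdist V(3)])
  \<comment> \<open>At a boundary point the limit is 0 from within \<Omega>, from the exterior
    through the reflected pieces, and along the boundary itself; the three sets cover
    \<open>V\<close>.\<close>
  have small: "continuous_on V (\<lambda>x. if d x = 0 then 0
      else d x * \<H> k x v w)" (is "continuous_on V ?F") for v w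
  proof (rule continuous_at_imp_continuous_on, intro ballI)
    fix x assume x: "x \<in> V"
    let ?D = "\<lambda>x. \<H> k x v w"
    show "isCont ?F x"
    proof (cases "d x = 0")
      case False
      have "continuous_on {x\<in>V. d x \<noteq> 0} (\<lambda>x. d x * ?D x)"
        using k2 Ck_on_imp_continuous_on[OF dV]
        by (intro continuous_on_mult) (auto simp: numeral_2_eq_2 intro: continuous_on_subset)
      then have "isCont (\<lambda>x. d x * ?D x) x" using oN x False by (simp add: continuous_on_eq_continuous_at)
      moreover have "eventually (\<lambda>y. ?F y = d y * ?D y) (nhds x)"
        by (rule eventually_mono[OF eventually_nhds_in_open[OF oN]]) (use x False in auto)
      ultimately show ?thesis using isCont_cong[of ?F "\<lambda>x. d x * ?D x" x] by simp
    next
      case True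
      then have p: "x \<in> frontier \<Omega>" using sdist_eq_0_iff x V(3) by auto
      have dD: "((\<lambda>z. d z * ?D z) \<longlongrightarrow> 0) (at x within V \<inter> \<Omega>)"
      proof (rule Lim_transform_eventually)
        show "((\<lambda>z. d z * \<H> g z v w) \<longlongrightarrow> 0) (at x within V \<inter> \<Omega>)"
          using g(3) p V(3) unfolding vanishing_hessian_def by (blast intro: tendsto_within_subset)
        show "eventually (\<lambda>z. d z * \<H> g z v w = d z * ?D z) (at x within V \<inter> \<Omega>)"
          unfolding eventually_at_filter
          by (intro always_eventually allI impI) (simp only: second_derivative_cong_open[OF oT(2) _ inside])
      qed
      have oD: "((\<lambda>z. d z * ?D z) \<longlongrightarrow> 0) (at x within V - closure \<Omega>)"
      proof (rule Lim_transform_eventually)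
        let ?E = "\<lambda>t z. \<H> (\<lambda>x. g (reflect m t x)) z v w"
        have "((\<lambda>z. d z * ?E 4 z) \<longlongrightarrow> 0) (at x within V - closure \<Omega>)" "((\<lambda>z. d z * ?E 8 z) \<longlongrightarrow> 0) (at x within V - closure \<Omega>)"
          by (rule reflected_hessian_tendsto[OF g m2 V(1,3) p x]; use RU Rout in auto)+
        then have "((\<lambda>z. 2 * (d z * ?E 4 z) + (- 1) * (d z * ?E 8 z)) \<longlongrightarrow> 2 * 0 + (- 1) * 0) (at x within V - closure \<Omega>)"
          by (intro tendsto_intros)
        then show "((\<lambda>z. 2 * (d z * ?E 4 z) + (- 1) * (d z * ?E 8 z)) \<longlongrightarrow> 0) (at x within V - closure \<Omega>)" by simp
        show "eventually (\<lambda>z. 2 * (d z * ?E 4 z) + (- 1) * (d z * ?E 8 z) = d z * ?D z) (at x within V - closure \<Omega>)"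
          unfolding eventually_at_filter
        proof (intro always_eventually allI impI)
          fix z assume z: "z \<in> V - closure \<Omega>"
          have e: "?D z = 2 * ?E 4 z + (- 1) * ?E 8 z"
            unfolding derivatives_lincomb(2)[OF g4 g8 oT(1) z, symmetric]
            by (rule fun_cong[OF second_derivative_cong_open[OF oT(1) z]]) (use kout in auto)
          show "2 * (d z * ?E 4 z) + (- 1) * (d z * ?E 8 z) = d z * ?D z" unfolding e by (simp add: algebra_simps)
        qed
      qed
      have "((\<lambda>z. d z * ?D z) \<longlongrightarrow> 0) (at x within (V \<inter> \<Omega>) \<union> (V - closure \<Omega>))"
        using dD oD by (simp add: Lim_within_Un)
      then have "(?F \<longlongrightarrow> 0) (at x within (V \<inter> \<Omega>) \<union> (V - closure \<Omega>))"
        by (rule Lim_null_comparison[OF _ tendsto_norm_zero, rotated]) (simp add: eventually_at_filter)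
      moreover have "(?F \<longlongrightarrow> 0) (at x within frontier \<Omega>)"
        by (rule Lim_transform_eventually[OF tendsto_const])
          (auto simp: eventually_at_filter sdist_frontier[OF open_domain] intro!: always_eventually)
      ultimately have "(?F \<longlongrightarrow> 0) (at x within ((V \<inter> \<Omega>) \<union> (V - closure \<Omega>)) \<union> frontier \<Omega>)"
        by (simp only: Lim_within_Un)
      moreover have "V \<subseteq> ((V \<inter> \<Omega>) \<union> (V - closure \<Omega>)) \<union> frontier \<Omega>"
        using open_domain by (auto simp: frontier_def interior_open)
      ultimately have "(?F \<longlongrightarrow> 0) (at x within V)" by (rule tendsto_within_subset)
      then show ?thesis using True at_within_open[OF x V(1)] by (simp add: isCont_def)
    qed
  qed
  have \<rho>2: "Ck_on 2 (\<lambda>x. d x * k x) V"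
    by (rule Ck_on_2_mult_vanishing[OF V(1) dV k1 k2 small])
  \<comment> \<open>Where \<open>k\<close> is positive, the product has the sign of the signed
    distance, as a defining function must.\<close>
  define W where "W = {x\<in>V. k x > 0}"
  have "W = V \<inter> k -` {0<..}" by (auto simp: W_def)
  then have oW: "open W"
    using continuous_open_preimage[OF Ck_on_imp_continuous_on[OF k1] V(1), of "{0<..}"] by auto
  have kp: "k p > 0" if "p \<in> frontier \<Omega>" for p
    using pos[OF that] that by (simp add: k_def frontier_def)
  have frW: "frontier \<Omega> \<subseteq> W" using V(2) kp by (auto simp: W_def)
  show thesis
  proof (rule that[of W "\<lambda>x. d x * k x"])
    show "W \<subseteq> U" using V by (auto simp: W_def)
    show "d z * k z = d z * g z" if "z \<in> W \<inter> \<Omega>" for z using inside[of z] that by (auto simp: W_def)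
    show "C2_defining_function \<Omega> W (\<lambda>x. d x * k x)"
      unfolding C2_defining_function_def boundary_nbhd_def
    proof (intro conjI ballI oW frW)
      show "Ck_on 2 (\<lambda>x. d x * k x) W" by (rule Ck_on_subset[OF \<rho>2]) (auto simp: W_def)
      show "d z * k z < 0" if "z \<in> W \<inter> \<Omega>" for z
        using that sdist_inside[of z] V(3) by (auto simp: W_def mult_neg_pos)
      show "0 < d z * k z" if "z \<in> W - closure \<Omega>" for z
        using that sdist_outside[of z] V(3) by (auto simp: W_def)
      fix p assume p: "p \<in> frontier \<Omega>"
      then have pU: "p \<in> U" and pV: "p \<in> V" using V by auto
      show "d p * k p = 0" using sdist_frontier[OF open_domain p] by simp
      have "isCont k p" using Ck_on_imp_continuous_on[OF k1] V(1) pV by (simp add: continuous_on_eq_continuous_at)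
      from has_derivative_mult_vanish[OF sdist_deriv[OF pU] sdist_frontier[OF open_domain p] this]
      have "\<D> (\<lambda>x. d x * k x) p = (\<lambda>v. (\<nu> p \<bullet> v) * k p)" by (rule frechet_derivative_eqI)
      then have "\<D> (\<lambda>x. d x * k x) p (\<nu> p) = k p" using nu_nu[OF pU] by simp
      then show "\<D> (\<lambda>x. d x * k x) p \<noteq> (\<lambda>v. 0)" using kp[OF p] by auto
    qed
  qed
qed

end

section \<open>The quotient of a defining function by the signed distance\<close>

context tube
begin

text \<open>Hadamard's lemma along normals: \<rho> vanishes at the nearest point, and the
  fundamental theorem of calculus on the segment from there to \<open>z\<close> extracts the factor
  d(z). The remaining integral involves only the gradient of \<rho> and the normal field, both C^1,
  and can be differentiated under the integral sign.\<close>

lemma quotient_by_sdist: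
  assumes W: "C2_defining_function \<Omega> W \<rho>" "U \<subseteq> W"
  obtains V h where "boundary_nbhd \<Omega> V" "V \<subseteq> U" "Ck_on 1 h V" "\<And>z. z \<in> V \<Longrightarrow> h z > 0"
    "\<And>z. z \<in> V \<Longrightarrow> \<rho> z = d z * h z"
proof -
  note D = C2_defining_functionD[OF W(1) open_domain]
  have r: "Ck_on (Suc (Suc 0)) \<rho> W" by (rule D(3))
  \<comment> \<open>The normal segment, from the nearest point at t = 0 to \<open>z\<close> at t =
    1, written through \<open>d\<close> and \<nu>, whose derivatives are at hand.\<close>
  define x where "x z t = z - ((1 - t) * d z) *\<^sub>R \<nu> z" for z and t :: real
  define f where "f z t = grad \<rho> (x z t) \<bullet> \<nu> z" for z and t :: real
  define h where "h z = integral (cbox 0 1) (f z)" for z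
  have \<nu>1: "Ck_on 1 \<nu> U" using Ck_on_grad[of 1 d U] C2_sdist open_U by (simp add: numeral_2_eq_2)
  have \<rho>1: "Ck_on 1 (grad \<rho>) W" using Ck_on_grad[OF r D(1)] by simp
  have grd: "(grad \<rho> has_derivative \<D> (grad \<rho>) y) (at y)" if "y \<in> W" for y
    using Ck_on_has_derivative[of 0 "grad \<rho>" W y] \<rho>1 D(1) that by simp
  have contd: "continuous_on U d" and cont\<nu>: "continuous_on U \<nu>"
    by (rule Ck_on_imp_continuous_on, rule C2_sdist, rule Ck_on_imp_continuous_on, rule \<nu>1)
  \<comment> \<open>The whole segment has to stay in \<open>W\<close>; it moves \<open>z\<close> by
    at most |d(z)|, which is small near the boundary.\<close>
  have loc: "\<exists>e>0. ball p e \<subseteq> U \<and> (\<forall>z\<in>ball p e. \<forall>t\<in>{0..1}. x z t \<in> W)" if p: "p \<in> frontier \<Omega>" for p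
  proof -
    have pU: "p \<in> U" and pW: "p \<in> W" using p frontier_U W(2) by auto
    obtain e1 where e1: "e1 > 0" "ball p e1 \<subseteq> U" using open_U pU openE by blast
    have "isCont d p" using contd open_U pU by (simp add: continuous_on_eq_continuous_at)
    then obtain e2 where e2: "e2 > 0" "\<And>z. dist z p < e2 \<Longrightarrow> dist (d z) (d p) < e1 / 2"
      unfolding continuous_at_eps_delta using e1(1) by (meson half_gt_zero)
    have "x z t \<in> W" if z: "z \<in> ball p (min (e1 / 2) e2)" and t: "t \<in> {0..1}" for z t
    proof -
      have zU: "z \<in> U" using z e1 by auto
      have "\<bar>d z\<bar> < e1 / 2" using e2(2)[of z] z sdist_frontier[OF open_domain p] by (simp add: dist_commute dist_real_def)
      moreover have "\<bar>1 - t\<bar> * \<bar>d z\<bar> \<le> 1 * \<bar>d z\<bar>" using t by (intro mult_right_mono) auto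
      ultimately have "norm (x z t - z) < e1 / 2" using norm_grad[OF zU] by (simp add: x_def abs_mult)
      moreover have "dist p z < e1 / 2" using z by simp
      ultimately have "dist p (x z t) < e1" using dist_triangle[of p "x z t" z] by (simp add: dist_norm norm_minus_commute)
      then show ?thesis using e1(2) W(2) by auto
    qed
    moreover have "ball p (min (e1 / 2) e2) \<subseteq> U" using e1 by auto
    ultimately show ?thesis using e1(1) e2(1) by (intro exI[of _ "min (e1 / 2) e2"]) auto
  qed
  define F where "F z t v = \<D> (grad \<rho>) (x z t) (v - (1 - t) *\<^sub>R (d z *\<^sub>R H z v + (\<nu> z \<bullet> v) *\<^sub>R \<nu> z)) \<bullet> \<nu> z
      + grad \<rho> (x z t) \<bullet> H z v" for z v and t :: real
  have main: "Ck_on 1 h (ball p e) \<and> (\<forall>z\<in>ball p e. \<rho> z = d z * h z)"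
    if B: "ball p e \<subseteq> U" and xW: "\<And>z t. z \<in> ball p e \<Longrightarrow> t \<in> {0..1} \<Longrightarrow> x z t \<in> W" for p e
  proof -
    let ?B = "ball p e" and ?C = "ball p e \<times> cbox 0 (1::real)"
    have cfst: "continuous_on ?C (\<lambda>y. q (fst y))" if "continuous_on U q" for q :: "complex^'n \<Rightarrow> 'b::topological_space"
      by (rule continuous_on_compose2[OF that continuous_on_fst[OF continuous_on_id]]) (use B in auto)
    have contx: "continuous_on ?C (\<lambda>y. x (fst y) (snd y))"
      unfolding x_def by (intro continuous_intros cfst contd cont\<nu>)
    have xC: "(\<lambda>y. x (fst y) (snd y)) ` ?C \<subseteq> W" using xW by auto
    have cg: "continuous_on ?C (\<lambda>y. grad \<rho> (x (fst y) (snd y)))"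
      by (rule continuous_on_compose2[OF Ck_on_imp_continuous_on[OF \<rho>1] contx xC])
    have cf: "continuous_on ?C (\<lambda>(z, t). f z t)"
      unfolding f_def case_prod_beta by (intro continuous_intros cg cfst cont\<nu>)
    have fd: "((\<lambda>z. f z t) has_derivative F z t) (at z)" if z: "z \<in> ?B" and t: "t \<in> {0..1}" for z t
    proof -
      have zU: "z \<in> U" using z B by auto
      have xd: "((\<lambda>z. x z t) has_derivative (\<lambda>v. v - (1 - t) *\<^sub>R (d z *\<^sub>R H z v + (\<nu> z \<bullet> v) *\<^sub>R \<nu> z))) (at z)"
      proof -
        have "((\<lambda>z. z - (1 - t) *\<^sub>R (d z *\<^sub>R \<nu> z)) has_derivative (\<lambda>v. v - (1 - t) *\<^sub>R (d z *\<^sub>R H z v + (\<nu> z \<bullet> v) *\<^sub>R \<nu> z))) (at z)"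
          by (rule has_derivative_diff[OF has_derivative_ident has_derivative_scaleR_right[OF has_derivative_scaleR[OF sdist_deriv[OF zU] grad_deriv[OF zU]]]])
        then show ?thesis by (simp add: x_def)
      qed
      have "((\<lambda>z. grad \<rho> (x z t)) has_derivative (\<lambda>v. \<D> (grad \<rho>) (x z t) (v - (1 - t) *\<^sub>R (d z *\<^sub>R H z v + (\<nu> z \<bullet> v) *\<^sub>R \<nu> z)))) (at z)"
        by (rule has_derivative_compose[OF xd grd[OF xW[OF z t]]])
      from has_derivative_inner[OF this grad_deriv[OF zU]] show ?thesis
        unfolding f_def F_def by (simp add: add.commute)
    qed
    have bl: "bounded_linear (F z t)" if "z \<in> ?B" "t \<in> {0..1}" for z t
      by (rule has_derivative_bounded_linear[OF fd[OF that]])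
    \<comment> \<open>The Leibniz rule takes the derivative of the integrand as a bounded linear
      operator depending continuously on both variables; continuity is checked on basis
      directions.\<close>
    define L where "L z t = Blinfun (F z t)" for z t
    have L: "blinfun_apply (L z t) = F z t" if "z \<in> ?B" "t \<in> {0..1}" for z t
      unfolding L_def by (rule bounded_linear_Blinfun_apply[OF bl[OF that]])
    have cF: "continuous_on ?C (\<lambda>y. F (fst y) (snd y) v)" for v
    proof -
      have cH: "continuous_on U (\<lambda>z. H z v)" using \<nu>1 by simp
      have ex: "\<D> (grad \<rho>) (x (fst y) (snd y)) u
          = (\<Sum>b\<in>Basis. (u \<bullet> b) *\<^sub>R \<D> (grad \<rho>) (x (fst y) (snd y)) b)" if "y \<in> ?C" for y u
        using frechet_derivative_expand[OF grd] xC that by blast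
      have cb: "continuous_on ?C (\<lambda>y. \<D> (grad \<rho>) (x (fst y) (snd y)) b)" for b
        by (rule continuous_on_compose2[OF _ contx xC, of "\<lambda>y. \<D> (grad \<rho>) y b"]) (use \<rho>1 in simp)
      let ?u = "\<lambda>y. v - (1 - snd y) *\<^sub>R (d (fst y) *\<^sub>R H (fst y) v + (\<nu> (fst y) \<bullet> v) *\<^sub>R \<nu> (fst y))"
      have cu: "continuous_on ?C ?u" by (intro continuous_intros cfst contd cont\<nu> cH)
      have "continuous_on ?C (\<lambda>y. (\<Sum>b\<in>Basis. (?u y \<bullet> b) *\<^sub>R \<D> (grad \<rho>) (x (fst y) (snd y)) b) \<bullet> \<nu> (fst y)
          + grad \<rho> (x (fst y) (snd y)) \<bullet> H (fst y) v)"
        by (intro continuous_on_add continuous_on_inner continuous_on_sum continuous_on_scaleR continuous_on_const cu cb cfst cont\<nu> cH cg)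
      moreover have "(\<Sum>b\<in>Basis. (?u y \<bullet> b) *\<^sub>R \<D> (grad \<rho>) (x (fst y) (snd y)) b) \<bullet> \<nu> (fst y)
          + grad \<rho> (x (fst y) (snd y)) \<bullet> H (fst y) v = F (fst y) (snd y) v" if "y \<in> ?C" for y
        unfolding F_def ex[OF that, of "?u y"] ..
      ultimately show ?thesis by (rule continuous_on_eq)
    qed
    have cL: "continuous_on ?C (\<lambda>(z, t). L z t)"
    proof (rule continuous_on_blinfun_componentwise)
      fix i :: "complex^'n"
      show "continuous_on ?C (\<lambda>y. blinfun_apply (case y of (z, t) \<Rightarrow> L z t) i)"
        by (rule continuous_on_eq[OF cF[of i]]) (auto simp: L)
    qed
    have cfz: "continuous_on (cbox 0 1) (f z)" if z: "z \<in> ?B" for z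
    proof -
      have "continuous_on (cbox 0 1) (\<lambda>t. (\<lambda>(z, t). f z t) (z, t))"
        by (rule continuous_on_compose2[OF cf, of _ "Pair z"]) (use z in \<open>auto intro!: continuous_intros\<close>)
      then show ?thesis by simp
    qed
    have hd: "(h has_derivative blinfun_apply (integral (cbox 0 1) (L z))) (at z)" if z: "z \<in> ?B" for z
    proof -
      have "(h has_derivative blinfun_apply (integral (cbox 0 1) (L z))) (at z within ?B)"
        unfolding h_def
      proof (rule leibniz_rule[OF _ _ cL z convex_ball])
        show "((\<lambda>x. f x t) has_derivative blinfun_apply (L z t)) (at z within ?B)" if "z \<in> ?B" "t \<in> cbox 0 1" for z t
          using fd[of z t] that by (simp add: L has_derivative_at_withinI)
        show "f z integrable_on cbox 0 1" if "z \<in> ?B" for z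
          by (rule integrable_continuous[OF cfz[OF that]])
      qed
      then show ?thesis using at_within_open[OF z open_ball] by simp
    qed
    have ci: "continuous_on ?B (\<lambda>z. integral (cbox 0 1) (L z))" by (rule integral_continuous_on_param[OF cL])
    have "Ck_on (Suc 0) h ?B"
    proof (rule Ck_on_SucI[OF open_ball hd])
      show "Ck_on 0 (\<lambda>z. blinfun_apply (integral (cbox 0 1) (L z)) v) ?B" for v
        using ci by (auto intro!: continuous_intros)
    qed
    moreover have "\<rho> z = d z * h z" if z: "z \<in> ?B" for z
    proof -
      have zU: "z \<in> U" using z B by auto
      have "((\<lambda>t. \<rho> (x z t)) has_vector_derivative d z * f z t) (at t within {0..1})" if t: "t \<in> {0..1}" for t
      proof -
        have "((\<lambda>t. z - ((1 - t) * d z) *\<^sub>R \<nu> z) has_derivative (\<lambda>k. k *\<^sub>R (d z *\<^sub>R \<nu> z))) (at t)"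
          by (auto intro!: derivative_eq_intros simp: algebra_simps)
        then have xd: "(x z has_derivative (\<lambda>k. k *\<^sub>R (d z *\<^sub>R \<nu> z))) (at t)" unfolding x_def[abs_def] .
        have "((\<lambda>t. \<rho> (x z t)) has_derivative (\<lambda>k. grad \<rho> (x z t) \<bullet> (k *\<^sub>R (d z *\<^sub>R \<nu> z)))) (at t)"
          by (rule has_derivative_compose[OF xd has_derivative_grad[OF r D(1) xW[OF z t]]])
        then have "((\<lambda>t. \<rho> (x z t)) has_vector_derivative d z * f z t) (at t)"
          by (simp add: has_vector_derivative_def f_def mult_ac)
        then show ?thesis by (rule has_vector_derivative_at_within)
      qed
      from fundamental_theorem_of_calculus[OF _ this]
      have "((\<lambda>t. d z * f z t) has_integral \<rho> (x z 1) - \<rho> (x z 0)) {0..1}" by simp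
      moreover have "((\<lambda>t. d z * f z t) has_integral d z * h z) {0..1}"
        using integrable_continuous[OF cfz[OF z]] unfolding h_def
        by (intro has_integral_mult_right) (simp add: has_integral_integral)
      ultimately have "\<rho> (x z 1) - \<rho> (x z 0) = d z * h z" by (rule has_integral_unique)
      moreover have "x z 1 = z" by (simp add: x_def)
      moreover have "x z 0 = nearest \<Omega> z" using nearest_diff[OF zU] by (simp add: x_def algebra_simps)
      ultimately show ?thesis using D(6)[OF nearest_frontier[OF zU]] by simp
    qed
    ultimately show ?thesis by simp
  qed
  have "\<exists>e>0. ball p e \<subseteq> U \<and> Ck_on 1 h (ball p e) \<and> (\<forall>z\<in>ball p e. \<rho> z = d z * h z)" if p: "p \<in> frontier \<Omega>" for p
  proof -
    obtain e where e: "e > 0" "ball p e \<subseteq> U" "\<And>z t. z \<in> ball p e \<Longrightarrow> t \<in> {0..1} \<Longrightarrow> x z t \<in> W"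
      using loc[OF p] by blast
    from main[OF e(2,3)] e show ?thesis by blast
  qed
  then have "\<forall>p\<in>frontier \<Omega>. \<exists>e. e > 0 \<and> ball p e \<subseteq> U \<and> Ck_on 1 h (ball p e) \<and> (\<forall>z\<in>ball p e. \<rho> z = d z * h z)" by blast
  from bchoice[OF this] obtain e where
    e: "\<And>p. p \<in> frontier \<Omega> \<Longrightarrow> e p > 0 \<and> ball p (e p) \<subseteq> U \<and> Ck_on 1 h (ball p (e p)) \<and> (\<forall>z\<in>ball p (e p). \<rho> z = d z * h z)"
    by blast
  define V' where "V' = (\<Union>p\<in>frontier \<Omega>. ball p (e p))"
  have V': "open V'" "frontier \<Omega> \<subseteq> V'" "V' \<subseteq> U" "\<And>z. z \<in> V' \<Longrightarrow> \<rho> z = d z * h z"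
    using e unfolding V'_def by (auto simp: subset_iff) (metis centre_in_ball mem_ball)
  have hV': "Ck_on 1 h V'"
    by (rule Ck_on_local[OF V'(1)]) (use e in \<open>auto simp: V'_def\<close>)
  have hpos: "h p > 0" if p: "p \<in> frontier \<Omega>" for p
  proof -
    have pU: "p \<in> U" and pV: "p \<in> V'" and pW: "p \<in> W" using p V' W(2) by auto
    have conth: "isCont h p" using Ck_on_imp_continuous_on[OF hV'] V'(1) pV by (simp add: continuous_on_eq_continuous_at)
    have "((\<lambda>z. d z * h z) has_derivative (\<lambda>v. (\<nu> p \<bullet> v) * h p)) (at p)"
      by (rule has_derivative_mult_vanish[OF sdist_deriv[OF pU] sdist_frontier[OF open_domain p] conth])
    then have "(\<rho> has_derivative (\<lambda>v. (\<nu> p \<bullet> v) * h p)) (at p)"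
      by (rule has_derivative_transform_within_open[OF _ V'(1) pV]) (simp add: V'(4))
    from has_derivative_unique[OF this has_derivative_grad[OF r D(1) pW]]
    have eq: "(\<nu> p \<bullet> v) * h p = grad \<rho> p \<bullet> v" for v by (rule fun_cong)
    have "h p \<noteq> 0"
    proof
      assume "h p = 0"
      then have "grad \<rho> p \<bullet> grad \<rho> p = 0" using eq[of "grad \<rho> p"] by simp
      then show False using D(7)[OF p] by simp
    qed
    \<comment> \<open>A negative value would persist at nearby points of \<Omega>, where
      \<open>d\<close> and \<rho> are both negative although \<rho> is their product d h.\<close>
    moreover have "h p \<ge> 0"
    proof (rule ccontr)
      assume "\<not> h p \<ge> 0"
      then have "eventually (\<lambda>z. h z < 0) (nhds p)"
        using conth tendsto_at_iff_tendsto_nhds[of h p] by (auto simp: isCont_def intro: order_tendstoD(2))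
      then obtain S where S: "open S" "p \<in> S" "\<And>z. z \<in> S \<Longrightarrow> h z < 0" by (auto simp: eventually_nhds)
      have "p \<in> closure \<Omega>" using p by (simp add: frontier_def)
      then have "(S \<inter> V') \<inter> \<Omega> \<noteq> {}"
        using open_Int_closure_eq_empty[of "S \<inter> V'" \<Omega>] S V'(1) pV by blast
      then obtain z where z: "z \<in> S" "z \<in> V'" "z \<in> \<Omega>" by auto
      have "d z < 0" using sdist_inside[of z] z V'(3) by auto
      then have "\<rho> z > 0" using V'(4)[OF z(2)] S(3)[OF z(1)] by (simp add: mult_neg_neg)
      moreover have "\<rho> z < 0" using D(4)[of z] z V'(3) W(2) by auto
      ultimately show False by simp
    qed
    ultimately show ?thesis by simp
  qed
  show thesis
  proof (rule that[of "{z\<in>V'. h z > 0}" h])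
    have "{z\<in>V'. h z > 0} = V' \<inter> h -` {0<..}" by auto
    then have "open {z\<in>V'. h z > 0}"
      using continuous_open_preimage[OF Ck_on_imp_continuous_on[OF hV'] V'(1), of "{0<..}"] by auto
    then show "boundary_nbhd \<Omega> {z\<in>V'. h z > 0}" using V'(2) hpos by (auto simp: boundary_nbhd_def)
    show "Ck_on 1 h {z\<in>V'. h z > 0}" by (rule Ck_on_subset[OF hV']) auto
  qed (use V' in auto)
qed

end

section \<open>Passing between the two conditions\<close>

lemma derivatives_norm_sq:
  fixes z :: "'a::euclidean_space"
  shows "\<D> (\<lambda>y::'a. (norm y)\<^sup>2) z v = 2 * (z \<bullet> v)"
    and "\<D> (\<lambda>y. \<D> (\<lambda>y::'a. (norm y)\<^sup>2) y v) z w = 2 * (w \<bullet> v)"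
proof -
  have 1: "\<D> (\<lambda>y::'a. (norm y)\<^sup>2) y = (\<lambda>v. 2 * (y \<bullet> v))" for y
    by (rule frechet_derivative_eqI) (auto simp: power2_norm_eq_inner inner_commute intro!: derivative_eq_intros)
  show "\<D> (\<lambda>y::'a. (norm y)\<^sup>2) z v = 2 * (z \<bullet> v)" by (simp add: 1)
  have "\<D> (\<lambda>y::'a. 2 * (y \<bullet> v)) z = (\<lambda>w. 2 * (w \<bullet> v))"
    by (rule frechet_derivative_eqI) (auto intro!: derivative_eq_intros)
  then show "\<D> (\<lambda>y. \<D> (\<lambda>y::'a. (norm y)\<^sup>2) y v) z w = 2 * (w \<bullet> v)"
    by (simp add: 1)
qed

lemma Ck_on_norm_sq: "open S \<Longrightarrow> Ck_on k (\<lambda>y::'a::euclidean_space. (norm y)\<^sup>2) S"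
  unfolding power2_norm_eq_inner by (intro Ck_on_inner Ck_on_ident)

lemma derivatives_add_norm_sq:
  fixes f :: "'a::euclidean_space \<Rightarrow> real"
  assumes "Ck_on 2 f S" "open S" "z \<in> S"
  shows "\<D> (\<lambda>y. f y + c * (norm y)\<^sup>2) z v = \<D> f z v + 2 * c * (z \<bullet> v)"
    and "\<H> (\<lambda>y. f y + c * (norm y)\<^sup>2) z v w
      = \<H> f z v w + 2 * c * (w \<bullet> v)"
proof -
  note D = derivatives_lincomb[OF assms(1) Ck_on_norm_sq[OF assms(2)] assms(2,3)]
  show "\<D> (\<lambda>y. f y + c * (norm y)\<^sup>2) z v = \<D> f z v + 2 * c * (z \<bullet> v)"
    using D(1)[of 1 c v] by (simp add: derivatives_norm_sq(1))
  show "\<H> (\<lambda>y. f y + c * (norm y)\<^sup>2) z v w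
      = \<H> f z v w + 2 * c * (w \<bullet> v)"
    using D(2)[of 1 c v w] by (simp add: derivatives_norm_sq(2))
qed

lemma Ck_on_add_norm_sq: "Ck_on k f S \<Longrightarrow> open S \<Longrightarrow> Ck_on k (\<lambda>y. f y + c * (norm y)\<^sup>2) S"
  for f :: "'a::euclidean_space \<Rightarrow> real"
  by (intro Ck_on_add Ck_on_mult Ck_on_const Ck_on_norm_sq)

context tube
begin

lemma open_inside: "open (U \<inter> \<Omega>)"
  by (intro open_Int open_U open_domain)

text \<open>Translating the conditions into normal form uses only identities at one point, for which
  any constants will do; no uniformity is asked here.\<close>

lemma pointwise_normal_form:
  assumes z: "z \<in> U \<inter> \<Omega>" and \<psi>: "Ck_on 2 \<psi> (U \<inter> \<Omega>)"
  obtains L K where "normal_form_at \<psi> z L K"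
proof -
  have zU: "z \<in> U" "z \<in> \<Omega>" using z by auto
  have nU: "nearest \<Omega> z \<in> U" using nearest_frontier[OF zU(1)] frontier_U by auto
  define K where "K = (\<Sum>b\<in>Basis. norm (H z b)) + (\<Sum>b\<in>Basis. norm (H (nearest \<Omega> z) b))"
  have "norm (H z v) \<le> K * norm v" "norm (H (nearest \<Omega> z) v) \<le> K * norm v" for v
  proof -
    have le: "(\<Sum>b\<in>Basis. norm (H z b)) \<le> K" "(\<Sum>b\<in>Basis. norm (H (nearest \<Omega> z) b)) \<le> K"
      by (simp_all add: K_def sum_nonneg)
    show "norm (H z v) \<le> K * norm v"
      using linear_norm_le_sum[OF H_linear[OF zU(1)], of v] mult_right_mono[OF le(1) norm_ge_zero[of v]] by linarith
    show "norm (H (nearest \<Omega> z) v) \<le> K * norm v"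
      using linear_norm_le_sum[OF H_linear[OF nU], of v] mult_right_mono[OF le(2) norm_ge_zero[of v]] by linarith
  qed
  from boundary_normal_form[OF zU \<psi> open_inside z order_refl this] show thesis by (rule that)
qed

lemma tangential_condition_iff:
  assumes "Ck_on 2 \<phi> (U \<inter> \<Omega>)"
  shows "tangential_condition \<Omega> s N U \<phi> \<longleftrightarrow>
    (\<forall>z\<in>U \<inter> \<Omega>. \<forall>\<tau>. \<nu> z \<bullet> \<tau> = 0 \<and> \<nu> z \<bullet> rot \<tau> = 0 \<longrightarrow>
      2 * N * (norm \<tau>)\<^sup>2 + s / (1 - s) * R_form \<phi> z \<tau> \<le> T_form \<phi> z \<tau>)"
  unfolding tangential_condition_def
proof (intro ball_cong refl all_cong1)
  fix z \<tau> assume z: "z \<in> U \<inter> \<Omega>"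
  then have zU: "z \<in> U" "z \<in> \<Omega>" by auto
  obtain L K where bform: "normal_form_at \<phi> z L K" by (rule pointwise_normal_form[OF z assms])
  show "(del (sdistc \<Omega>) z (T10 \<tau>) = 0 \<longrightarrow>
          N * tan_norm_sq z \<tau> + s / (1 - s) *
            (cmod (del (\<lambda>w. complex_of_real (\<phi> w)) z (T10 \<tau>) - 2 * alpha \<Omega> (nearest \<Omega> z) (T10 \<tau>)))\<^sup>2
        \<le> levi \<phi> z \<tau> + inverse (- d z) * levi d (nearest \<Omega> z) \<tau> + 2 * Re (eval11 (beta \<Omega> (nearest \<Omega> z)) \<tau> \<tau>))
    \<longleftrightarrow> (\<nu> z \<bullet> \<tau> = 0 \<and> \<nu> z \<bullet> rot \<tau> = 0 \<longrightarrow>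
      2 * N * (norm \<tau>)\<^sup>2 + s / (1 - s) * R_form \<phi> z \<tau> \<le> T_form \<phi> z \<tau>)"
    unfolding del_sdist_iff[OF zU(1)] tangential_iff[OF zU assms open_inside z bform] R_form_def T_form_def ..
qed

text \<open>Division by the positive factor (-\<lambda>) \<eta>/4 from \<open>levi_lam\<close>; this
  is where \<open>M\<close> turns into M/\<eta>.\<close>

lemma hessian_iff:
  assumes z: "z \<in> U \<inter> \<Omega>" and \<psi>: "Ck_on 2 \<psi> (U \<inter> \<Omega>)"
    and \<rho>: "\<And>w. w \<in> U \<inter> \<Omega> \<Longrightarrow> \<rho> w = d w * exp (- \<psi> w)" and \<eta>: "\<eta> > 0"
  shows "levi (lam \<eta> \<rho>) z X \<ge> M * (- lam \<eta> \<rho> z) * tan_norm_sq z X \<longleftrightarrow> 2 * (M / \<eta>) * (norm X)\<^sup>2 \<le> Q_form \<psi> z \<eta> X"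
proof -
  have zU: "z \<in> U" "z \<in> \<Omega>" using z by auto
  obtain L K where "normal_form_at \<psi> z L K" by (rule pointwise_normal_form[OF z \<psi>])
  then have nform: "normal_form (\<nu> z) (H z) (\<H> \<psi> z) (\<D> \<psi> z)
    (- d z) (C2_size \<psi> z) L K" by (rule boundary_normal_form.axioms)
  have lev: "levi (lam \<eta> \<rho>) z X = (- lam \<eta> \<rho> z) * \<eta> / 4 * Q_form \<psi> z \<eta> X"
    unfolding Q_form_def by (rule levi_lam(1)[OF zU \<psi> open_inside z _ nform]) (rule \<rho>)
  have pos: "- lam \<eta> \<rho> z > 0"
    by (rule levi_lam(2)[OF zU \<psi> open_inside z _ nform]) (rule \<rho>)
  define c where "c = (- lam \<eta> \<rho> z) * \<eta> / 4"
  have c: "c > 0" unfolding c_def by (intro divide_pos_pos mult_pos_pos pos \<eta>) simp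
  have e1: "M * (- lam \<eta> \<rho> z) * tan_norm_sq z X = c * (2 * (M / \<eta>) * (norm X)\<^sup>2)"
    using \<eta> by (simp add: c_def tan_norm_sq_norm)
  have e2: "levi (lam \<eta> \<rho>) z X = c * Q_form \<psi> z \<eta> X" unfolding lev c_def ..
  show ?thesis unfolding e1 e2 using c by (simp only: mult_le_cancel_left_pos)
qed

text \<open>The added term shifts the derivatives inside the square linearly in \<open>z\<close>.
  Its Hessian is 2c times the identity, which evaluated on \<tau> and \<open>rot \<tau>\<close> adds
  4c |\<tau>|^2, so \<open>quadratic_gain\<close> applies.\<close>

lemma T_form_add_norm_sq:
  assumes z: "z \<in> U \<inter> \<Omega>" and \<psi>: "Ck_on 2 \<psi> (U \<inter> \<Omega>)"
    and k: "0 < k" "k < k'" "\<kappa> = 1 / k - 1 / k'" and r: "0 < r" "norm z \<le> r"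
    and le: "2 * N * (norm \<tau>)\<^sup>2 + k' * R_form \<psi> z \<tau> \<le> T_form \<psi> z \<tau>"
  shows "2 * (N + \<kappa> / (2 * r\<^sup>2)) * (norm \<tau>)\<^sup>2 + k * R_form (\<lambda>y. \<psi> y + \<kappa> / (2 * r\<^sup>2) * (norm y)\<^sup>2) z \<tau>
    \<le> T_form (\<lambda>y. \<psi> y + \<kappa> / (2 * r\<^sup>2) * (norm y)\<^sup>2) z \<tau>"
proof -
  define c where "c = \<kappa> / (2 * r\<^sup>2)"
  let ?\<phi> = "\<lambda>y. \<psi> y + c * (norm y)\<^sup>2"
  obtain L K where 1: "normal_form_at \<psi> z L K" by (rule pointwise_normal_form[OF z \<psi>])
  obtain L' K' where 2: "normal_form_at ?\<phi> z L' K'"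
    by (rule pointwise_normal_form[OF z Ck_on_add_norm_sq[OF \<psi> open_inside]])
  note D = derivatives_add_norm_sq[OF \<psi> open_inside z, of c]
  define p where "p = \<D> \<psi> z \<tau> - rot (\<nu> z) \<bullet> H (nearest \<Omega> z) (rot \<tau>)"
  define q where "q = \<D> \<psi> z (rot \<tau>) + rot (\<nu> z) \<bullet> H (nearest \<Omega> z) \<tau>"
  have R1: "R_form \<psi> z \<tau> = p\<^sup>2 + q\<^sup>2"
    unfolding R_form_def boundary_normal_form.R0_def[OF 1] p_def q_def ..
  have R2: "R_form ?\<phi> z \<tau> = (p + 2 * c * (z \<bullet> \<tau>))\<^sup>2 + (q + 2 * c * (z \<bullet> rot \<tau>))\<^sup>2"
    unfolding R_form_def boundary_normal_form.R0_def[OF 2] p_def q_def D by (simp add: algebra_simps)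
  have T2: "T_form ?\<phi> z \<tau> = T_form \<psi> z \<tau> + 4 * c * (norm \<tau>)\<^sup>2"
    unfolding T_form_def boundary_normal_form.T0_def[OF 1] boundary_normal_form.T0_def[OF 2] D
    by (simp add: power2_norm_eq_inner)
  from quadratic_gain[OF k r c_def le[unfolded R1]]
  show ?thesis unfolding c_def[symmetric] R2 T2 .
qed

section \<open>Stability of the vanishing Hessian condition\<close>

lemma small_imp_vanishing_hessian:
  assumes \<phi>: "Ck_on 2 \<phi> (U \<inter> \<Omega>)" and small: "small_hessian \<phi>"
  shows "vanishing_hessian \<phi> (U \<inter> \<Omega>)"
  unfolding vanishing_hessian_def
proof (intro ballI allI)
  fix p v w :: "complex^'n" assume p: "p \<in> frontier \<Omega>"
  have "((\<lambda>z. - d z * C2_size \<phi> z) \<longlongrightarrow> 0) (at p within U \<inter> \<Omega>)"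
  proof (rule tendstoI)
    fix e :: real assume "e > 0"
    then obtain V where V: "boundary_nbhd \<Omega> V" "\<And>z. z \<in> V \<inter> U \<inter> \<Omega> \<Longrightarrow> - d z * C2_size \<phi> z \<le> e / 2"
      using small unfolding small_hessian_def by (meson half_gt_zero)
    have "eventually (\<lambda>z. z \<in> V) (nhds p)" using V(1) p by (intro eventually_nhds_in_open) (auto simp: boundary_nbhd_def)
    then show "eventually (\<lambda>z. dist (- d z * C2_size \<phi> z) 0 < e) (at p within U \<inter> \<Omega>)"
      unfolding eventually_at_filter
    proof eventually_elim
      case (elim z)
      show ?case
      proof (intro impI)
        assume z: "z \<in> U \<inter> \<Omega>"
        have "0 \<le> - d z * C2_size \<phi> z"
          using sdist_inside[of z] z C2_size_nonneg[of \<phi> z] by (intro mult_nonneg_nonneg) auto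
        then show "dist (- d z * C2_size \<phi> z) 0 < e" using V(2)[of z] z elim \<open>e > 0\<close> by (simp add: dist_real_def)
      qed
    qed
  qed
  then have "((\<lambda>z. - d z * C2_size \<phi> z * (norm v * norm w)) \<longlongrightarrow> 0) (at p within U \<inter> \<Omega>)"
    by (rule tendsto_mult_left_zero)
  then show "((\<lambda>z. d z * \<H> \<phi> z v w) \<longlongrightarrow> 0) (at p within U \<inter> \<Omega>)"
  proof (rule Lim_null_comparison[rotated])
    show "eventually (\<lambda>z. norm (d z * \<H> \<phi> z v w)
      \<le> - d z * C2_size \<phi> z * (norm v * norm w)) (at p within U \<inter> \<Omega>)"
      unfolding eventually_at_filter
    proof (intro always_eventually allI impI)
      fix z assume z: "z \<in> U \<inter> \<Omega>"
      interpret C2_at \<phi> "U \<inter> \<Omega>" z by unfold_locales (use \<phi> open_inside z in auto)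
      have "d z < 0" using sdist_inside[of z] z by auto
      then have "norm (d z * D2 v w) = - d z * \<bar>D2 v w\<bar>" by (simp add: abs_mult)
      also have "\<dots> \<le> - d z * (C2_size \<phi> z * (norm v * norm w))"
        using \<open>d z < 0\<close> by (intro mult_left_mono D2_bound) auto
      finally show "norm (d z * D2 v w) \<le> - d z * C2_size \<phi> z * (norm v * norm w)" by (simp add: mult.assoc)
    qed
  qed
qed

lemma vanishing_imp_small_hessian:
  assumes "vanishing_hessian \<phi> (U \<inter> \<Omega>)"
  shows "small_hessian \<phi>"
  unfolding small_hessian_def
proof (intro allI impI)
  fix e :: real assume e: "e > 0"
  have "\<exists>S. open S \<and> p \<in> S \<and> (\<forall>z\<in>S \<inter> (U \<inter> \<Omega>). - d z * C2_size \<phi> z \<le> e)" if p: "p \<in> frontier \<Omega>" for p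
  proof -
    let ?D = "\<lambda>b c z. \<H> \<phi> z b c"
    have "((\<lambda>z. \<Sum>b\<in>Basis. \<Sum>c\<in>Basis. \<bar>d z * ?D b c z\<bar>) \<longlongrightarrow> (\<Sum>b\<in>(Basis::(complex^'n) set). \<Sum>c\<in>(Basis::(complex^'n) set). \<bar>0\<bar>)) (at p within U \<inter> \<Omega>)"
      using assms p unfolding vanishing_hessian_def by (intro tendsto_sum tendsto_rabs) blast
    then have "eventually (\<lambda>z. (\<Sum>b\<in>Basis. \<Sum>c\<in>Basis. \<bar>d z * ?D b c z\<bar>) < e) (at p within U \<inter> \<Omega>)"
      by (rule order_tendstoD(2)) (use e in simp)
    then obtain S where S: "open S" "p \<in> S" "\<And>z. z \<in> S \<Longrightarrow> z \<noteq> p \<Longrightarrow> z \<in> U \<inter> \<Omega> \<Longrightarrow> (\<Sum>b\<in>Basis. \<Sum>c\<in>Basis. \<bar>d z * ?D b c z\<bar>) < e"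
      unfolding eventually_at_topological by blast
    have "- d z * C2_size \<phi> z \<le> e" if z: "z \<in> S \<inter> (U \<inter> \<Omega>)" for z
    proof -
      have "z \<noteq> p" using frontier_open_disjoint[OF open_domain p] z by auto
      moreover have "- d z * C2_size \<phi> z = (\<Sum>b\<in>Basis. \<Sum>c\<in>Basis. \<bar>d z * ?D b c z\<bar>)"
        using sdist_inside[of z] z by (simp add: C2_size_def abs_mult sum_distrib_left)
      ultimately show ?thesis using S(3)[of z] z by auto
    qed
    then show ?thesis using S by blast
  qed
  then have "\<forall>p\<in>frontier \<Omega>. \<exists>S. open S \<and> p \<in> S \<and> (\<forall>z\<in>S \<inter> (U \<inter> \<Omega>). - d z * C2_size \<phi> z \<le> e)" by blast
  from bchoice[OF this] obtain S where
    S: "\<And>p. p \<in> frontier \<Omega> \<Longrightarrow> open (S p) \<and> p \<in> S p \<and> (\<forall>z\<in>S p \<inter> (U \<inter> \<Omega>). - d z * C2_size \<phi> z \<le> e)" by blast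
  have "boundary_nbhd \<Omega> (\<Union>p\<in>frontier \<Omega>. S p)" using S unfolding boundary_nbhd_def by blast
  moreover have "\<forall>z\<in>(\<Union>p\<in>frontier \<Omega>. S p) \<inter> U \<inter> \<Omega>. - d z * C2_size \<phi> z \<le> e" using S by blast
  ultimately show "\<exists>V. boundary_nbhd \<Omega> V \<and> (\<forall>z\<in>V \<inter> U \<inter> \<Omega>. - d z * C2_size \<phi> z \<le> e)" by blast
qed

lemma tendsto_sdist: "p \<in> frontier \<Omega> \<Longrightarrow> (d \<longlongrightarrow> 0) (at p within A)"
proof -
  assume p: "p \<in> frontier \<Omega>"
  then have "p \<in> U" using frontier_U by auto
  then have "isCont d p" by (intro has_derivative_continuous[OF sdist_deriv])
  then show ?thesis using sdist_frontier[OF open_domain p] by (auto simp: isCont_def intro: tendsto_within_subset)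
qed

lemma tendsto_frontier_within:
  assumes "continuous_on U f" "p \<in> frontier \<Omega>"
  shows "(f \<longlongrightarrow> f p) (at p within A)"
proof -
  have "p \<in> U" using frontier_U assms(2) by auto
  then have "isCont f p" using assms(1) open_U by (simp add: continuous_on_eq_continuous_at)
  then show ?thesis unfolding isCont_def by (rule tendsto_within_subset) simp
qed

lemma vanishing_hessian_add_norm_sq:
  assumes \<phi>: "Ck_on 2 \<phi> (U \<inter> \<Omega>)" and van: "vanishing_hessian \<phi> (U \<inter> \<Omega>)"
  shows "vanishing_hessian (\<lambda>y. \<phi> y + c * (norm y)\<^sup>2) (U \<inter> \<Omega>)"
  unfolding vanishing_hessian_def
proof (intro ballI allI)
  fix p v w :: "complex^'n" assume p: "p \<in> frontier \<Omega>"
  let ?D = "\<lambda>z. \<H> \<phi> z v w"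
  have "((\<lambda>z. d z * ?D z + d z * (2 * c * (w \<bullet> v))) \<longlongrightarrow> 0 + 0 * (2 * c * (w \<bullet> v))) (at p within U \<inter> \<Omega>)"
    using van p unfolding vanishing_hessian_def by (intro tendsto_intros tendsto_sdist) auto
  then have lim: "((\<lambda>z. d z * ?D z + d z * (2 * c * (w \<bullet> v))) \<longlongrightarrow> 0) (at p within U \<inter> \<Omega>)" by simp
  show "((\<lambda>z. d z * \<H> (\<lambda>y. \<phi> y + c * (norm y)\<^sup>2) z v w) \<longlongrightarrow> 0) (at p within U \<inter> \<Omega>)"
    by (rule Lim_transform_eventually[OF lim], unfold eventually_at_filter, intro always_eventually allI impI)
      (simp add: derivatives_add_norm_sq(2)[OF \<phi> open_inside] distrib_left)
qed

text \<open>The second derivatives are F'(h) h'' + F''(h) h' h'. The first term vanishes at the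
  boundary after multiplication by \<open>d\<close>, by assumption; in the second all factors are
  bounded there. Used with the logarithm and the exponential to pass between \<psi> and the
  quotient.\<close>

lemma vanishing_hessian_compose:
  fixes F F1 F2 :: "real \<Rightarrow> real"
  assumes h: "Ck_on 1 h U" "Ck_on 2 h (U \<inter> \<Omega>)" "vanishing_hessian h (U \<inter> \<Omega>)"
    and F: "\<And>x. x \<in> T \<Longrightarrow> (F has_real_derivative F1 x) (at x)" "\<And>x. x \<in> T \<Longrightarrow> (F1 has_real_derivative F2 x) (at x)"
    and cont: "continuous_on T F2" and hT: "\<And>z. z \<in> U \<Longrightarrow> h z \<in> T"
  shows "vanishing_hessian (\<lambda>z. F (h z)) (U \<inter> \<Omega>)"
  unfolding vanishing_hessian_def
proof (intro ballI allI)
  fix p v w :: "complex^'n" assume p: "p \<in> frontier \<Omega>"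
  let ?V = "U \<inter> \<Omega>" and ?D = "\<lambda>z. \<D> h z"
  let ?D2 = "\<lambda>z. \<H> h z v w"
  have C: "Ck_on (Suc (Suc 0)) h ?V" using h(2) by (simp only: numeral_2_eq_2)
  have d1: "\<D> (\<lambda>z. F (h z)) z v = F1 (h z) * ?D z v" if z: "z \<in> ?V" for z v
  proof -
    have "((\<lambda>z. F (h z)) has_derivative (\<lambda>v. F1 (h z) * ?D z v)) (at z)"
      by (rule has_derivative_compose[OF Ck_on_has_derivative[OF C open_inside z]])
        (use F(1)[OF hT, of z] z in \<open>simp add: has_field_derivative_def\<close>)
    from frechet_derivative_eqI[OF this] show ?thesis by simp
  qed
  have d2: "\<H> (\<lambda>z. F (h z)) z v w
      = F1 (h z) * ?D2 z + F2 (h z) * ?D z w * ?D z v" if z: "z \<in> ?V" for z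
  proof -
    have "((\<lambda>z. F1 (h z)) has_derivative (\<lambda>w. F2 (h z) * ?D z w)) (at z)"
      by (rule has_derivative_compose[OF Ck_on_has_derivative[OF C open_inside z]])
        (use F(2)[OF hT, of z] z in \<open>simp add: has_field_derivative_def\<close>)
    moreover have "((\<lambda>y. ?D y v) has_derivative \<D> (\<lambda>y. ?D y v) z) (at z)"
      by (rule Ck_on_has_derivative[of 0, OF _ open_inside z]) (use C in simp)
    ultimately have "((\<lambda>y. F1 (h y) * ?D y v) has_derivative (\<lambda>w. F1 (h z) * \<D> (\<lambda>y. ?D y v) z w + F2 (h z) * ?D z w * ?D z v)) (at z)"
      by (rule has_derivative_mult)
    moreover have "\<H> (\<lambda>z. F (h z)) z v
        = \<D> (\<lambda>y. F1 (h y) * ?D y v) z"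
      by (rule frechet_derivative_cong_open[OF open_inside z]) (rule d1)
    ultimately show ?thesis by (simp add: frechet_derivative_eqI)
  qed
  have Dcont: "continuous_on U (\<lambda>z. ?D z v)" for v using h(1) by simp
  have ch: "continuous_on U h" by (rule Ck_on_imp_continuous_on[OF h(1)])
  have F1c: "continuous_on T F1"
    using F(2) by (meson DERIV_continuous_on has_field_derivative_at_within)
  have c12: "continuous_on U (\<lambda>z. F1 (h z))" "continuous_on U (\<lambda>z. F2 (h z))"
    by (rule continuous_on_compose2[OF F1c ch], use hT in auto)
      (rule continuous_on_compose2[OF cont ch], use hT in auto)
  have "((\<lambda>z. F1 (h z) * (d z * ?D2 z) + d z * (F2 (h z) * ?D z w * ?D z v))
      \<longlongrightarrow> F1 (h p) * 0 + 0 * (F2 (h p) * ?D p w * ?D p v)) (at p within ?V)"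
    using h(3) p unfolding vanishing_hessian_def
    by (intro tendsto_add tendsto_mult tendsto_sdist tendsto_frontier_within[OF c12(1)]
        tendsto_frontier_within[OF c12(2)] tendsto_frontier_within[OF Dcont]) auto
  then have lim: "((\<lambda>z. F1 (h z) * (d z * ?D2 z) + d z * (F2 (h z) * ?D z w * ?D z v)) \<longlongrightarrow> 0) (at p within ?V)" by simp
  show "((\<lambda>z. d z * \<H> (\<lambda>z. F (h z)) z v w) \<longlongrightarrow> 0) (at p within ?V)"
    by (rule Lim_transform_eventually[OF lim], unfold eventually_at_filter, intro always_eventually allI impI)
      (simp add: d2 algebra_simps)
qed

text \<open>Solving the product rule for \<rho> = d h, the product of \<open>d\<close> with a second
  derivative of \<open>h\<close> equals \<open>E\<close>, which is continuous across the boundary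
  because it contains no second derivative of \<open>h\<close>. At the boundary \<open>E\<close> is
  0.\<close>

lemma quotient_C2:
  assumes W: "C2_defining_function \<Omega> W \<rho>" "U \<subseteq> W" and h: "Ck_on 1 h U" "\<And>z. z \<in> U \<Longrightarrow> \<rho> z = d z * h z"
  shows "Ck_on 2 h (U - frontier \<Omega>)" "vanishing_hessian h (U \<inter> \<Omega>)"
proof -
  note D = C2_defining_functionD[OF W(1) open_domain]
  have o: "open (U - frontier \<Omega>)" using open_U by (auto simp: open_Diff)
  have \<rho>2: "Ck_on 2 \<rho> U" using Ck_on_subset[OF D(3) W(2)] by (simp add: numeral_2_eq_2)
  have \<rho>C: "Ck_on 2 \<rho> (U - frontier \<Omega>)" and dC: "Ck_on 2 d (U - frontier \<Omega>)"
    by (rule Ck_on_subset[OF \<rho>2], simp, rule Ck_on_subset[OF C2_sdist], simp)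
  have nz: "d z \<noteq> 0" if "z \<in> U - frontier \<Omega>" for z using sdist_eq_0_iff[of z] that by auto
  have dd: "d z * d z > 0" if "z \<in> U - frontier \<Omega>" for z
    using nz[OF that] not_real_square_gt_zero by blast
  \<comment> \<open>The quotient is written with 1/d^2, since smoothness of \<open>inverse\<close>
    is available on positive reals and \<open>d\<close> takes both signs.\<close>
  have "Ck_on 2 (\<lambda>z. inverse (d z * d z)) (U - frontier \<Omega>)"
    by (rule Ck_on_compose[OF Ck_on_inverse_real Ck_on_mult[OF dC dC o] _ o]) (use dd in auto)
  then have "Ck_on 2 (\<lambda>z. \<rho> z * d z * inverse (d z * d z)) (U - frontier \<Omega>)"
    by (intro Ck_on_mult \<rho>C dC o)
  moreover have "\<rho> z * d z * inverse (d z * d z) = h z" if "z \<in> U - frontier \<Omega>" for z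
    using nz[OF that] h(2)[of z] that by (simp add: field_simps)
  ultimately show hC: "Ck_on 2 h (U - frontier \<Omega>)" by (rule Ck_on_transfer[OF o])
  have \<rho>C2: "Ck_on (Suc (Suc 0)) \<rho> U" using \<rho>2 by (simp only: numeral_2_eq_2)
  have h1: "Ck_on (Suc 0) h U" using h(1) by simp
  let ?h = "\<lambda>z. \<D> h z"
  have Dh: "continuous_on U (\<lambda>z. ?h z v)" for v using h1 by simp
  have d1: "\<D> \<rho> z v = d z * ?h z v + (\<nu> z \<bullet> v) * h z" if z: "z \<in> U" for z v
  proof -
    have "((\<lambda>z. d z * h z) has_derivative (\<lambda>v. d z * ?h z v + (\<nu> z \<bullet> v) * h z)) (at z)"
      by (rule has_derivative_mult[OF sdist_deriv[OF z] Ck_on_has_derivative[OF h1 open_U z]])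
    from frechet_derivative_eqI[OF this] frechet_derivative_cong_open[OF open_U z h(2)]
    show ?thesis by simp
  qed
  define E where "E v w z = \<H> \<rho> z v w - (\<nu> z \<bullet> w) * ?h z v
      - (\<nu> z \<bullet> v) * ?h z w - (H z w \<bullet> v) * h z" for v w z
  have rest: "((\<lambda>z. (\<nu> z \<bullet> v) * h z) has_derivative (\<lambda>w. (\<nu> z \<bullet> v) * ?h z w + (H z w \<bullet> v) * h z)) (at z)"
    if z: "z \<in> U" for z v
    by (rule has_derivative_mult[OF has_derivative_inner_left[OF grad_deriv[OF z]] Ck_on_has_derivative[OF h1 open_U z]])
  \<comment> \<open>At a boundary point \<open>has_derivative_mult_vanish\<close> yields the second
    derivative of \<rho> without any second derivative of \<open>h\<close>; comparison with the
    definition of \<open>E\<close> leaves 0.\<close>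
  have E0: "E v w p = 0" if p: "p \<in> frontier \<Omega>" for v w p
  proof -
    have pU: "p \<in> U" using p frontier_U by auto
    have "isCont (\<lambda>z. ?h z v) p" using Dh[of v] open_U pU by (simp add: continuous_on_eq_continuous_at)
    from has_derivative_add[OF has_derivative_mult_vanish[OF sdist_deriv[OF pU] sdist_frontier[OF open_domain p] this] rest[OF pU, of v]]
    have "((\<lambda>z. d z * ?h z v + (\<nu> z \<bullet> v) * h z) has_derivative
        (\<lambda>w. (\<nu> p \<bullet> w) * ?h p v + ((\<nu> p \<bullet> v) * ?h p w + (H p w \<bullet> v) * h p))) (at p)" .
    moreover have "\<H> \<rho> p v
        = \<D> (\<lambda>y. d y * ?h y v + (\<nu> y \<bullet> v) * h y) p"
        by (rule frechet_derivative_cong_open[OF open_U pU]) (rule d1)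
      ultimately
    show ?thesis by (simp add: E_def frechet_derivative_eqI)
  qed
  have \<nu>1: "Ck_on (Suc 0) \<nu> U" using Ck_on_grad[of 1 d U] C2_sdist open_U by (simp add: numeral_2_eq_2)
  have Ec: "continuous_on U (E v w)" for v w
  proof -
    have "continuous_on U (\<lambda>z. H z w)" using \<nu>1 by simp
    moreover have "continuous_on U (\<lambda>z. \<H> \<rho> z v w)" using \<rho>C2 by simp
    ultimately show ?thesis
      unfolding E_def[abs_def]
      by (intro continuous_intros Dh Ck_on_imp_continuous_on[OF h1] Ck_on_imp_continuous_on[OF \<nu>1])
  qed
  show "vanishing_hessian h (U \<inter> \<Omega>)"
    unfolding vanishing_hessian_def
  proof (intro ballI allI)
    fix p v w :: "complex^'n" assume p: "p \<in> frontier \<Omega>"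
    have lim: "(E v w \<longlongrightarrow> 0) (at p within U \<inter> \<Omega>)"
      using tendsto_frontier_within[OF Ec p] E0[OF p] by metis
    show "((\<lambda>z. d z * \<D> (\<lambda>y. ?h y v) z w) \<longlongrightarrow> 0) (at p within U \<inter> \<Omega>)"
    proof (rule Lim_transform_eventually[OF lim], unfold eventually_at_filter, intro always_eventually allI impI)
      fix z assume z: "z \<in> U \<inter> \<Omega>"
      have zf: "z \<in> U - frontier \<Omega>" using z frontier_open_disjoint[OF open_domain] by auto
      have zU: "z \<in> U" using z by auto
      have "((\<lambda>y. ?h y v) has_derivative \<D> (\<lambda>y. ?h y v) z) (at z)"
        by (rule Ck_on_has_derivative[of 0, OF _ o zf]) (use hC in \<open>simp add: numeral_2_eq_2\<close>)
      from has_derivative_add[OF has_derivative_mult[OF sdist_deriv[OF zU] this] rest[OF zU, of v]]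
      have "((\<lambda>z. d z * ?h z v + (\<nu> z \<bullet> v) * h z) has_derivative
        (\<lambda>w. d z * \<D> (\<lambda>y. ?h y v) z w + (\<nu> z \<bullet> w) * ?h z v + ((\<nu> z \<bullet> v) * ?h z w + (H z w \<bullet> v) * h z))) (at z)" .
      moreover have "\<H> \<rho> z v
        = \<D> (\<lambda>y. d y * ?h y v + (\<nu> y \<bullet> v) * h y) z"
        by (rule frechet_derivative_cong_open[OF open_U zU]) (rule d1)
      ultimately
      show "E v w z = d z * \<D> (\<lambda>y. ?h y v) z w"
        by (simp add: E_def frechet_derivative_eqI)
    qed
  qed
qed

end

section \<open>Assembling the two directions\<close>

lemma convexity_quotient_diff: "s \<noteq> 0 \<Longrightarrow> \<eta> \<noteq> 0 \<Longrightarrow> 1 / (s / (1 - s)) - 1 / (\<eta> / (1 - \<eta>)) = 1 / s - 1 / \<eta>" for s \<eta> :: real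
  by (simp add: diff_divide_distrib)

lemma convexity_quotient_less: "0 < s \<Longrightarrow> s < \<eta> \<Longrightarrow> \<eta> < 1 \<Longrightarrow> s / (1 - s) < \<eta> / (1 - \<eta>)" for s \<eta> :: real
  by (intro frac_less) auto

text \<open>The growth condition also involves the function and its first derivatives; shrinking the
  neighborhood bounds both by continuity, and the Hessian part is the uniform form of the
  assumption.\<close>

lemma (in tube) small_C2_growth_near:
  assumes bd: "bounded \<Omega>" and ne: "frontier \<Omega> \<noteq> {}"
    and \<phi>: "Ck_on 1 \<phi> U" "vanishing_hessian \<phi> (U \<inter> \<Omega>)"
  obtains V where "boundary_nbhd \<Omega> V" "V \<subseteq> U" "small_C2_growth \<Omega> V \<phi>"
proof -
  have small: "small_hessian \<phi>" by (rule vanishing_imp_small_hessian[OF \<phi>(2)])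
  have "continuous_on U (\<lambda>z. \<bar>\<phi> z\<bar>)" by (intro continuous_intros Ck_on_imp_continuous_on[OF \<phi>(1)])
  from boundary_nbhd_bounded[OF nbhd this bd] obtain C0 where C0: "C0 \<ge> 0" "boundary_nbhd \<Omega> {z\<in>U. \<bar>\<phi> z\<bar> < C0}" by blast
  have "continuous_on U (C1_size \<phi>)"
    unfolding C1_size_def[abs_def] by (intro continuous_on_sum continuous_on_rabs) (use \<phi>(1) in auto)
  from boundary_nbhd_bounded[OF nbhd this bd] obtain C1 where C1: "C1 \<ge> 0" "boundary_nbhd \<Omega> {z\<in>U. C1_size \<phi> z < C1}" by blast
  obtain V1 where V1: "boundary_nbhd \<Omega> V1" "\<And>z. z \<in> V1 \<inter> U \<inter> \<Omega> \<Longrightarrow> - d z * C2_size \<phi> z \<le> 1"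
    using small[unfolded small_hessian_def] zero_less_one by blast
  define V where "V = {z\<in>U. \<bar>\<phi> z\<bar> < C0} \<inter> {z\<in>U. C1_size \<phi> z < C1} \<inter> V1"
  define C where "C = max 1 (max C0 C1)"
  have "small_C2_growth \<Omega> V \<phi>"
  proof (rule small_C2_growthI[where C = C])
    show "0 \<le> C" by (simp add: C_def)
    fix z assume z: "z \<in> \<Omega> \<inter> V"
    show "\<bar>\<phi> z\<bar> \<le> C" "C1_size \<phi> z \<le> C" using z by (auto simp: V_def C_def)
    have "z \<in> V1 \<inter> U \<inter> \<Omega>" using z by (auto simp: V_def)
    from V1(2)[OF this] have "bdist \<Omega> z * C2_size \<phi> z \<le> 1" using z by (simp add: bdist_inside)
    also have "1 \<le> C" by (simp add: C_def)
    finally show "bdist \<Omega> z * C2_size \<phi> z \<le> C" .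
  next
    fix e :: real assume "e > 0"
    then obtain V2 where V2: "boundary_nbhd \<Omega> V2" "\<And>z. z \<in> V2 \<inter> U \<inter> \<Omega> \<Longrightarrow> - d z * C2_size \<phi> z \<le> e"
      using small[unfolded small_hessian_def] by blast
    obtain t where t: "t > 0" "\<And>z. bdist \<Omega> z < t \<Longrightarrow> z \<in> V2"
      using boundary_nbhd_bdist[OF V2(1) bd ne] by blast
    have "bdist \<Omega> z * C2_size \<phi> z \<le> e" if z: "z \<in> \<Omega> \<inter> V" "bdist \<Omega> z < t" for z
    proof -
      have "z \<in> V2 \<inter> U \<inter> \<Omega>" using t(2)[OF z(2)] z(1) by (auto simp: V_def)
      from V2(2)[OF this] show ?thesis using z by (simp add: bdist_inside)
    qed
    then show "\<exists>t>0. \<forall>z\<in>\<Omega> \<inter> V. bdist \<Omega> z < t \<longrightarrow> bdist \<Omega> z * C2_size \<phi> z \<le> e" using t(1) by blast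
  qed
  moreover have "boundary_nbhd \<Omega> V" unfolding V_def by (intro boundary_nbhd_Int C0 C1 V1)
  moreover have "V \<subseteq> U" by (auto simp: V_def)
  ultimately show thesis using that by blast
qed

lemma small_C2_growth_subset:
  assumes "small_C2_growth \<Omega> U \<phi>" "V \<subseteq> U"
  shows "small_C2_growth \<Omega> V \<phi>"
proof -
  have "C2_norm \<phi> {z \<in> \<Omega> \<inter> V. bdist \<Omega> z > \<epsilon>} \<le> C2_norm \<phi> {z \<in> \<Omega> \<inter> U. bdist \<Omega> z > \<epsilon>}" for \<epsilon>
    unfolding C2_norm_def using assms(2) by (intro add_mono sum_mono SUP_subset_mono) auto
  then have le: "ennreal \<epsilon> * C2_norm \<phi> {z \<in> \<Omega> \<inter> V. bdist \<Omega> z > \<epsilon>}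
      \<le> ennreal \<epsilon> * C2_norm \<phi> {z \<in> \<Omega> \<inter> U. bdist \<Omega> z > \<epsilon>}" for \<epsilon>
    by (rule mult_left_mono) simp
  have lim: "((\<lambda>\<epsilon>. ennreal \<epsilon> * C2_norm \<phi> {z \<in> \<Omega> \<inter> U. bdist \<Omega> z > \<epsilon>}) \<longlongrightarrow> 0) (at_right 0)"
    using assms(1) by (simp add: small_C2_growth_def)
  show ?thesis
    unfolding small_C2_growth_def
    by (rule tendsto_sandwich[OF _ _ tendsto_const lim]; rule always_eventually; rule allI) (simp, rule le)
qed

lemma vanishing_hessian_subset:
  "tube.vanishing_hessian \<Omega> \<phi> A \<Longrightarrow> B \<subseteq> A \<Longrightarrow> tube \<Omega> U \<Longrightarrow> tube.vanishing_hessian \<Omega> \<phi> B"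
  unfolding tube.vanishing_hessian_def by (meson tendsto_within_subset)

text \<open>The two conditions are first compared at the common exponent \<eta>; the exponent is
  then lowered to \<open>s\<close> on the tangential side, where |z|^2 can be added to the
  weight.\<close>

lemma (in tube) hessian_imp_weight:
  assumes bd: "bounded \<Omega>" and ne: "frontier \<Omega> \<noteq> {}"
    and r: "0 < r" "\<And>z. z \<in> \<Omega> \<Longrightarrow> norm z \<le> r"
    and unique: "\<And>z. z \<in> U \<Longrightarrow> \<exists>!\<xi>. \<xi> \<in> frontier \<Omega> \<and> dist z \<xi> = bdist \<Omega> z"
    and hess: "hessian_condition \<Omega> \<eta> M W \<rho> U\<eta>" and U: "U \<subseteq> U\<eta>"
    and s: "0 < s" "s < \<eta>" "\<eta> < 1" and N: "N < 1 / (2 * r\<^sup>2) * (1 / s - 1 / \<eta>) + M / \<eta>"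
  obtains V \<phi> where "V \<subseteq> U" "weight_condition \<Omega> s N V \<phi>"
proof -
  have W: "C2_defining_function \<Omega> W \<rho>" "U \<subseteq> W" and lev: "\<And>z X. z \<in> U\<eta> \<inter> \<Omega> \<Longrightarrow> levi (lam \<eta> \<rho>) z X \<ge> M * (- lam \<eta> \<rho> z) * tan_norm_sq z X"
    using hess U unfolding hessian_condition_def by auto
  obtain V1 h where V1: "boundary_nbhd \<Omega> V1" "V1 \<subseteq> U" and h: "Ck_on 1 h V1" "\<And>z. z \<in> V1 \<Longrightarrow> h z > 0"
    "\<And>z. z \<in> V1 \<Longrightarrow> \<rho> z = d z * h z"
    using quotient_by_sdist[OF W] by blast
  interpret t1: tube \<Omega> V1 by (rule subtube[OF V1])
  have W1: "V1 \<subseteq> W" using V1 W by auto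
  note h2 = t1.quotient_C2[OF W(1) W1 h(1,3)]
  have o: "open (V1 - frontier \<Omega>)" using t1.open_U by (simp add: open_Diff)
  have sub: "V1 \<inter> \<Omega> \<subseteq> V1 - frontier \<Omega>" using frontier_open_disjoint[OF open_domain] by auto
  \<comment> \<open>Makes \<rho> = d h equal to d e^(-\<psi>).\<close>
  define \<psi> where "\<psi> z = - ln (h z)" for z
  have \<psi>1: "Ck_on 1 \<psi> V1"
    unfolding \<psi>_def[abs_def]
    by (intro Ck_on_uminus Ck_on_compose[OF Ck_on_ln_real h(1)] t1.open_U) (use h(2) in auto)
  have \<psi>2': "Ck_on 2 \<psi> (V1 - frontier \<Omega>)"
    unfolding \<psi>_def[abs_def]
    by (intro Ck_on_uminus Ck_on_compose[OF Ck_on_ln_real h2(1)] o) (use h(2) in auto)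
  have \<psi>2: "Ck_on 2 \<psi> (V1 \<inter> \<Omega>)" by (rule Ck_on_subset[OF \<psi>2' sub])
  have \<psi>van: "t1.vanishing_hessian \<psi> (V1 \<inter> \<Omega>)"
    unfolding \<psi>_def[abs_def]
  proof (rule t1.vanishing_hessian_compose[OF h(1) Ck_on_subset[OF h2(1) sub] h2(2),
        where F = "\<lambda>x. - ln x" and ?F1.0 = "\<lambda>x. - inverse x" and ?F2.0 = "\<lambda>x. inverse x * inverse x" and T = "{0<..}"])
    show "((\<lambda>x. - ln x) has_real_derivative - inverse x) (at x)" if "x \<in> {0<..}" for x :: real
      using that by (auto intro!: derivative_eq_intros simp: divide_inverse)
    show "((\<lambda>x. - inverse x) has_real_derivative inverse x * inverse x) (at x)" if "x \<in> {0<..}" for x :: real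
      using that by (auto intro!: derivative_eq_intros)
  qed (use h(2) in \<open>auto intro!: continuous_intros\<close>)
  have \<rho>: "\<rho> w = d w * exp (- \<psi> w)" if "w \<in> V1 \<inter> \<Omega>" for w
    using h(2,3)[of w] that by (simp add: \<psi>_def)
  define \<kappa> where "\<kappa> = 1 / s - 1 / \<eta>"
  \<comment> \<open>The constant needed before |z|^2 is added; the assumption on \<open>N\<close>
    says precisely that it lies strictly below M/\<eta>.\<close>
  define N1 where "N1 = N - \<kappa> / (2 * r\<^sup>2)"
  have N1: "N1 < M / \<eta>" using N by (simp add: N1_def \<kappa>_def)
  have \<eta>0: "0 < \<eta>" using s by simp
  have Q: "2 * (M / \<eta>) * (norm X)\<^sup>2 \<le> t1.Q_form \<psi> z \<eta> X" if z: "z \<in> V1 \<inter> \<Omega>" for z X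
  proof -
    have "z \<in> U\<eta> \<inter> \<Omega>" using z V1 U by auto
    moreover have "levi (lam \<eta> \<rho>) z X \<ge> M * (- lam \<eta> \<rho> z) * tan_norm_sq z X \<longleftrightarrow>
        2 * (M / \<eta>) * (norm X)\<^sup>2 \<le> t1.Q_form \<psi> z \<eta> X"
      by (rule t1.hessian_iff[OF z \<psi>2 _ \<eta>0]) (rule \<rho>)
    ultimately show ?thesis using lev by blast
  qed
  obtain V2 where V2: "boundary_nbhd \<Omega> V2" "V2 \<subseteq> V1"
    "\<And>z \<tau>. z \<in> V2 \<inter> \<Omega> \<Longrightarrow> \<nu> z \<bullet> \<tau> = 0 \<Longrightarrow> \<nu> z \<bullet> rot \<tau> = 0 \<Longrightarrow>
      2 * N1 * (norm \<tau>)\<^sup>2 + \<eta> / (1 - \<eta>) * t1.R_form \<psi> z \<tau> \<le> t1.T_form \<psi> z \<tau>"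
    using t1.Q_form_imp_T_form[OF bd \<psi>1 \<psi>2 t1.vanishing_imp_small_hessian[OF \<psi>van] \<eta>0 s(3) N1 Q] by blast
  define \<phi> where "\<phi> y = \<psi> y + \<kappa> / (2 * r\<^sup>2) * (norm y)\<^sup>2" for y
  have \<phi>1: "Ck_on 1 \<phi> V1" unfolding \<phi>_def[abs_def] by (rule Ck_on_add_norm_sq[OF \<psi>1 t1.open_U])
  have \<phi>2: "Ck_on 2 \<phi> (V1 - frontier \<Omega>)" unfolding \<phi>_def[abs_def] by (rule Ck_on_add_norm_sq[OF \<psi>2' o])
  have \<phi>van: "t1.vanishing_hessian \<phi> (V1 \<inter> \<Omega>)"
    unfolding \<phi>_def[abs_def] by (rule t1.vanishing_hessian_add_norm_sq[OF \<psi>2 \<psi>van])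
  obtain V3 where V3: "boundary_nbhd \<Omega> V3" "V3 \<subseteq> V1" "small_C2_growth \<Omega> V3 \<phi>"
    using t1.small_C2_growth_near[OF bd ne \<phi>1 \<phi>van] by blast
  define V where "V = V2 \<inter> V3"
  have V: "boundary_nbhd \<Omega> V" "V \<subseteq> V1" "V \<subseteq> V2" "V \<subseteq> V3" using V2 V3 by (auto simp: V_def intro: boundary_nbhd_Int)
  interpret t: tube \<Omega> V by (rule t1.subtube[OF V(1,2)])
  have "tangential_condition \<Omega> s N V \<phi>"
    unfolding t.tangential_condition_iff[OF Ck_on_subset[OF \<phi>2 order_trans[OF Int_mono[OF V(2) order_refl] sub]]]
  proof (intro ballI allI impI)
    fix z \<tau> assume z: "z \<in> V \<inter> \<Omega>" and \<tau>: "\<nu> z \<bullet> \<tau> = 0 \<and> \<nu> z \<bullet> rot \<tau> = 0"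
    have z2: "z \<in> V2 \<inter> \<Omega>" and z1: "z \<in> V1 \<inter> \<Omega>" using z V by auto
    have rz: "norm z \<le> r" using z r(2) by auto
    have sk: "0 < s / (1 - s)" "s / (1 - s) < \<eta> / (1 - \<eta>)" "\<kappa> = 1 / (s / (1 - s)) - 1 / (\<eta> / (1 - \<eta>))"
      using s convexity_quotient_less[of s \<eta>] convexity_quotient_diff[of s \<eta>] by (auto simp: \<kappa>_def)
    have "N1 + \<kappa> / (2 * r\<^sup>2) = N" by (simp add: N1_def)
    with t1.T_form_add_norm_sq[OF z1 \<psi>2 sk r(1) rz V2(3)[OF z2 conjunct1[OF \<tau>] conjunct2[OF \<tau>]]]
    show "2 * N * (norm \<tau>)\<^sup>2 + s / (1 - s) * t.R_form \<phi> z \<tau> \<le> t.T_form \<phi> z \<tau>"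
      unfolding \<phi>_def[abs_def] by simp
  qed
  moreover have "regular_nbhd \<Omega> V"
    unfolding regular_nbhd_def using V(1) t.C2_sdist unique V V1 by blast
  moreover have "small_C2_growth \<Omega> V \<phi>" by (rule small_C2_growth_subset[OF V3(3) V(4)])
  moreover have "Ck_on 1 \<phi> V" "Ck_on 2 \<phi> (V - frontier \<Omega>)"
    by (rule Ck_on_subset[OF \<phi>1 V(2)], rule Ck_on_subset[OF \<phi>2]) (use V in auto)
  ultimately have "weight_condition \<Omega> s N V \<phi>" unfolding weight_condition_def by blast
  moreover have "V \<subseteq> U" using V V1 by auto
  ultimately show thesis using that by blast
qed

text \<open>The order is reversed: the exponent is lowered from \<open>s\<close> to \<eta> while
  still on the tangential side, and only then is the bound carried over to all vectors. The
  resulting defining function lives inside only and has to be extended.\<close>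

lemma (in tube) weight_imp_hessian:
  assumes bd: "bounded \<Omega>"
    and r: "0 < r" "\<And>z. z \<in> \<Omega> \<Longrightarrow> norm z \<le> r"
    and weight: "weight_condition \<Omega> s N Us \<phi>" and U: "U \<subseteq> Us"
    and s: "0 < \<eta>" "\<eta> < s" "s < 1" and M: "M < 1 / (2 * r\<^sup>2) * (1 - \<eta> / s) + \<eta> * N"
  obtains W \<rho> V where "hessian_condition \<Omega> \<eta> M W \<rho> V"
proof -
  have \<phi>Us: "Ck_on 1 \<phi> Us" "Ck_on 2 \<phi> (Us - frontier \<Omega>)" "small_C2_growth \<Omega> Us \<phi>" "tangential_condition \<Omega> s N Us \<phi>"
    using weight by (simp_all add: weight_condition_def)
  have sub: "U \<inter> \<Omega> \<subseteq> Us - frontier \<Omega>" using frontier_open_disjoint[OF open_domain] U by auto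
  have \<phi>1: "Ck_on 1 \<phi> U" by (rule Ck_on_subset[OF \<phi>Us(1) U])
  have \<phi>2: "Ck_on 2 \<phi> (U \<inter> \<Omega>)" by (rule Ck_on_subset[OF \<phi>Us(2) sub])
  have \<phi>van: "vanishing_hessian \<phi> (U \<inter> \<Omega>)"
    by (rule small_imp_vanishing_hessian[OF \<phi>2 small_C2_growth_imp[OF \<phi>Us(3) U]])
  have "tangential_condition \<Omega> s N U \<phi>" using \<phi>Us(4) U unfolding tangential_condition_def by blast
  then have T\<phi>: "2 * N * (norm \<tau>)\<^sup>2 + s / (1 - s) * R_form \<phi> z \<tau> \<le> T_form \<phi> z \<tau>"
    if "z \<in> U \<inter> \<Omega>" "\<nu> z \<bullet> \<tau> = 0" "\<nu> z \<bullet> rot \<tau> = 0" for z \<tau>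
    using that unfolding tangential_condition_iff[OF \<phi>2] by blast
  define \<kappa> where "\<kappa> = 1 / \<eta> - 1 / s"
  define \<psi> where "\<psi> y = \<phi> y + \<kappa> / (2 * r\<^sup>2) * (norm y)\<^sup>2" for y
  have \<psi>1: "Ck_on 1 \<psi> U" unfolding \<psi>_def[abs_def] by (rule Ck_on_add_norm_sq[OF \<phi>1 open_U])
  have \<psi>2: "Ck_on 2 \<psi> (U \<inter> \<Omega>)" unfolding \<psi>_def[abs_def] by (rule Ck_on_add_norm_sq[OF \<phi>2 open_inside])
  have \<psi>van: "vanishing_hessian \<psi> (U \<inter> \<Omega>)"
    unfolding \<psi>_def[abs_def] by (rule vanishing_hessian_add_norm_sq[OF \<phi>2 \<phi>van])
  have sk: "0 < \<eta> / (1 - \<eta>)" "\<eta> / (1 - \<eta>) < s / (1 - s)" "\<kappa> = 1 / (\<eta> / (1 - \<eta>)) - 1 / (s / (1 - s))"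
    using s convexity_quotient_less[of \<eta> s] convexity_quotient_diff[of \<eta> s] by (auto simp: \<kappa>_def)
  have T\<psi>: "2 * (N + \<kappa> / (2 * r\<^sup>2)) * (norm \<tau>)\<^sup>2 + \<eta> / (1 - \<eta>) * R_form \<psi> z \<tau> \<le> T_form \<psi> z \<tau>"
    if z: "z \<in> U \<inter> \<Omega>" and \<tau>: "\<nu> z \<bullet> \<tau> = 0" "\<nu> z \<bullet> rot \<tau> = 0" for z \<tau>
    unfolding \<psi>_def[abs_def]
    by (rule T_form_add_norm_sq[OF z \<phi>2 sk r(1) _ T\<phi>[OF z \<tau>]]) (use z r(2) in auto)
  \<comment> \<open>Dividing by \<eta> turns (1 - \<eta>/s)/(2 r^2) into (1/\<eta> - 1/s)/(2 r^2),
    the gain for the exponents \<eta> and \<open>s\<close>.\<close>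
  have "M / \<eta> < (1 / (2 * r\<^sup>2) * (1 - \<eta> / s) + \<eta> * N) / \<eta>" by (rule divide_strict_right_mono[OF M s(1)])
  also have "\<dots> = N + \<kappa> / (2 * r\<^sup>2)" using s r by (simp add: \<kappa>_def field_simps)
  finally have MN: "M / \<eta> < N + \<kappa> / (2 * r\<^sup>2)" .
  have \<eta>1: "\<eta> < 1" using s by simp
  obtain V1 where V1: "boundary_nbhd \<Omega> V1" "V1 \<subseteq> U"
    "\<And>z X. z \<in> V1 \<inter> \<Omega> \<Longrightarrow> 2 * (M / \<eta>) * (norm X)\<^sup>2 \<le> Q_form \<psi> z \<eta> X"
    using T_form_imp_Q_form[OF bd \<psi>1 \<psi>2 vanishing_imp_small_hessian[OF \<psi>van] s(1) \<eta>1 MN T\<psi>] by blast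
  interpret t: tube \<Omega> V1 by (rule subtube[OF V1(1,2)])
  define g where "g z = exp (- \<psi> z)" for z
  have sub1: "V1 \<inter> \<Omega> \<subseteq> U \<inter> \<Omega>" using V1 by auto
  have \<psi>V: "Ck_on 1 \<psi> V1" "Ck_on 2 \<psi> (V1 \<inter> \<Omega>)" "t.vanishing_hessian \<psi> (V1 \<inter> \<Omega>)"
    by (rule Ck_on_subset[OF \<psi>1 V1(2)], rule Ck_on_subset[OF \<psi>2 sub1],
        rule vanishing_hessian_subset[OF \<psi>van sub1 t.tube_axioms])
  have g1: "Ck_on 1 g V1"
    unfolding g_def[abs_def] by (rule Ck_on_compose[OF Ck_on_exp_real Ck_on_uminus[OF \<psi>V(1) t.open_U] _ t.open_U]) auto
  have g2: "Ck_on 2 g (V1 \<inter> \<Omega>)"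
    unfolding g_def[abs_def] by (rule Ck_on_compose[OF Ck_on_exp_real Ck_on_uminus[OF \<psi>V(2) t.open_inside] _ t.open_inside]) auto
  have gvan: "t.vanishing_hessian g (V1 \<inter> \<Omega>)"
    unfolding g_def[abs_def]
    by (rule t.vanishing_hessian_compose[OF \<psi>V, where F = "\<lambda>x. exp (- x)" and ?F1.0 = "\<lambda>x. - exp (- x)"
          and ?F2.0 = "\<lambda>x. exp (- x)" and T = UNIV])
      (auto intro!: derivative_eq_intros continuous_intros)
  obtain W \<rho> where W: "C2_defining_function \<Omega> W \<rho>" "W \<subseteq> V1" "\<And>z. z \<in> W \<inter> \<Omega> \<Longrightarrow> \<rho> z = d z * g z"
    by (rule t.defining_function_extension[OF bd g1 g2 gvan]) (auto simp: g_def)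
  have Wn: "boundary_nbhd \<Omega> W" using W(1) by (simp add: C2_defining_function_def)
  interpret w: tube \<Omega> W by (rule t.subtube[OF Wn W(2)])
  have "levi (lam \<eta> \<rho>) z X \<ge> M * (- lam \<eta> \<rho> z) * tan_norm_sq z X" if z: "z \<in> W \<inter> \<Omega>" for z X
  proof -
    have \<psi>W: "Ck_on 2 \<psi> (W \<inter> \<Omega>)" by (rule Ck_on_subset[OF \<psi>V(2)]) (use W in auto)
    have "\<rho> w = d w * exp (- \<psi> w)" if "w \<in> W \<inter> \<Omega>" for w using W(3)[OF that] by (simp add: g_def)
    from w.hessian_iff[OF z \<psi>W this s(1)] show ?thesis using V1(3)[of z X] z W(2) by blast
  qed
  then have "hessian_condition \<Omega> \<eta> M W \<rho> W"
    using W(1) Wn unfolding hessian_condition_def by blast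
  then show thesis by (rule that)
qed

lemma regular_tube:
  assumes "open \<Omega>" "C2_boundary \<Omega>" "boundary_nbhd \<Omega> V"
  obtains U where "tube \<Omega> U" "U \<subseteq> V" "\<And>z. z \<in> U \<Longrightarrow> \<exists>!\<xi>. \<xi> \<in> frontier \<Omega> \<and> dist z \<xi> = bdist \<Omega> z"
proof -
  obtain W \<rho> where "C2_defining_function \<Omega> W \<rho>" using assms(2) by (auto simp: C2_boundary_def)
  from tubular_neighborhood[OF this assms(1)] obtain U where U: "regular_nbhd \<Omega> U"
    and rest: "\<And>z. z \<in> U \<Longrightarrow> nearest \<Omega> z \<in> frontier \<Omega>"
    "\<And>z. z \<in> U \<Longrightarrow> norm (grad (sdist \<Omega>) z) = 1"
    "\<And>z. z \<in> U \<Longrightarrow> grad (sdist \<Omega>) (nearest \<Omega> z) = grad (sdist \<Omega>) z"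
    "\<And>z. z \<in> U \<Longrightarrow> z - nearest \<Omega> z = sdist \<Omega> z *\<^sub>R grad (sdist \<Omega>) z" by metis
  interpret tube \<Omega> U by unfold_locales (use assms(1) U rest in \<open>auto simp: regular_nbhd_def\<close>)
  show thesis
  proof (rule that[of "U \<inter> V"])
    show "tube \<Omega> (U \<inter> V)" by (rule subtube[OF boundary_nbhd_Int[OF nbhd assms(3)]]) auto
    show "\<exists>!\<xi>. \<xi> \<in> frontier \<Omega> \<and> dist z \<xi> = bdist \<Omega> z" if "z \<in> U \<inter> V" for z
      using U that unfolding regular_nbhd_def by blast
  qed auto
qed

theorem proposition5p2:
  fixes \<Omega> :: "(complex^'n) set" and r :: real
  assumes "open \<Omega>" and "connected \<Omega>" and "\<Omega> \<noteq> {}" and "bounded \<Omega>"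
    and "C2_boundary \<Omega>" and "pseudoconvex \<Omega>"
    and "r = (SUP z\<in>\<Omega>. norm z)"
  shows
    "(\<forall>\<eta> M W \<rho> U\<^sub>\<eta>.
        0 < \<eta> \<and> \<eta> < 1 \<and> hessian_condition \<Omega> \<eta> M W \<rho> U\<^sub>\<eta> \<longrightarrow>
        (\<forall>s N. 0 < s \<and> s < \<eta> \<and> N < 1 / (2 * r\<^sup>2) * (1 / s - 1 / \<eta>) + M / \<eta> \<longrightarrow>
           (\<exists>U\<^sub>s \<phi>. U\<^sub>s \<subseteq> U\<^sub>\<eta> \<and> weight_condition \<Omega> s N U\<^sub>s \<phi>)))
     \<and>
     (\<forall>s N U\<^sub>s \<phi>.
        0 < s \<and> s < 1 \<and> weight_condition \<Omega> s N U\<^sub>s \<phi> \<longrightarrow>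
        (\<forall>\<eta> M. 0 < \<eta> \<and> \<eta> < s \<and> M < 1 / (2 * r\<^sup>2) * (1 - \<eta> / s) + \<eta> * N \<longrightarrow>
           (\<exists>W \<rho> U\<^sub>\<eta>. hessian_condition \<Omega> \<eta> M W \<rho> U\<^sub>\<eta>)))"
proof -
  have r_ge: "norm z \<le> r" if "z \<in> \<Omega>" for z
  proof -
    have "bdd_above (norm ` \<Omega>)" using assms(4) by (auto simp: bounded_iff bdd_above_def)
    then show ?thesis unfolding assms(7) by (rule cSUP_upper[OF that])
  qed
  \<comment> \<open>Otherwise \<Omega> would be the single point 0, which is not open; positivity is
    needed because the gain divides by r^2.\<close>
  have r_pos: "0 < r"
  proof (rule ccontr)
    assume "\<not> 0 < r"
    then have "z = 0" if "z \<in> \<Omega>" for z using r_ge[OF that] norm_ge_zero[of z] by (metis norm_le_zero_iff order_trans not_less)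
    then have "\<Omega> = {0}" using assms(3) by auto
    then show False using assms(1) not_open_singleton by metis
  qed
  \<comment> \<open>A set with empty boundary is empty or the whole space, and \<Omega> is nonempty
    and bounded.\<close>
  have ne: "frontier \<Omega> \<noteq> {}"
    using assms(3,4) frontier_eq_empty[of \<Omega>] not_bounded_UNIV by auto
  show ?thesis
  proof (intro conjI allI impI; elim conjE)
    fix \<eta> M W \<rho> U\<^sub>\<eta> s N
    assume \<eta>: "0 < \<eta>" "\<eta> < 1" and hess: "hessian_condition \<Omega> \<eta> M W \<rho> U\<^sub>\<eta>"
      and s: "0 < s" "s < \<eta>" "N < 1 / (2 * r\<^sup>2) * (1 / s - 1 / \<eta>) + M / \<eta>"
    have "boundary_nbhd \<Omega> U\<^sub>\<eta>" using hess by (simp add: hessian_condition_def)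
    from regular_tube[OF assms(1,5) this] obtain U where
      U: "tube \<Omega> U" "U \<subseteq> U\<^sub>\<eta>" "\<And>z. z \<in> U \<Longrightarrow> \<exists>!\<xi>. \<xi> \<in> frontier \<Omega> \<and> dist z \<xi> = bdist \<Omega> z" by blast
    obtain V \<phi> where "V \<subseteq> U" "weight_condition \<Omega> s N V \<phi>"
      by (rule tube.hessian_imp_weight[OF U(1) assms(4) ne r_pos r_ge U(3) hess U(2) s(1,2) \<eta>(2) s(3)])
    then show "\<exists>U\<^sub>s \<phi>. U\<^sub>s \<subseteq> U\<^sub>\<eta> \<and> weight_condition \<Omega> s N U\<^sub>s \<phi>" using U(2) by blast
  next
    fix s N U\<^sub>s \<phi> \<eta> M
    assume s: "0 < s" "s < 1" and weight: "weight_condition \<Omega> s N U\<^sub>s \<phi>"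
      and \<eta>: "0 < \<eta>" "\<eta> < s" "M < 1 / (2 * r\<^sup>2) * (1 - \<eta> / s) + \<eta> * N"
    have "boundary_nbhd \<Omega> U\<^sub>s" using weight by (simp add: weight_condition_def regular_nbhd_def)
    from regular_tube[OF assms(1,5) this] obtain U where
      U: "tube \<Omega> U" "U \<subseteq> U\<^sub>s" "\<And>z. z \<in> U \<Longrightarrow> \<exists>!\<xi>. \<xi> \<in> frontier \<Omega> \<and> dist z \<xi> = bdist \<Omega> z" by blast
    show "\<exists>W \<rho> U\<^sub>\<eta>. hessian_condition \<Omega> \<eta> M W \<rho> U\<^sub>\<eta>"
      by (rule tube.weight_imp_hessian[OF U(1) assms(4) r_pos r_ge weight U(2) \<eta>(1,2) s(2) \<eta>(3)]) blast+
  qed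
qed

end
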